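(* Let $R>0$, $T_0>0$, $b>1$, $M>1$. Let $\mathbf{F}\in H^4([0,\infty);H^1(\mathbb{R}^3))^3$ be real-valued with $\operatorname{supp}\mathbf{F}\subset B_R\times(0,T_0)$, $\nabla\cdot\mathbf{F}=0$ (divergence in $\mathbf{x}$) and $\|\mathbf{F}\|_{H^4([0,\infty);H^1(\mathbb{R}^3))^3}\le M$. For each $n\in(0,b^2)$ let $\mathbf{E}(\cdot,\cdot;n)$ be the solution of $$n\partial_t^2\mathbf{E}+\nabla\times(\nabla\times\mathbf{E})=\mathbf{F}(\mathbf{x},t),\quad (\mathbf{x},t)\in\mathbb{R}^3\times(0,\infty),\qquad \mathbf{E}(\mathbf{x},0)=\partial_t\mathbf{E}(\mathbf{x},0)=0.$$ Let $T>2Rn+T_0$ and define $$\epsilon=\sup_{n\in(0,b^2)}\Big(\int_0^T\int_{\partial B_R}\big(|(\nabla\times\mathbf{E}(\cdot,\cdot;n))\times\nu|^2+|\mathbf{E}(\cdot,\cdot;n)\times\nu|^2\big)\,ds(\mathbf{x})\,dt\Big)^{1/2},$$ and assume $0<\epsilon<1$. Then there is a constant $C>0$ depending only on $T_0$ and $R$ such that $$\|\mathbf{F}\|_{L^2(\mathbb{R}^4)}^2\le C\Big(b^{11}\epsilon^2+\frac{M^2}{b\,|\ln\epsilon|^{2/5}}\Big).$$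
   Context: $B_R=\{\mathbf{x}\in\mathbb{R}^3:|\mathbf{x}|<R\}$, $\nu$ is the outward unit normal on $\partial B_R$, $ds$ surface measure. The norm $\|\mathbf{F}\|_{L^2(\mathbb{R}^4)}$ is the $L^2$ norm over $(\mathbf{x},t)\in\mathbb{R}^3\times\mathbb{R}$ (with $\mathbf{F}$ extended by zero). *)

theory Defs
  imports "HOL-Analysis.Analysis"
begin

type_synonym pt = "(real^3) \<times> real"

primrec dderivs :: "'a list \<Rightarrow> ('a::real_normed_vector \<Rightarrow> 'b::real_normed_vector) \<Rightarrow> 'a \<Rightarrow> 'b" where
  "dderivs [] f = f"
| "dderivs (v # vs) f = (\<lambda>x. frechet_derivative (dderivs vs f) (at x) v)"

definition smooth_fun :: "('a::real_normed_vector \<Rightarrow> 'b::real_normed_vector) \<Rightarrow> bool" where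
  "smooth_fun f \<longleftrightarrow> (\<forall>vs x. dderivs vs f differentiable (at x))"

definition test_fun :: "(pt \<Rightarrow> 'b::real_normed_vector) \<Rightarrow> bool" where
  "test_fun \<phi> \<longleftrightarrow> smooth_fun \<phi> \<and> compact (closure {p. \<phi> p \<noteq> 0})"

definition test_fun_pos :: "(pt \<Rightarrow> real) \<Rightarrow> bool" where
  "test_fun_pos \<phi> \<longleftrightarrow> test_fun \<phi> \<and> closure {p. \<phi> p \<noteq> 0} \<subseteq> {p. 0 < snd p}"

definition sderiv :: "3 \<Rightarrow> (pt \<Rightarrow> 'b::real_normed_vector) \<Rightarrow> pt \<Rightarrow> 'b" where
  "sderiv j f p = frechet_derivative (\<lambda>y. f (y, snd p)) (at (fst p)) (axis j 1)"

definition tderiv :: "(pt \<Rightarrow> 'b::real_normed_vector) \<Rightarrow> pt \<Rightarrow> 'b" where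
  "tderiv f p = frechet_derivative (\<lambda>s. f (fst p, s)) (at (snd p)) 1"

definition curlx :: "(pt \<Rightarrow> real^3) \<Rightarrow> pt \<Rightarrow> real^3" where
  "curlx f p = vector [sderiv 2 f p $ 3 - sderiv 3 f p $ 2,
                       sderiv 3 f p $ 1 - sderiv 1 f p $ 3,
                       sderiv 1 f p $ 2 - sderiv 2 f p $ 1]"

definition weak_sderiv :: "3 \<Rightarrow> (pt \<Rightarrow> real^3) \<Rightarrow> (pt \<Rightarrow> real^3) \<Rightarrow> bool" where
  "weak_sderiv j u g \<longleftrightarrow> (\<forall>\<phi>. test_fun_pos \<phi> \<longrightarrow>
      (\<integral>p. sderiv j \<phi> p *\<^sub>R u p \<partial>lborel) = - (\<integral>p. \<phi> p *\<^sub>R g p \<partial>lborel))"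

definition weak_tderiv :: "(pt \<Rightarrow> real^3) \<Rightarrow> (pt \<Rightarrow> real^3) \<Rightarrow> bool" where
  "weak_tderiv u g \<longleftrightarrow> (\<forall>\<phi>. test_fun_pos \<phi> \<longrightarrow>
      (\<integral>p. tderiv \<phi> p *\<^sub>R u p \<partial>lborel) = - (\<integral>p. \<phi> p *\<^sub>R g p \<partial>lborel))"

text \<open>L^2 on R^3 x (0,\<infinity>), represented by the zero extension to t \<le> 0.\<close>
definition L2_pos :: "(pt \<Rightarrow> real^3) \<Rightarrow> bool" where
  "L2_pos u \<longleftrightarrow> u \<in> borel_measurable lborel \<and> integrable lborel (\<lambda>p. (norm (u p))\<^sup>2)
     \<and> (\<forall>p. snd p \<le> 0 \<longrightarrow> u p = 0)"

definition L2sq :: "(pt \<Rightarrow> real^3) \<Rightarrow> real" where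
  "L2sq u = (\<integral>p. (norm (u p))\<^sup>2 \<partial>lborel)"

text \<open>F \<in> H^4([0,\<infinity>);H^1(R^3))^3 with norm \<le> M. D k = \<partial>_t^k F, G k j = \<partial>_{x_j} \<partial>_t^k F;
  squared norm = \<Sum>_{k\<le>4} (\<parallel>\<partial>_t^k F\<parallel>^2_{L^2} + \<parallel>\<nabla>_x \<partial>_t^k F\<parallel>^2_{L^2}).\<close>
definition H4H1_bound :: "(pt \<Rightarrow> real^3) \<Rightarrow> real \<Rightarrow> bool" where
  "H4H1_bound F M \<longleftrightarrow> (\<exists>(D::nat \<Rightarrow> pt \<Rightarrow> real^3) (G::nat \<Rightarrow> 3 \<Rightarrow> pt \<Rightarrow> real^3).
      D 0 = F
    \<and> (\<forall>k\<le>4. L2_pos (D k) \<and> (\<forall>j. L2_pos (G k j) \<and> weak_sderiv j (D k) (G k j)))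
    \<and> (\<forall>k<4. weak_tderiv (D k) (D (Suc k)))
    \<and> (\<Sum>k\<le>4. L2sq (D k) + (\<Sum>j\<in>UNIV. L2sq (G k j))) \<le> M\<^sup>2)"

definition div_free :: "(pt \<Rightarrow> real^3) \<Rightarrow> bool" where
  "div_free F \<longleftrightarrow> (\<forall>\<phi>::pt \<Rightarrow> real. test_fun \<phi> \<longrightarrow>
      (\<Sum>j\<in>UNIV. \<integral>p. sderiv j \<phi> p * F p $ j \<partial>lborel) = 0)"

text \<open>E is the (causal) solution of n E_tt + curl curl E = F, E(0)=E_t(0)=0, extended by zero
  to t \<le> 0; the equation holds in the sense of distributions on all of R^4 (this encodes the
  zero initial data). E is taken as its continuous representative, C^1 in x with jointly
  continuous spatial derivatives, so that traces on the sphere are pointwise values.\<close>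
definition maxwell_sol :: "real \<Rightarrow> (pt \<Rightarrow> real^3) \<Rightarrow> (pt \<Rightarrow> real^3) \<Rightarrow> bool" where
  "maxwell_sol n F E \<longleftrightarrow>
      continuous_on UNIV E
    \<and> (\<forall>p. snd p \<le> 0 \<longrightarrow> E p = 0)
    \<and> (\<forall>x t. (\<lambda>y. E (y, t)) differentiable (at x))
    \<and> (\<forall>j. continuous_on UNIV (sderiv j E))
    \<and> (\<forall>\<Phi>::pt \<Rightarrow> real^3. test_fun \<Phi> \<longrightarrow>
         (\<integral>p. E p \<bullet> (n *\<^sub>R tderiv (tderiv \<Phi>) p + curlx (curlx \<Phi>) p) \<partial>lborel)
           = (\<integral>p. F p \<bullet> \<Phi> p \<partial>lborel))"

text \<open>\<int>_0^T \<int>_{\<partial>B_R} (|curl E \<times> \<nu>|^2 + |E \<times> \<nu>|^2) ds dt, surface measure in spherical coordinates.\<close>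
definition bdry_int :: "real \<Rightarrow> (pt \<Rightarrow> real^3) \<Rightarrow> real \<Rightarrow> real" where
  "bdry_int R E T = integral ({0..T} \<times> {0..pi} \<times> {0..2*pi})
     (\<lambda>(t, \<theta>, \<phi>).
        let \<nu> = (vector [sin \<theta> * cos \<phi>, sin \<theta> * sin \<phi>, cos \<theta>] :: real^3);
            y = R *\<^sub>R \<nu>
        in ((norm (cross3 (curlx E (y, t)) \<nu>))\<^sup>2 + (norm (cross3 (E (y, t)) \<nu>))\<^sup>2) * R\<^sup>2 * sin \<theta>)"

end

theory Submission
  imports Defs
begin

text \<open>
  Let \<open>s\<close> and \<open>d\<close> be orthogonal vectors in space with \<open>|s|\<^sup>2 = n\<close>. The plane wave
  \<open>\<psi>(t - s \<bullet> x) d\<close> solves the homogeneous Maxwell system. Testing the weak equation with this wave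
  times a radial cutoff that shrinks to the sphere expresses \<open>\<integral> \<psi>(t - s \<bullet> x) d \<bullet> F\<close> through the
  tangential traces of \<open>E\<close> and \<open>curl E\<close> on the sphere. For \<open>\<psi>\<close> of compact support equal to a cosine
  on the times that matter, this bounds the Fourier transform of \<open>F\<close> at \<open>(\<xi>, \<omega>)\<close> in the directions
  orthogonal to \<open>\<xi>\<close>, as long as \<open>|\<xi>| < b |\<omega>|\<close>; in the direction of \<open>\<xi>\<close> it vanishes because \<open>F\<close>
  is divergence free. The remaining low temporal frequencies are reached by Lagrange extrapolation in
  \<open>\<omega>\<close>, which is effective because \<open>F\<close> lives in a bounded time interval. A cosine expansion on a
  cube, with Bessel's inequality for the first derivatives controlling the tail, turns the Fourier
  bounds into an \<open>L\<^sup>2\<close> bound with spatial cutoff \<open>\<rho>\<close>, and \<open>\<rho>\<^sup>2 = b |ln \<epsilon>| powr (2/5)\<close> balances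
  the two contributions.
\<close>

section \<open>Smooth cutoff functions\<close>

text \<open>A wave with slowness \<open>s\<close> reads the transform of \<open>F\<close> at
  \<open>(\<xi>, \<omega>)\<close> with \<open>\<xi> = - \<omega> s\<close>, so the data cover only
  a double cone around the frequency axis of time. Stopping at \<open>norm s \<le> b / 2\<close>
  leaves time for the wave to be switched off before the measurements end. The obstacle is the price
  of the missing frequencies: filling \<open>|\<omega>| < 4 * \<rho> / b\<close> with
  \<open>N\<close> nodes multiplies the data by \<open>12 ^ N\<close> and leaves an error of order
  \<open>12 ^ N * (12 * \<rho> * T0 / b) ^ N / fact N\<close>, while the final constant may depend
  on neither \<open>b\<close> nor \<open>\<epsilon>\<close>. Let \<open>s\<close> now stand for
  \<open>|ln \<epsilon>| powr (1/5)\<close>, so that \<open>\<rho>\<^sup>2 = b * s\<^sup>2\<close>.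
  If \<open>s ^ 4 \<le> b\<close>, then \<open>\<rho> / b\<close> is at most
  \<open>b powr (-1/4)\<close>, a fixed \<open>N\<close> suffices, and powers of \<open>b\<close>
  pay for everything. If \<open>b < s ^ 4\<close>, all powers of \<open>b\<close> and
  \<open>\<rho>\<close> are dominated by powers of \<open>s\<close>; \<open>N\<close> grows like
  \<open>s ^ 5\<close>, and the decay of \<open>\<epsilon>\<^sup>2 = exp (- 2 * s ^ 5)\<close> pays.
  As long as \<open>b * s\<^sup>2\<close> stays bounded, the a priori bound by
  \<open>M\<^sup>2\<close> is enough.\<close>

definition flat :: "nat \<Rightarrow> real \<Rightarrow> real" where
  "flat m x = (if x \<le> 0 then 0 else exp (- 1 / x) / x ^ m)"

lemma flat_nonneg [simp]: "0 \<le> flat m x"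
  by (simp add: flat_def)

lemma flat_pos_iff [simp]: "0 < flat m x \<longleftrightarrow> 0 < x"
  by (simp add: flat_def)

lemma flat_nonpos_arg: "x \<le> 0 \<Longrightarrow> flat m x = 0"
  by (simp add: flat_def)

lemma flat_tendsto_0: "(flat m \<longlongrightarrow> 0) (at 0)"
proof -
  have "((\<lambda>u::real. u ^ m / exp u) \<longlongrightarrow> 0) at_top"
    by (rule tendsto_power_div_exp_0)
  then have "((\<lambda>x::real. (inverse x) ^ m / exp (inverse x)) \<longlongrightarrow> 0) (at_right 0)"
    by (rule filterlim_compose[OF _ filterlim_inverse_at_top_right])
  then have "(flat m \<longlongrightarrow> 0) (at_right 0)"
  proof (rule Lim_transform_eventually)
    show "\<forall>\<^sub>F x in at_right 0. inverse x ^ m / exp (inverse x) = flat m x"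
      by (auto simp: eventually_at_filter flat_def exp_minus field_simps)
  qed
  moreover have "(flat m \<longlongrightarrow> 0) (at_left 0)"
    by (rule Lim_transform_eventually[OF tendsto_const])
       (auto simp: eventually_at_filter flat_def)
  ultimately show ?thesis
    by (simp add: filterlim_split_at)
qed

text \<open>The exponent \<open>m\<close> is carried in \<open>flat\<close> so that the family is
  closed under differentiation: differentiating \<open>exp (- 1 / x) / x ^ m\<close> only produces
  higher negative powers of \<open>x\<close>.\<close>

lemma flat_deriv:
  "(flat m has_real_derivative (flat (m + 2) x - real m * flat (m + 1) x)) (at x)"
proof (cases x "0::real" rule: linorder_cases)
  case less
  have "((\<lambda>x. 0) has_real_derivative (flat (m + 2) x - real m * flat (m + 1) x)) (at x)"
    using less by (auto simp: flat_def)
  then show ?thesis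
    by (rule has_field_derivative_transform_within_open[where S = "{..<0}"])
       (use less in \<open>auto simp: flat_def\<close>)
next
  case equal
  \<comment> \<open>At the origin the difference quotient of \<open>flat m\<close> is
    \<open>flat (m + 1)\<close> itself, so the limit already known settles
    differentiability.\<close>
  have "((\<lambda>h. (flat m (0 + h) - flat m 0) / h) \<longlongrightarrow> 0) (at 0)"
  proof (rule Lim_transform_eventually[OF flat_tendsto_0[of "m + 1"]])
    show "\<forall>\<^sub>F h in at 0. flat (m + 1) h = (flat m (0 + h) - flat m 0) / h"
      by (auto simp: eventually_at_filter flat_def)
  qed
  then show ?thesis
    using equal by (auto simp: DERIV_def flat_def)
next
  case greater
  have dinv: "((\<lambda>x. - 1 / x) has_real_derivative 1 / x\<^sup>2) (at x)"
    by (rule derivative_eq_intros refl | use greater in \<open>simp add: power2_eq_square\<close>)+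
  have dexp: "((\<lambda>x. exp (- 1 / x)) has_real_derivative exp (- 1 / x) * (1 / x\<^sup>2)) (at x)"
    by (rule DERIV_chain2[OF DERIV_exp dinv])
  have dpow: "((\<lambda>x. x ^ m) has_real_derivative real m * x ^ (m - 1)) (at x)"
    using DERIV_pow[of m x] by simp
  have "((\<lambda>x. exp (- 1 / x) / x ^ m) has_real_derivative
      (exp (- 1 / x) * (1 / x\<^sup>2) * x ^ m - exp (- 1 / x) * (real m * x ^ (m - 1))) / (x ^ m * x ^ m)) (at x)"
    by (rule DERIV_divide[OF dexp dpow]) (use greater in simp)
  also have "(exp (- 1 / x) * (1 / x\<^sup>2) * x ^ m - exp (- 1 / x) * (real m * x ^ (m - 1))) / (x ^ m * x ^ m)
      = flat (m + 2) x - real m * flat (m + 1) x"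
    using greater by (cases m) (auto simp: flat_def field_simps power2_eq_square)
  finally have "((\<lambda>x. exp (- 1 / x) / x ^ m) has_real_derivative
      (flat (m + 2) x - real m * flat (m + 1) x)) (at x)" .
  then show ?thesis
    by (rule has_field_derivative_transform_within_open[where S = "{0<..}"])
       (use greater in \<open>auto simp: flat_def\<close>)
qed

lemma has_derivative_compose_real:
  assumes "(f has_derivative D) (at x)" "(g has_real_derivative c) (at (f x))"
  shows "((\<lambda>x. g (f x)) has_derivative (\<lambda>v. c * D v)) (at x)"
  using has_derivative_compose[OF assms(1), of g "(*) c"] assms(2)
  by (simp add: has_field_derivative_def)

text \<open>A class of functions closed under directional derivatives, so that smoothness follows by induction.\<close>

inductive smooth_expr :: "('a::euclidean_space \<Rightarrow> real) \<Rightarrow> bool" where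
  const: "smooth_expr (\<lambda>_. c)"
| inner: "smooth_expr (\<lambda>x. x \<bullet> b)"
| add: "smooth_expr f \<Longrightarrow> smooth_expr g \<Longrightarrow> smooth_expr (\<lambda>x. f x + g x)"
| mult: "smooth_expr f \<Longrightarrow> smooth_expr g \<Longrightarrow> smooth_expr (\<lambda>x. f x * g x)"
| cos: "smooth_expr f \<Longrightarrow> smooth_expr (\<lambda>x. cos (f x))"
| sin: "smooth_expr f \<Longrightarrow> smooth_expr (\<lambda>x. sin (f x))"
| flat: "smooth_expr f \<Longrightarrow> smooth_expr (\<lambda>x. flat m (f x))"
| inverse: "smooth_expr f \<Longrightarrow> (\<And>x. f x \<noteq> 0) \<Longrightarrow> smooth_expr (\<lambda>x. inverse (f x))"

lemma smooth_expr_cmult: "smooth_expr f \<Longrightarrow> smooth_expr (\<lambda>x. c * f x)"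
  by (intro smooth_expr.mult smooth_expr.const)

lemma smooth_expr_uminus: "smooth_expr f \<Longrightarrow> smooth_expr (\<lambda>x. - f x)"
  using smooth_expr_cmult[of f "-1"] by simp

lemma smooth_expr_diff: "smooth_expr f \<Longrightarrow> smooth_expr g \<Longrightarrow> smooth_expr (\<lambda>x. f x - g x)"
  using smooth_expr.add[OF _ smooth_expr_uminus, of f g] by simp

text \<open>The induction carries an explicit derivative \<open>D\<close>, to which the sum, product
  and chain rules apply directly; uniqueness identifies it with \<open>frechet_derivative\<close>
  afterwards.\<close>

lemma smooth_expr_derivative:
  "smooth_expr f \<Longrightarrow> \<exists>D. (\<forall>x. (f has_derivative D x) (at x)) \<and> (\<forall>v. smooth_expr (\<lambda>x. D x v))"
proof (induction rule: smooth_expr.induct)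
  case (const c)
  show ?case by (rule exI[of _ "\<lambda>x v. 0"]) (auto intro: smooth_expr.const)
next
  case (inner b)
  show ?case
    by (rule exI[of _ "\<lambda>x v. v \<bullet> b"]) (auto intro!: smooth_expr.const derivative_eq_intros)
next
  case (add f g)
  then obtain D E where "\<forall>x. (f has_derivative D x) (at x)" "\<forall>v. smooth_expr (\<lambda>x. D x v)"
    "\<forall>x. (g has_derivative E x) (at x)" "\<forall>v. smooth_expr (\<lambda>x. E x v)" by blast
  then show ?case
    by (intro exI[of _ "\<lambda>x v. D x v + E x v"])
       (auto intro!: smooth_expr.add has_derivative_add)
next
  case (mult f g)
  then obtain D E where "\<forall>x. (f has_derivative D x) (at x)" "\<forall>v. smooth_expr (\<lambda>x. D x v)"
    "\<forall>x. (g has_derivative E x) (at x)" "\<forall>v. smooth_expr (\<lambda>x. E x v)" by blast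
  with mult.hyps show ?case
    by (intro exI[of _ "\<lambda>x v. f x * E x v + D x v * g x"])
       (auto intro!: smooth_expr.add smooth_expr.mult has_derivative_mult)
next
  case (cos f)
  then obtain D where "\<forall>x. (f has_derivative D x) (at x)" "\<forall>v. smooth_expr (\<lambda>x. D x v)" by blast
  with cos.hyps show ?case
    by (intro exI[of _ "\<lambda>x v. - sin (f x) * D x v"])
       (auto intro!: smooth_expr.mult smooth_expr.sin smooth_expr_uminus
             has_derivative_compose_real derivative_eq_intros)
next
  case (sin f)
  then obtain D where "\<forall>x. (f has_derivative D x) (at x)" "\<forall>v. smooth_expr (\<lambda>x. D x v)" by blast
  with sin.hyps show ?case
    by (intro exI[of _ "\<lambda>x v. cos (f x) * D x v"])
       (auto intro!: smooth_expr.mult smooth_expr.cos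
             has_derivative_compose_real derivative_eq_intros)
next
  case (flat f m)
  then obtain D where "\<forall>x. (f has_derivative D x) (at x)" "\<forall>v. smooth_expr (\<lambda>x. D x v)" by blast
  with flat.hyps show ?case
    by (intro exI[of _ "\<lambda>x v. (flat (m + 2) (f x) - real m * flat (m + 1) (f x)) * D x v"])
       (auto intro!: smooth_expr.mult smooth_expr.flat smooth_expr_diff smooth_expr.const
             has_derivative_compose_real[where g = "flat m"] simp del: add_2_eq_Suc' One_nat_def
             simp add: flat_deriv)
next
  case (inverse f)
  then obtain D where "\<forall>x. (f has_derivative D x) (at x)" "\<forall>v. smooth_expr (\<lambda>x. D x v)" by blast
  with inverse.hyps show ?case
    by (intro exI[of _ "\<lambda>x v. (- (inverse (f x) * inverse (f x))) * D x v"])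
       (auto intro!: smooth_expr.mult smooth_expr.inverse smooth_expr_uminus
             has_derivative_compose_real derivative_eq_intros simp: power2_eq_square)
qed

lemma smooth_expr_has_derivative:
  assumes "smooth_expr f" shows "(f has_derivative frechet_derivative f (at x)) (at x)"
proof -
  have "f differentiable (at x)"
    using smooth_expr_derivative[OF assms] by (auto simp: differentiable_def)
  then show ?thesis by (simp add: frechet_derivative_works)
qed

lemma smooth_expr_differentiable: "smooth_expr f \<Longrightarrow> f differentiable (at x)"
  by (auto simp: differentiable_def dest: smooth_expr_has_derivative)

lemma smooth_expr_frechet:
  assumes "smooth_expr f" shows "smooth_expr (\<lambda>x. frechet_derivative f (at x) v)"
proof -
  obtain D where D: "\<forall>x. (f has_derivative D x) (at x)" "\<forall>v. smooth_expr (\<lambda>x. D x v)"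
    using smooth_expr_derivative[OF assms] by blast
  have "frechet_derivative f (at x) = D x" for x
    using D(1) frechet_derivative_at by metis
  with D show ?thesis by simp
qed

lemma smooth_expr_continuous: "smooth_expr f \<Longrightarrow> continuous_on S f"
  by (intro continuous_at_imp_continuous_on ballI differentiable_imp_continuous_within smooth_expr_differentiable)

text \<open>Every iterated derivative of a scalar function times a fixed vector keeps the direction
  \<open>d\<close>, so the scalar class also serves vector-valued test functions.\<close>

lemma smooth_expr_scaleR_dderivs:
  assumes "smooth_expr f"
  shows "\<exists>g. smooth_expr g \<and> dderivs vs (\<lambda>x. f x *\<^sub>R d) = (\<lambda>x. g x *\<^sub>R d)"
proof (induction vs)
  case Nil
  show ?case by (rule exI[of _ f]) (simp add: assms)
next
  case (Cons v vs)
  then obtain g where g: "smooth_expr g" "dderivs vs (\<lambda>x. f x *\<^sub>R d) = (\<lambda>x. g x *\<^sub>R d)" by blast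
  have "((\<lambda>x. g x *\<^sub>R d) has_derivative (\<lambda>v. frechet_derivative g (at x) v *\<^sub>R d)) (at x)" for x
    by (intro has_derivative_scaleR_left smooth_expr_has_derivative g)
  then have "frechet_derivative (\<lambda>x. g x *\<^sub>R d) (at x) = (\<lambda>v. frechet_derivative g (at x) v *\<^sub>R d)" for x
    by (rule frechet_derivative_at[symmetric])
  then show ?case
    by (intro exI[of _ "\<lambda>x. frechet_derivative g (at x) v"])
       (simp add: g(2) smooth_expr_frechet[OF g(1)])
qed

lemma smooth_fun_scaleR:
  assumes "smooth_expr f" shows "smooth_fun (\<lambda>x. f x *\<^sub>R d)"
  unfolding smooth_fun_def
proof (intro allI)
  fix vs x
  obtain g where g: "smooth_expr g" "dderivs vs (\<lambda>x. f x *\<^sub>R d) = (\<lambda>x. g x *\<^sub>R d)"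
    using smooth_expr_scaleR_dderivs[OF assms] by blast
  show "dderivs vs (\<lambda>x. f x *\<^sub>R d) differentiable at x"
    unfolding g(2)
    by (rule differentiableI[OF has_derivative_scaleR_left[OF smooth_expr_has_derivative[OF g(1)]]])
qed

lemma test_fun_scaleR:
  assumes "smooth_expr f" "bounded {p. f p \<noteq> 0}"
  shows "test_fun (\<lambda>p. f p *\<^sub>R d)"
  unfolding test_fun_def
proof
  have "bounded {p. f p *\<^sub>R d \<noteq> 0}" by (rule bounded_subset[OF assms(2)]) auto
  then show "compact (closure {p. f p *\<^sub>R d \<noteq> 0})" by (simp add: compact_closure)
qed (rule smooth_fun_scaleR[OF assms(1)])

lemma test_fun_smooth_expr:
  fixes f :: "pt \<Rightarrow> real"
  assumes "smooth_expr f" "bounded {p. f p \<noteq> 0}"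
  shows "test_fun f"
  using test_fun_scaleR[OF assms, of "1::real"] by simp

section \<open>The smooth step and its derivative\<close>

definition step :: "real \<Rightarrow> real" where
  "step x = flat 0 x * inverse (flat 0 x + flat 0 (1 - x))"

text \<open>The derivative of \<open>step\<close>, put into a form in which nonnegativity and
  membership in the smooth class are visible.\<close>

definition bump :: "real \<Rightarrow> real" where
  "bump x = (flat 2 x * flat 0 (1 - x) + flat 0 x * flat 2 (1 - x)) * inverse (flat 0 x + flat 0 (1 - x)) ^ 2"

lemma flat_sum_pos: "0 < flat 0 x + flat 0 (1 - x)"
  by (cases "0 < x") (auto intro: add_pos_nonneg add_nonneg_pos)

lemma flat_sum_ne: "flat 0 x + flat 0 (1 - x) \<noteq> 0"
  using flat_sum_pos[of x] by simp

lemma step_deriv: "(step has_real_derivative bump x) (at x)"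
proof -
  have d0: "(flat 0 has_real_derivative flat 2 y) (at y)" for y
    using flat_deriv[of 0 y] by (simp add: numeral_2_eq_2)
  have d1: "((\<lambda>x. flat 0 (1 - x)) has_real_derivative - flat 2 (1 - x)) (at x)"
    using DERIV_chain2[where f = "flat 0" and g = "\<lambda>x. 1 - x", OF d0 DERIV_diff[OF DERIV_const DERIV_ident]]
    by simp
  have alg: "c * inverse (a + b) + - (inverse (a + b) * (c + - e) * inverse (a + b)) * a
      = (c * b + a * e) * (inverse (a + b))\<^sup>2" if "a + b \<noteq> 0" for a b c e :: real
  proof -
    define s where "s = inverse (a + b)"
    have "c * s = c * (s * s * (a + b))" using that by (simp add: s_def)
    then have "c * s + - (s * (c + - e) * s) * a = c * (s * s * (a + b)) + - (s * (c + - e) * s) * a"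
      by simp
    also have "\<dots> = (c * b + a * e) * s\<^sup>2" by (simp add: algebra_simps power2_eq_square)
    finally show ?thesis unfolding s_def .
  qed
  show ?thesis
    unfolding step_def[abs_def] bump_def alg[OF flat_sum_ne, symmetric]
    by (rule DERIV_mult[OF d0 DERIV_inverse'[OF DERIV_add[OF d0 d1] flat_sum_ne]])
qed

lemma step_0: "x \<le> 0 \<Longrightarrow> step x = 0"
  by (simp add: step_def flat_nonpos_arg)

lemma step_1: "1 \<le> x \<Longrightarrow> step x = 1"
  using flat_sum_ne[of x] by (simp add: step_def flat_nonpos_arg)

lemma step_nonneg: "0 \<le> step x"
  by (simp add: step_def)

lemma step_le_1: "step x \<le> 1"
  using flat_sum_pos[of x] by (simp add: step_def field_simps)

lemma bump_nonneg: "0 \<le> bump x"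
  by (simp add: bump_def)

lemma bump_0: "x \<le> 0 \<or> 1 \<le> x \<Longrightarrow> bump x = 0"
  by (auto simp: bump_def flat_nonpos_arg)

lemma smooth_expr_step:
  "smooth_expr f \<Longrightarrow> smooth_expr (\<lambda>x. step (f x))"
  unfolding step_def
  by (intro smooth_expr.mult smooth_expr.flat smooth_expr.inverse smooth_expr.add
      smooth_expr_diff smooth_expr.const flat_sum_ne)

lemma smooth_expr_bump:
  "smooth_expr f \<Longrightarrow> smooth_expr (\<lambda>x. bump (f x))"
  unfolding bump_def power2_eq_square
  by (intro smooth_expr.mult smooth_expr.flat smooth_expr.inverse smooth_expr.add
      smooth_expr_diff smooth_expr.const flat_sum_ne)

lemma continuous_bump: "continuous_on S bump"
proof -
  have "smooth_expr (\<lambda>x::real. x \<bullet> 1)" by (rule smooth_expr.inner)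
  then have "smooth_expr (\<lambda>x::real. bump x)" using smooth_expr_bump by force
  then show ?thesis by (rule smooth_expr_continuous)
qed

lemma bump_bounded: obtains B where "B > 0" "\<And>x. bump x \<le> B"
proof -
  have "compact (bump ` {0..1})" by (intro compact_continuous_image continuous_bump) simp
  then obtain B where B: "\<And>x. x \<in> {0..1} \<Longrightarrow> norm (bump x) \<le> B"
    by (metis compact_imp_bounded bounded_iff imageI)
  have "bump x \<le> max B 1" for x
    using B[of x] bump_0[of x] by (cases "x \<in> {0..1}") auto
  then show ?thesis using that[of "max B 1"] by auto
qed

lemma smooth_expr_norm2:
  "smooth_expr (\<lambda>p::pt. fst p \<bullet> fst p)"
proof -
  have eq: "(\<lambda>p::pt. fst p \<bullet> fst p) =
    (\<lambda>p. (p \<bullet> (axis 1 1, 0)) * (p \<bullet> (axis 1 1, 0)) + (p \<bullet> (axis 2 1, 0)) * (p \<bullet> (axis 2 1, 0))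
       + (p \<bullet> (axis 3 1, 0)) * (p \<bullet> (axis 3 1, 0)))"
    by (auto simp: fun_eq_iff inner_axis inner_vec_def sum_3 axis_def)
  show ?thesis unfolding eq
    by (intro smooth_expr.add smooth_expr.mult smooth_expr.inner)
qed

section \<open>Integration by parts for the curl\<close>

lemma integrable_continuous_bounded_support:
  fixes f :: "'a::euclidean_space \<Rightarrow> 'b::{banach,second_countable_topology}"
  assumes "continuous_on UNIV f" "bounded K" "\<And>x. x \<notin> K \<Longrightarrow> f x = 0"
  shows "integrable lborel f"
proof -
  have "integrable lborel (\<lambda>x. indicator (closure K) x *\<^sub>R f x)"
    by (rule borel_integrable_compact) (use assms in \<open>auto simp: compact_closure intro: continuous_on_subset\<close>)
  also have "(\<lambda>x. indicator (closure K) x *\<^sub>R f x) = f"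
    using assms(3) closure_subset[of K] by (auto simp: indicator_def fun_eq_iff)
  finally show ?thesis .
qed

lemma lborel_integral_translate:
  fixes f :: "'a::euclidean_space \<Rightarrow> real"
  assumes "f \<in> borel_measurable borel"
  shows "(\<integral>x. f (x + v) \<partial>lborel) = (\<integral>x. f x \<partial>lborel)"
proof -
  have "(\<integral>x. f x \<partial>lborel) = (\<integral>x. f x \<partial>distr lborel borel ((+) v))"
    by (subst lborel_distr_plus) simp
  also have "\<dots> = (\<integral>x. f (v + x) \<partial>lborel)"
    by (rule integral_distr) (use assms in auto)
  finally show ?thesis by (simp add: add.commute)
qed

text \<open>The difference quotients along \<open>v\<close> integrate to zero by translation
  invariance, and dominated convergence passes this to the derivative. Differentiability along one
  direction suffices, which fits \<open>E\<close>: it is C1 in space and merely continuous in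
  time.\<close>

lemma integral_line_derivative_eq_0:
  fixes h h' :: "'a::euclidean_space \<Rightarrow> real"
  assumes h: "continuous_on UNIV h" and h': "continuous_on UNIV h'"
    and K: "bounded K" "\<And>x. x \<notin> K \<Longrightarrow> h x = 0" "\<And>x. x \<notin> K \<Longrightarrow> h' x = 0"
    and d: "\<And>x. ((\<lambda>s. h (x + s *\<^sub>R v)) has_real_derivative h' x) (at 0)"
  shows "(\<integral>x. h' x \<partial>lborel) = 0"
proof -
  have [measurable]: "h \<in> borel_measurable borel" "h' \<in> borel_measurable borel"
    using h h' by (auto intro: borel_measurable_continuous_onI)
  have line: "((\<lambda>s. h (x + s *\<^sub>R v)) has_real_derivative h' (x + s *\<^sub>R v)) (at s)" for x s
  proof -
    have "((\<lambda>r. h ((x + s *\<^sub>R v) + r *\<^sub>R v)) has_real_derivative h' (x + s *\<^sub>R v)) (at 0)" by (rule d)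
    then have "((\<lambda>r. h (x + (r + s) *\<^sub>R v)) has_real_derivative h' (x + s *\<^sub>R v)) (at 0)"
      by (simp add: algebra_simps)
    then show ?thesis by (subst (asm) DERIV_shift[symmetric]) simp
  qed
  obtain B where B: "\<And>x. \<bar>h' x\<bar> \<le> B" "B \<ge> 0"
  proof -
    have "compact (h' ` closure K)"
      using K(1) h' by (intro compact_continuous_image) (auto intro: continuous_on_subset simp: compact_closure)
    then obtain B where "\<forall>y\<in>h' ` closure K. norm y \<le> B" by (meson bounded_iff compact_imp_bounded)
    then have "\<bar>h' x\<bar> \<le> max B 0" for x
      using K(3)[of x] closure_subset[of K] by (cases "x \<in> K") force+
    then show thesis using that[of "max B 0"] by simp
  qed
  obtain r where r: "\<And>x. x \<in> K \<Longrightarrow> norm x \<le> r" using K(1) by (auto simp: bounded_iff)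
  define q where "q = (\<lambda>n x. (h (x + (1 / real (Suc n)) *\<^sub>R v) - h x) * real (Suc n))"
  have int: "integrable lborel h" by (rule integrable_continuous_bounded_support[OF h K(1,2)])
  have qb: "\<bar>q n x\<bar> \<le> indicator (cball 0 (r + norm v)) x * B" for n x
  proof -
    obtain s where s: "0 < s" "s < 1 / real (Suc n)"
      "h (x + (1 / real (Suc n)) *\<^sub>R v) - h (x + 0 *\<^sub>R v) = (1 / real (Suc n) - 0) * h' (x + s *\<^sub>R v)"
      using MVT2[of 0 "1 / real (Suc n)" "\<lambda>s. h (x + s *\<^sub>R v)" "\<lambda>s. h' (x + s *\<^sub>R v)"] line by auto
    then have q: "q n x = h' (x + s *\<^sub>R v)" by (simp add: q_def)
    show ?thesis
    proof (cases "x \<in> cball 0 (r + norm v)")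
      case True
      then show ?thesis using B by (simp add: q)
    next
      case False
      \<comment> \<open>Step lengths never exceed 1, so all quotients vanish outside one ball,
        obtained by enlarging the radius \<open>r\<close> of the support by \<open>norm v\<close>.
        This makes the dominating function integrable.\<close>
      have "s \<le> 1" using s(2) by (rule order_trans[OF less_imp_le]) simp
      then have "norm (s *\<^sub>R v) \<le> norm v" using s(1) by (simp add: mult_left_le_one_le)
      moreover have "norm x \<le> norm (x + s *\<^sub>R v) + norm (s *\<^sub>R v)"
        using norm_triangle_ineq4[of "x + s *\<^sub>R v" "s *\<^sub>R v"] by simp
      ultimately have "x + s *\<^sub>R v \<notin> K" using False r[of "x + s *\<^sub>R v"] by auto
      then show ?thesis using K(3) B by (simp add: q)
    qed
  qed
  have "(\<lambda>n. \<integral>x. q n x \<partial>lborel) \<longlonglongrightarrow> (\<integral>x. h' x \<partial>lborel)"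
  proof (rule integral_dominated_convergence[where w = "\<lambda>x. indicator (cball 0 (r + norm v)) x * B"])
    show "integrable lborel (\<lambda>x. indicator (cball 0 (r + norm v)) x * B)"
      using emeasure_bounded_finite[OF bounded_cball[of 0 "r + norm v"]] by (intro integrable_mult_left integrable_real_indicator) auto
    show "AE x in lborel. (\<lambda>n. q n x) \<longlonglongrightarrow> h' x"
    proof (rule AE_I2)
      fix x
      have "((\<lambda>s. (h (x + s *\<^sub>R v) - h x) / s) \<longlongrightarrow> h' x) (at 0)"
        using d[of x] by (simp add: DERIV_def)
      moreover have "filterlim (\<lambda>n. 1 / real (Suc n)) (at 0) sequentially"
        unfolding filterlim_at using LIMSEQ_inverse_real_of_nat by (auto simp: inverse_eq_divide)
      ultimately have "(\<lambda>n. (h (x + (1 / real (Suc n)) *\<^sub>R v) - h x) / (1 / real (Suc n))) \<longlonglongrightarrow> h' x"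
        by (rule filterlim_compose)
      then show "(\<lambda>n. q n x) \<longlonglongrightarrow> h' x" by (simp add: q_def)
    qed
    show "AE x in lborel. norm (q n x) \<le> indicator (cball 0 (r + norm v)) x * B" for n
      using qb by auto
  qed (auto simp: q_def)
  moreover have "(\<integral>x. q n x \<partial>lborel) = 0" for n
  proof -
    have int2: "integrable lborel (\<lambda>x. h (x + (1 / real (Suc n)) *\<^sub>R v))"
    proof (rule integrable_continuous_bounded_support)
      show "continuous_on UNIV (\<lambda>x. h (x + (1 / real (Suc n)) *\<^sub>R v))"
        by (intro continuous_on_compose2[OF h] continuous_intros) auto
      show "bounded ((\<lambda>x. - ((1 / real (Suc n)) *\<^sub>R v) + x) ` K)" by (rule bounded_translation[OF K(1)])
      show "h (x + (1 / real (Suc n)) *\<^sub>R v) = 0" if "x \<notin> (\<lambda>x. - ((1 / real (Suc n)) *\<^sub>R v) + x) ` K" for x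
      proof (rule K(2), rule notI)
        assume "x + (1 / real (Suc n)) *\<^sub>R v \<in> K"
        then have "- ((1 / real (Suc n)) *\<^sub>R v) + (x + (1 / real (Suc n)) *\<^sub>R v) \<in> (\<lambda>x. - ((1 / real (Suc n)) *\<^sub>R v) + x) ` K"
          by (rule imageI)
        with that show False by simp
      qed
    qed
    have "(\<integral>x. q n x \<partial>lborel) = ((\<integral>x. h (x + (1 / real (Suc n)) *\<^sub>R v) \<partial>lborel) - (\<integral>x. h x \<partial>lborel)) * real (Suc n)"
      unfolding q_def using int int2 by (simp del: of_nat_Suc)
    also have "\<dots> = 0" by (subst lborel_integral_translate) simp_all
    finally show ?thesis .
  qed
  ultimately show ?thesis by (simp add: LIMSEQ_const_iff)
qed

text \<open>The spatial regularity that \<open>maxwell_sol\<close> grants to \<open>E\<close>.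
  Nothing is asked in time, because every time derivative falls on the test wave.\<close>

definition C1x :: "(pt \<Rightarrow> real^3) \<Rightarrow> bool" where
  "C1x W \<longleftrightarrow> continuous_on UNIV W \<and> (\<forall>x t. (\<lambda>y. W (y, t)) differentiable (at x))
     \<and> (\<forall>j. continuous_on UNIV (sderiv j W))"

lemma C1x_line_deriv:
  assumes "C1x W"
  shows "((\<lambda>s. W (p + s *\<^sub>R (axis j 1, 0)) $ k) has_real_derivative sderiv j W p $ k) (at 0)"
proof -
  obtain x t where p: "p = (x, t)" by (cases p)
  have "(\<lambda>y. W (y, t)) differentiable (at x)" using assms by (auto simp: C1x_def)
  then have "((\<lambda>y. W (y, t)) has_derivative frechet_derivative (\<lambda>y. W (y, t)) (at x)) (at x)"
    by (simp add: frechet_derivative_works)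
  then have D: "((\<lambda>y. W (y, t) $ k) has_derivative (\<lambda>v. frechet_derivative (\<lambda>y. W (y, t)) (at x) v $ k)) (at (x + 0 *\<^sub>R axis j 1))"
    by (auto intro: bounded_linear.has_derivative[OF bounded_linear_vec_nth])
  have L: "((\<lambda>s. x + s *\<^sub>R axis j 1) has_derivative (\<lambda>s. s *\<^sub>R axis j 1)) (at 0)"
    by (auto intro!: derivative_eq_intros)
  have lin: "linear (frechet_derivative (\<lambda>y. W (y, t)) (at x))"
    by (rule linear_frechet_derivative) fact
  have eq: "(\<lambda>s. frechet_derivative (\<lambda>y. W (y, t)) (at x) (s *\<^sub>R axis j 1) $ k) = (*) (sderiv j W p $ k)"
    by (auto simp: fun_eq_iff linear_cmul[OF lin] p sderiv_def)
  from has_derivative_compose[OF L D]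
  show ?thesis
    unfolding has_field_derivative_def eq by (simp add: p)
qed

lemma C1x_sderiv_support:
  assumes "closed K" "\<And>p. p \<notin> K \<Longrightarrow> W p = 0" "p \<notin> K"
  shows "sderiv j W p = 0"
proof -
  obtain x t where p: "p = (x, t)" by (cases p)
  have "open (- K)" using assms(1) by (simp add: open_Compl)
  then have op: "open ((\<lambda>y. (y, t)) -` (- K))"
    by (intro open_vimage) (auto intro!: continuous_intros)
  have "((\<lambda>y. W (y, t)) has_derivative (\<lambda>v. 0)) (at x)"
    by (rule has_derivative_transform_within_open[OF has_derivative_const[of 0] op])
       (use assms p in auto)
  then have "frechet_derivative (\<lambda>y. W (y, t)) (at x) = (\<lambda>v. 0)"
    by (rule frechet_derivative_at[symmetric])
  then show ?thesis by (simp add: p sderiv_def)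
qed

lemma integral_by_parts_C1x:
  assumes E: "C1x E" and W: "C1x W" and K: "compact K" "\<And>p. p \<notin> K \<Longrightarrow> W p = 0"
  shows "integrable lborel (\<lambda>p. E p $ i * sderiv j W p $ k + sderiv j E p $ i * W p $ k)"
    and "(\<integral>p. E p $ i * sderiv j W p $ k + sderiv j E p $ i * W p $ k \<partial>lborel) = 0"
proof -
  have cont: "continuous_on UNIV (\<lambda>p. E p $ i * sderiv j W p $ k + sderiv j E p $ i * W p $ k)"
    using E W by (auto simp: C1x_def intro!: continuous_intros)
  have z: "E p $ i * sderiv j W p $ k + sderiv j E p $ i * W p $ k = 0" if "p \<notin> K" for p
    using that K C1x_sderiv_support[where W = W, OF compact_imp_closed[OF K(1)] K(2)] by simp
  show "integrable lborel (\<lambda>p. E p $ i * sderiv j W p $ k + sderiv j E p $ i * W p $ k)"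
    by (rule integrable_continuous_bounded_support[OF cont compact_imp_bounded[OF K(1)] z])
  show "(\<integral>p. E p $ i * sderiv j W p $ k + sderiv j E p $ i * W p $ k \<partial>lborel) = 0"
  proof (rule integral_line_derivative_eq_0[where h = "\<lambda>p. E p $ i * W p $ k" and K = K and v = "(axis j 1, 0)"])
    show "continuous_on UNIV (\<lambda>p. E p $ i * W p $ k)"
      using E W by (auto simp: C1x_def intro!: continuous_intros)
    show "((\<lambda>s. E (p + s *\<^sub>R (axis j 1, 0)) $ i * W (p + s *\<^sub>R (axis j 1, 0)) $ k) has_real_derivative
        (E p $ i * sderiv j W p $ k + sderiv j E p $ i * W p $ k)) (at 0)" for p
      by (rule DERIV_cong[OF DERIV_mult[OF C1x_line_deriv[OF E, of p j i] C1x_line_deriv[OF W, of p j k]]])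
         (simp add: zero_prod_def[symmetric] algebra_simps)
  qed (use cont z K compact_imp_bounded in auto)
qed

lemma inner3: "(x::real^3) \<bullet> y = x $ 1 * y $ 1 + x $ 2 * y $ 2 + x $ 3 * y $ 3"
  by (simp add: inner_vec_def sum_3)

lemma curlx_nth [simp]:
  "curlx f p $ 1 = sderiv 2 f p $ 3 - sderiv 3 f p $ 2"
  "curlx f p $ 2 = sderiv 3 f p $ 1 - sderiv 1 f p $ 3"
  "curlx f p $ 3 = sderiv 1 f p $ 2 - sderiv 2 f p $ 1"
  by (simp_all add: curlx_def)

lemma continuous_curlx:
  assumes "C1x W" shows "continuous_on UNIV (curlx W)"
proof -
  have c: "continuous_on UNIV (\<lambda>p. sderiv j W p $ k)" for j k
    using assms by (auto simp: C1x_def intro!: continuous_intros)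
  have "continuous_on UNIV (\<lambda>p. curlx W p $ k)" for k
    using exhaust_3[of k] by (elim disjE; simp only: curlx_nth; intro continuous_on_diff c)
  then have "continuous_on UNIV (\<lambda>p. \<chi> k. curlx W p $ k)" by (rule continuous_on_vec_lambda)
  then show ?thesis by simp
qed

text \<open>The difference of the two integrands is a signed sum of six derivatives of products of
  components, one for each permutation of the axes, and each of these integrates to zero.\<close>

lemma curl_by_parts:
  assumes E: "C1x E" and W: "C1x W" and K: "compact K" "\<And>p. p \<notin> K \<Longrightarrow> W p = 0"
  shows "(\<integral>p. E p \<bullet> curlx W p \<partial>lborel) = (\<integral>p. curlx E p \<bullet> W p \<partial>lborel)"
    and "integrable lborel (\<lambda>p. E p \<bullet> curlx W p)" and "integrable lborel (\<lambda>p. curlx E p \<bullet> W p)"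
proof -
  define B where "B = (\<lambda>i j k p. E p $ i * sderiv j W p $ k + sderiv j E p $ i * W p $ k)"
  have int: "integrable lborel (B i j k)" and zero: "integral\<^sup>L lborel (B i j k) = 0" for i j k
    unfolding B_def by (rule integral_by_parts_C1x[OF E W K]; assumption)+
  have sW: "sderiv j W p = 0" if "p \<notin> K" for j p
    using that K C1x_sderiv_support[where W = W, OF compact_imp_closed[OF K(1)] K(2)] by blast
  have cE: "continuous_on UNIV E" and cW: "continuous_on UNIV W" using E W by (auto simp: C1x_def)
  show i1: "integrable lborel (\<lambda>p. E p \<bullet> curlx W p)"
  proof (rule integrable_continuous_bounded_support)
    show "continuous_on UNIV (\<lambda>p. E p \<bullet> curlx W p)"
      by (intro continuous_intros cE continuous_curlx W)
    show "bounded K" using K(1) by (rule compact_imp_bounded)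
    show "E p \<bullet> curlx W p = 0" if "p \<notin> K" for p
      using sW[OF that] by (simp add: inner3)
  qed
  show i2: "integrable lborel (\<lambda>p. curlx E p \<bullet> W p)"
  proof (rule integrable_continuous_bounded_support)
    show "continuous_on UNIV (\<lambda>p. curlx E p \<bullet> W p)"
      by (intro continuous_intros cW continuous_curlx E)
    show "bounded K" using K(1) by (rule compact_imp_bounded)
    show "curlx E p \<bullet> W p = 0" if "p \<notin> K" for p
      using K(2)[OF that] by simp
  qed
  have "(\<integral>p. E p \<bullet> curlx W p \<partial>lborel) - (\<integral>p. curlx E p \<bullet> W p \<partial>lborel)
     = (\<integral>p. E p \<bullet> curlx W p - curlx E p \<bullet> W p \<partial>lborel)"
    using i1 i2 by simp
  also have "\<dots> = (\<integral>p. B 1 2 3 p - B 1 3 2 p + B 2 3 1 p - B 2 1 3 p + B 3 1 2 p - B 3 2 1 p \<partial>lborel)"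
    by (intro Bochner_Integration.integral_cong) (simp_all add: B_def inner3 algebra_simps)
  also have "\<dots> = 0"
    by (simp add: int zero)
  finally show "(\<integral>p. E p \<bullet> curlx W p \<partial>lborel) = (\<integral>p. curlx E p \<bullet> W p \<partial>lborel)" by simp
qed

lemma C1x_smooth_expr:
  assumes W: "\<And>k. smooth_expr (\<lambda>p. W p $ k)"
  shows "C1x W"
  unfolding C1x_def
proof (intro conjI allI)
  have D: "(W has_derivative (\<lambda>v. \<chi> k. frechet_derivative (\<lambda>p. W p $ k) (at p) v)) (at p)" for p
    unfolding has_derivative_componentwise_within[of W] Basis_vec_def
    using smooth_expr_has_derivative[OF W] by (auto simp: inner_axis)
  have sl: "((\<lambda>y. W (y, t)) has_derivative (\<lambda>v. \<chi> k. frechet_derivative (\<lambda>p. W p $ k) (at (x, t)) (v, 0))) (at x)" for x t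
  proof -
    have "((\<lambda>y. (y, t)) has_derivative (\<lambda>v. (v, 0))) (at x)" by (auto intro!: derivative_eq_intros)
    from has_derivative_compose[OF this D] show ?thesis .
  qed
  show "continuous_on UNIV W"
    using D by (meson continuous_at_imp_continuous_on has_derivative_continuous)
  show "(\<lambda>y. W (y, t)) differentiable at x" for x t
    using sl by (auto simp: differentiable_def)
  fix j
  have "sderiv j W = (\<lambda>p. \<chi> k. frechet_derivative (\<lambda>p. W p $ k) (at p) (axis j 1, 0))"
    unfolding sderiv_def by (rule ext) (simp add: frechet_derivative_at[OF sl, symmetric])
  then show "continuous_on UNIV (sderiv j W)"
    by (auto intro!: continuous_intros smooth_expr_continuous smooth_expr_frechet W)
qed

section \<open>Travelling waves with a radial cutoff\<close>

lemma cross3_nth [simp]: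
  "cross3 a b $ 1 = a $ 2 * b $ 3 - a $ 3 * b $ 2"
  "cross3 a b $ 2 = a $ 3 * b $ 1 - a $ 1 * b $ 3"
  "cross3 a b $ 3 = a $ 1 * b $ 2 - a $ 2 * b $ 1"
  by (simp_all add: cross3_simps)

lemma sderiv_scaleR:
  assumes "((\<lambda>y. f (y, snd p)) has_derivative (\<lambda>h. G \<bullet> h)) (at (fst p))"
  shows "sderiv j (\<lambda>p. f p *\<^sub>R d) p = (G $ j) *\<^sub>R d"
proof -
  have "((\<lambda>y. f (y, snd p) *\<^sub>R d) has_derivative (\<lambda>h. (G \<bullet> h) *\<^sub>R d)) (at (fst p))"
    by (rule has_derivative_scaleR_left[OF assms])
  then have "frechet_derivative (\<lambda>y. f (y, snd p) *\<^sub>R d) (at (fst p)) = (\<lambda>h. (G \<bullet> h) *\<^sub>R d)"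
    by (rule frechet_derivative_at[symmetric])
  then show ?thesis by (simp add: sderiv_def inner_axis)
qed

lemma curlx_scaleR:
  assumes "((\<lambda>y. f (y, snd p)) has_derivative (\<lambda>h. G \<bullet> h)) (at (fst p))"
  shows "curlx (\<lambda>p. f p *\<^sub>R d) p = cross3 G d"
  by (simp add: vec_eq_iff forall_3 sderiv_scaleR[OF assms])

lemma tderiv_scaleR:
  assumes "((\<lambda>t. f (fst p, t)) has_real_derivative c) (at (snd p))"
  shows "tderiv (\<lambda>p. f p *\<^sub>R d) p = c *\<^sub>R d"
proof -
  have "((\<lambda>t. f (fst p, t) *\<^sub>R d) has_derivative (\<lambda>h. (c * h) *\<^sub>R d)) (at (snd p))"
    using assms by (intro has_derivative_scaleR_left) (simp add: has_field_derivative_def)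
  then have "frechet_derivative (\<lambda>t. f (fst p, t) *\<^sub>R d) (at (snd p)) = (\<lambda>h. (c * h) *\<^sub>R d)"
    by (rule frechet_derivative_at[symmetric])
  then show ?thesis by (simp add: tderiv_def)
qed

lemma cross3_linear_left:
  "cross3 (a *\<^sub>R x - b *\<^sub>R s) d = a *\<^sub>R cross3 x d + b *\<^sub>R cross3 d s"
  by (simp add: vec_eq_iff forall_3 algebra_simps)

text \<open>Composed with \<open>step\<close> this is a cutoff that equals 1 for
  \<open>fst p \<bullet> fst p \<le> R\<^sup>2 - \<delta>\<close> and vanishes outside the ball of
  radius \<open>R\<close>. The squared norm keeps it smooth at the origin.\<close>

definition radial_arg :: "real \<Rightarrow> real \<Rightarrow> pt \<Rightarrow> real" where
  "radial_arg R \<delta> p = (R\<^sup>2 - fst p \<bullet> fst p) / \<delta>"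

text \<open>Retarded time for the slowness vector \<open>s\<close>: a profile composed with it
  travels in the direction of \<open>s\<close> with speed \<open>1 / norm s\<close>.\<close>

definition phase :: "real^3 \<Rightarrow> pt \<Rightarrow> real" where
  "phase s p = snd p - s \<bullet> fst p"

lemma smooth_expr_radial_arg: "smooth_expr (radial_arg R \<delta>)"
  unfolding radial_arg_def divide_inverse
  by (intro smooth_expr.mult smooth_expr.const smooth_expr_diff smooth_expr_norm2)

lemma smooth_expr_phase: "smooth_expr (phase s)"
proof -
  have "phase s = (\<lambda>p. p \<bullet> (- s, 1))"
    by (auto simp: phase_def fun_eq_iff inner_Pair inner_commute)
  then show ?thesis by (simp add: smooth_expr.inner)
qed

lemma smooth_expr_fst_nth: "smooth_expr (\<lambda>p::pt. fst p $ k)"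
proof -
  have "(\<lambda>p::pt. fst p $ k) = (\<lambda>p. p \<bullet> (axis k 1, 0))" by (auto simp: fun_eq_iff inner_axis)
  then show ?thesis by (simp add: smooth_expr.inner)
qed

lemma cutoff_wave_deriv:
  assumes \<psi>: "\<And>u. (\<psi> has_real_derivative \<psi>' u) (at u)"
  shows "((\<lambda>y. step (radial_arg R \<delta> (y, snd p)) * \<psi> (phase s (y, snd p))) has_derivative
     (\<lambda>h. ((- (2 / \<delta>) * bump (radial_arg R \<delta> p) * \<psi> (phase s p)) *\<^sub>R fst p
        - (step (radial_arg R \<delta> p) * \<psi>' (phase s p)) *\<^sub>R s) \<bullet> h)) (at (fst p))"
    and "((\<lambda>t. step (radial_arg R \<delta> (fst p, t)) * \<psi> (phase s (fst p, t))) has_real_derivative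
      step (radial_arg R \<delta> p) * \<psi>' (phase s p)) (at (snd p))"
proof -
  have r: "((\<lambda>y. radial_arg R \<delta> (y, snd p)) has_derivative (\<lambda>h. - (2 / \<delta>) * (fst p \<bullet> h))) (at (fst p))"
    unfolding radial_arg_def divide_inverse
    by (auto intro!: derivative_eq_intros simp: inner_commute algebra_simps)
  have u: "((\<lambda>y. phase s (y, snd p)) has_derivative (\<lambda>h. - (s \<bullet> h))) (at (fst p))"
    unfolding phase_def by (auto intro!: derivative_eq_intros)
  have "((\<lambda>y. step (radial_arg R \<delta> (y, snd p))) has_derivative
      (\<lambda>h. bump (radial_arg R \<delta> p) * (- (2 / \<delta>) * (fst p \<bullet> h)))) (at (fst p))"
    by (rule has_derivative_compose_real[OF r]) (use step_deriv[of "radial_arg R \<delta> p"] in simp)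
  moreover have "((\<lambda>y. \<psi> (phase s (y, snd p))) has_derivative (\<lambda>h. \<psi>' (phase s p) * (- (s \<bullet> h)))) (at (fst p))"
    by (rule has_derivative_compose_real[OF u]) (use \<psi>[of "phase s p"] in simp)
  ultimately have "((\<lambda>y. step (radial_arg R \<delta> (y, snd p)) * \<psi> (phase s (y, snd p))) has_derivative
      (\<lambda>h. step (radial_arg R \<delta> (fst p, snd p)) * (\<psi>' (phase s p) * (- (s \<bullet> h)))
         + bump (radial_arg R \<delta> p) * (- (2 / \<delta>) * (fst p \<bullet> h)) * \<psi> (phase s (fst p, snd p)))) (at (fst p))"
    by (rule has_derivative_mult)
  then show "((\<lambda>y. step (radial_arg R \<delta> (y, snd p)) * \<psi> (phase s (y, snd p))) has_derivative
     (\<lambda>h. ((- (2 / \<delta>) * bump (radial_arg R \<delta> p) * \<psi> (phase s p)) *\<^sub>R fst p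
        - (step (radial_arg R \<delta> p) * \<psi>' (phase s p)) *\<^sub>R s) \<bullet> h)) (at (fst p))"
    by (rule has_derivative_eq_rhs) (auto simp: fun_eq_iff inner_diff_left algebra_simps)
  have "((\<lambda>t. \<psi> (phase s (fst p, t))) has_real_derivative \<psi>' (phase s p) * 1) (at (snd p))"
  proof (rule DERIV_chain2[where f = \<psi> and g = "\<lambda>t. phase s (fst p, t)"])
    show "(\<psi> has_real_derivative \<psi>' (phase s p)) (at (phase s (fst p, snd p)))" using \<psi>[of "phase s p"] by simp
    show "((\<lambda>t. phase s (fst p, t)) has_real_derivative 1) (at (snd p))"
      unfolding phase_def by (auto intro!: derivative_eq_intros)
  qed
  then show "((\<lambda>t. step (radial_arg R \<delta> (fst p, t)) * \<psi> (phase s (fst p, t))) has_real_derivative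
      step (radial_arg R \<delta> p) * \<psi>' (phase s p)) (at (snd p))"
    using DERIV_cmult[of "\<lambda>t. \<psi> (phase s (fst p, t))" "\<psi>' (phase s p)" "snd p" UNIV "step (radial_arg R \<delta> p)"]
    by (simp add: radial_arg_def)
qed

lemma cutoff_wave_support:
  assumes "\<delta> > 0" "R > 0" "\<And>u. \<bar>u\<bar> > \<tau> \<Longrightarrow> \<psi> u = 0"
    and "p \<notin> cball 0 R \<times> {- (\<tau> + norm s * R)..\<tau> + norm s * R}"
  shows "step (radial_arg R \<delta> p) * \<psi> (phase s p) = 0" "bump (radial_arg R \<delta> p) * \<psi> (phase s p) = 0"
proof -
  have "radial_arg R \<delta> p \<le> 0 \<or> \<bar>phase s p\<bar> > \<tau>"
  proof (cases "norm (fst p) \<le> R")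
    case False
    then have "R\<^sup>2 \<le> (norm (fst p))\<^sup>2" using assms(2) by (intro power_mono) auto
    then show ?thesis using assms(1) by (simp add: radial_arg_def power2_norm_eq_inner divide_nonpos_pos)
  next
    case True
    have "\<bar>s \<bullet> fst p\<bar> \<le> norm s * norm (fst p)" by (rule Cauchy_Schwarz_ineq2)
    also have "\<dots> \<le> norm s * R" using True by (intro mult_left_mono) auto
    finally have "\<bar>s \<bullet> fst p\<bar> \<le> norm s * R" .
    then show ?thesis using assms(4) True by (cases p) (auto simp: phase_def)
  qed
  then show "step (radial_arg R \<delta> p) * \<psi> (phase s p) = 0" "bump (radial_arg R \<delta> p) * \<psi> (phase s p) = 0"
    using assms(3) by (auto simp: step_0 bump_0)
qed

text \<open>Without the cutoff the wave solves the homogeneous system, so only terms with a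
  derivative of the cutoff can survive. Both curls are integrated by parts in such a way that
  \<open>E\<close> is differentiated at most once and the cutoff never twice: a second derivative of
  the cutoff would blow up as \<open>\<delta>\<close> tends to 0, whereas
  \<open>2 / \<delta> * bump\<close> keeps bounded mass.\<close>

lemma wave_identity:
  fixes s d :: "real^3"
  assumes E: "maxwell_sol n F E" and n: "n = s \<bullet> s" and ds: "d \<bullet> s = 0"
    and \<delta>: "\<delta> > 0" and R: "R > 0"
    and d1: "\<And>u. (\<psi> has_real_derivative \<psi>1 u) (at u)" and d2: "\<And>u. (\<psi>1 has_real_derivative \<psi>2 u) (at u)"
    and sm: "\<And>f :: pt \<Rightarrow> real. smooth_expr f \<Longrightarrow> smooth_expr (\<lambda>p. \<psi> (f p))"
       "\<And>f :: pt \<Rightarrow> real. smooth_expr f \<Longrightarrow> smooth_expr (\<lambda>p. \<psi>1 (f p))"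
    and supp: "\<And>u. \<bar>u\<bar> > \<tau> \<Longrightarrow> \<psi> u = 0" "\<And>u. \<bar>u\<bar> > \<tau> \<Longrightarrow> \<psi>1 u = 0"
  shows "(\<integral>p. F p \<bullet> ((step (radial_arg R \<delta> p) * \<psi> (phase s p)) *\<^sub>R d) \<partial>lborel)
    = (\<integral>p. - (2 / \<delta>) * bump (radial_arg R \<delta> p) *
         (\<psi> (phase s p) * (curlx E p \<bullet> cross3 (fst p) d)
          + \<psi>1 (phase s p) * (E p \<bullet> cross3 (fst p) (cross3 d s))) \<partial>lborel)" (is "_ = integral\<^sup>L _ ?r")
proof -
  let ?st = "\<lambda>p. step (radial_arg R \<delta> p)" and ?bu = "\<lambda>p. bump (radial_arg R \<delta> p)" and ?u = "phase s"
  let ?c = "cross3 d s"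
  define \<Phi> where "\<Phi> = (\<lambda>p. (?st p * \<psi> (?u p)) *\<^sub>R d)"
  define W where "W = (\<lambda>p. (- (2 / \<delta>) * ?bu p * \<psi> (?u p)) *\<^sub>R cross3 (fst p) d + (?st p * \<psi>1 (?u p)) *\<^sub>R ?c)"
  \<comment> \<open>\<open>V\<close> is the part of the curl \<open>W\<close> in which the cutoff is
    not differentiated. The curl is first moved from \<open>W\<close> to \<open>E\<close>; for the
    part \<open>V\<close> it is then moved back, which cancels the interior term with
    \<open>\<psi>2\<close>.\<close>
  define V where "V = (\<lambda>p. (?st p * \<psi>1 (?u p)) *\<^sub>R ?c)"
  define K where "K = (cball 0 R :: (real^3) set) \<times> {- (\<tau> + norm s * R)..\<tau> + norm s * R}"
  have K: "compact K" unfolding K_def by (intro compact_Times) auto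
  have C1E: "C1x E" using E by (auto simp: maxwell_sol_def C1x_def)
  have sst: "smooth_expr ?st" "smooth_expr ?bu"
    by (intro smooth_expr_step smooth_expr_bump smooth_expr_radial_arg)+
  have s\<psi>: "smooth_expr (\<lambda>p. \<psi> (?u p))" "smooth_expr (\<lambda>p. \<psi>1 (?u p))"
    by (intro sm smooth_expr_phase)+
  have test: "test_fun \<Phi>" unfolding \<Phi>_def
  proof (rule test_fun_scaleR)
    show "smooth_expr (\<lambda>p. ?st p * \<psi> (?u p))" by (intro smooth_expr.mult sst s\<psi>)
    show "bounded {p. ?st p * \<psi> (?u p) \<noteq> 0}"
      by (rule bounded_subset[OF compact_imp_bounded[OF K]])
         (use cutoff_wave_support(1)[of \<delta> R \<tau> \<psi>, OF \<delta> R supp(1)] in \<open>auto simp: K_def\<close>)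
  qed
  have curl\<Phi>: "curlx \<Phi> = W"
    unfolding \<Phi>_def W_def
    by (rule ext, subst curlx_scaleR[OF cutoff_wave_deriv(1)[OF d1]])
       (simp only: cross3_linear_left)
  have tt: "tderiv (tderiv \<Phi>) p = (?st p * \<psi>2 (?u p)) *\<^sub>R d" for p
  proof -
    have "tderiv \<Phi> = (\<lambda>p. (?st p * \<psi>1 (?u p)) *\<^sub>R d)"
      unfolding \<Phi>_def by (rule ext) (rule tderiv_scaleR[OF cutoff_wave_deriv(2)[OF d1]])
    then show ?thesis using tderiv_scaleR[OF cutoff_wave_deriv(2)[OF d2]] by simp
  qed
  \<comment> \<open>This is where the wave meets the equation: transversality removes one term of
    the double product, and \<open>s \<bullet> s = n\<close> matches the coefficient of the second
    time derivative.\<close>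
  have ccs: "cross3 ?c s = - n *\<^sub>R d"
  proof -
    have "cross3 ?c s = (d \<bullet> s) *\<^sub>R s - (s \<bullet> s) *\<^sub>R d"
      by (simp add: vec_eq_iff forall_3 inner3 algebra_simps)
    then show ?thesis by (simp add: ds n)
  qed
  have curlV: "curlx V p = (- (2 / \<delta>) * ?bu p * \<psi>1 (?u p)) *\<^sub>R cross3 (fst p) ?c - (n * (?st p * \<psi>2 (?u p))) *\<^sub>R d" for p
  proof -
    have "curlx V p = (- (2 / \<delta>) * ?bu p * \<psi>1 (?u p)) *\<^sub>R cross3 (fst p) ?c + (?st p * \<psi>2 (?u p)) *\<^sub>R cross3 ?c s"
      unfolding V_def
      by (subst curlx_scaleR[OF cutoff_wave_deriv(1)[OF d2]])
         (simp only: cross3_linear_left)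
    then show ?thesis by (simp add: ccs mult.commute)
  qed
  have C1V: "C1x V"
    by (rule C1x_smooth_expr) (auto simp: V_def intro!: smooth_expr.mult smooth_expr.const sst s\<psi>)
  have C1W: "C1x W"
  proof (rule C1x_smooth_expr)
    have "smooth_expr (\<lambda>p::pt. cross3 (fst p) d $ k)" for k
      using exhaust_3[of k]
      by (elim disjE; simp; intro smooth_expr_diff smooth_expr.mult smooth_expr.const smooth_expr_fst_nth)
    then show "smooth_expr (\<lambda>p. W p $ k)" for k
      unfolding W_def vector_add_component vector_scaleR_component real_scaleR_def
      by (intro smooth_expr.add smooth_expr.mult smooth_expr.const sst s\<psi>)
  qed
  have V0: "V p = 0" if "p \<notin> K" for p
    using cutoff_wave_support(1)[of \<delta> R \<tau> \<psi>1, OF \<delta> R supp(2)] that unfolding K_def V_def by auto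
  have W0: "W p = 0" if "p \<notin> K" for p
  proof -
    have "?bu p * \<psi> (?u p) = 0" using cutoff_wave_support(2)[of \<delta> R \<tau> \<psi>, OF \<delta> R supp(1)] that unfolding K_def by blast
    then show ?thesis using V0[OF that] by (auto simp: W_def V_def)
  qed
  note cW = curl_by_parts[OF C1E C1W K W0] and cV = curl_by_parts[OF C1E C1V K V0]
  \<comment> \<open>\<open>\<psi>2\<close> is given only as a pointwise derivative, so integrability
    of its term is read off from \<open>curlV\<close>, all of whose other terms are
    integrable.\<close>
  have intT: "integrable lborel (\<lambda>p. n * (?st p * \<psi>2 (?u p)) * (E p \<bullet> d))"
  proof -
    have "(\<lambda>p. n * (?st p * \<psi>2 (?u p)) * (E p \<bullet> d))
      = (\<lambda>p. - (2 / \<delta>) * ?bu p * \<psi>1 (?u p) * (E p \<bullet> cross3 (fst p) ?c) - E p \<bullet> curlx V p)"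
      by (rule ext) (simp add: curlV inner_diff_right algebra_simps)
    moreover have "integrable lborel (\<lambda>p. - (2 / \<delta>) * ?bu p * \<psi>1 (?u p) * (E p \<bullet> cross3 (fst p) ?c))"
    proof (rule integrable_continuous_bounded_support[OF _ compact_imp_bounded[OF K]])
      show "continuous_on UNIV (\<lambda>p. - (2 / \<delta>) * ?bu p * \<psi>1 (?u p) * (E p \<bullet> cross3 (fst p) ?c))"
        using C1E unfolding C1x_def
        by (intro continuous_intros smooth_expr_continuous[OF sst(2)] smooth_expr_continuous[OF s\<psi>(2)] continuous_on_cross) auto
      show "- (2 / \<delta>) * ?bu p * \<psi>1 (?u p) * (E p \<bullet> cross3 (fst p) ?c) = 0" if "p \<notin> K" for p
        using cutoff_wave_support(2)[of \<delta> R \<tau> \<psi>1, OF \<delta> R supp(2)] that unfolding K_def by auto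
    qed
    ultimately show ?thesis using cV(2) by simp
  qed
  have "(\<integral>p. F p \<bullet> \<Phi> p \<partial>lborel) = (\<integral>p. E p \<bullet> (n *\<^sub>R tderiv (tderiv \<Phi>) p + curlx (curlx \<Phi>) p) \<partial>lborel)"
    using E test by (simp add: maxwell_sol_def)
  also have "\<dots> = (\<integral>p. n * (?st p * \<psi>2 (?u p)) * (E p \<bullet> d) + E p \<bullet> curlx W p \<partial>lborel)"
    by (simp add: tt curl\<Phi> inner_add_right)
  also have "\<dots> = (\<integral>p. n * (?st p * \<psi>2 (?u p)) * (E p \<bullet> d) \<partial>lborel) + (\<integral>p. curlx E p \<bullet> W p \<partial>lborel)
      + (\<integral>p. E p \<bullet> curlx V p \<partial>lborel) - (\<integral>p. curlx E p \<bullet> V p \<partial>lborel)"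
    using intT cW cV by simp
  also have "\<dots> = (\<integral>p. n * (?st p * \<psi>2 (?u p)) * (E p \<bullet> d) + curlx E p \<bullet> W p + E p \<bullet> curlx V p - curlx E p \<bullet> V p \<partial>lborel)"
    using intT cW cV by simp
  also have "\<dots> = integral\<^sup>L lborel ?r"
    by (intro Bochner_Integration.integral_cong refl)
       (simp only: curlV, simp add: W_def V_def inner_add_right inner_diff_right algebra_simps)
  finally show ?thesis by (simp add: \<Phi>_def)
qed

text \<open>The weight \<open>2 / \<delta> * bump\<close> times the radius is minus the radial
  derivative of the cutoff. It therefore acts as a density on a thin shell that concentrates on the
  sphere.\<close>

definition shell_integral :: "real \<Rightarrow> real \<Rightarrow> real \<Rightarrow> (pt \<Rightarrow> real) \<Rightarrow> real" where
  "shell_integral R \<delta> T q =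
     (\<integral>p. indicator (cball 0 R \<times> {0..T}) p * (2 / \<delta> * bump (radial_arg R \<delta> p) * q p) \<partial>lborel)"

lemma shell_integrable:
  assumes "continuous_on UNIV q"
  shows "integrable lborel (\<lambda>p. indicator (cball 0 R \<times> {0..T}) p * (2 / \<delta> * bump (radial_arg R \<delta> p) * q p))"
proof -
  have "continuous_on (cball 0 R \<times> {0..T}) (\<lambda>p. 2 / \<delta> * bump (radial_arg R \<delta> p) * q p)"
    by (intro continuous_intros smooth_expr_continuous smooth_expr_bump smooth_expr_radial_arg
        continuous_on_subset[OF assms]) auto
  from borel_integrable_compact[OF compact_Times[OF compact_cball compact_Icc] this]
  show ?thesis by simp
qed

text \<open>The free weight \<open>\<mu>\<close> takes the place of the Cauchy-Schwarz inequality
  for shell integrals: it is optimized only after the shell has shrunk to the sphere.\<close>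

lemma young_ineq:
  fixes A B a b \<mu> :: real
  assumes "\<mu> > 0"
  shows "a * A + b * B \<le> \<mu> / 2 * (A\<^sup>2 + B\<^sup>2) + (a\<^sup>2 + b\<^sup>2) / (2 * \<mu>)"
proof -
  have one: "a * A \<le> \<mu> / 2 * A\<^sup>2 + a\<^sup>2 / (2 * \<mu>)" for a A :: real
  proof -
    have "0 \<le> (\<mu> * A - a)\<^sup>2 / (2 * \<mu>)" using assms by simp
    also have "\<dots> = \<mu> / 2 * A\<^sup>2 + a\<^sup>2 / (2 * \<mu>) - a * A"
      using assms by (simp add: power2_eq_square field_simps)
    finally show ?thesis by simp
  qed
  from add_mono[OF one[of a A] one[of b B]] show ?thesis
    by (simp add: distrib_left add_divide_distrib algebra_simps)
qed

lemma curlx_eq_0_of_past: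
  assumes "\<And>p. snd p \<le> 0 \<Longrightarrow> E p = 0" "snd p \<le> 0"
  shows "curlx E p = 0"
proof -
  have "(\<lambda>y. E (y, snd p)) = (\<lambda>y. 0)" using assms by auto
  then have "sderiv j E p = 0" for j by (simp add: sderiv_def)
  then show ?thesis by (simp add: vec_eq_iff forall_3)
qed

text \<open>The triple product identity moves the cross product with the position onto
  \<open>E\<close> and \<open>curlx E\<close>, so that only tangential traces remain. The factor
  \<open>n\<close> arises from \<open>norm (cross3 d s)\<close>, which squares to \<open>n\<close>
  for unit \<open>d\<close> orthogonal to \<open>s\<close>.\<close>

lemma wave_estimate_shell:
  fixes s d :: "real^3"
  assumes E: "maxwell_sol n F E" and n: "n = s \<bullet> s" and ds: "d \<bullet> s = 0" and nd: "norm d = 1"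
    and \<delta>: "\<delta> > 0" and R: "R > 0" and \<mu>: "\<mu> > 0"
    and d1: "\<And>u. (\<psi> has_real_derivative \<psi>1 u) (at u)" and d2: "\<And>u. (\<psi>1 has_real_derivative \<psi>2 u) (at u)"
    and sm: "\<And>f :: pt \<Rightarrow> real. smooth_expr f \<Longrightarrow> smooth_expr (\<lambda>p. \<psi> (f p))"
       "\<And>f :: pt \<Rightarrow> real. smooth_expr f \<Longrightarrow> smooth_expr (\<lambda>p. \<psi>1 (f p))"
    and supp: "\<And>u. \<bar>u\<bar> > \<tau> \<Longrightarrow> \<psi> u = 0" "\<And>u. \<bar>u\<bar> > \<tau> \<Longrightarrow> \<psi>1 u = 0"
    and bnd: "\<And>u. \<bar>\<psi> u\<bar> \<le> 1" "\<And>u. \<bar>\<psi>1 u\<bar> \<le> K"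
    and late: "\<And>u. u > U \<Longrightarrow> \<psi> u = 0" "\<And>u. u > U \<Longrightarrow> \<psi>1 u = 0"
    and T: "U + norm s * R \<le> T"
  shows "\<bar>\<integral>p. F p \<bullet> ((step (radial_arg R \<delta> p) * \<psi> (phase s p)) *\<^sub>R d) \<partial>lborel\<bar>
     \<le> \<mu> / 2 * shell_integral R \<delta> T (\<lambda>p. (norm (cross3 (curlx E p) (fst p)))\<^sup>2 + (norm (cross3 (E p) (fst p)))\<^sup>2)
       + (1 + n * K\<^sup>2) / (2 * \<mu>) * shell_integral R \<delta> T (\<lambda>_. 1)"
proof -
  let ?bu = "\<lambda>p. bump (radial_arg R \<delta> p)" and ?u = "phase s" and ?c = "cross3 d s"
  let ?r = "\<lambda>p. - (2 / \<delta>) * ?bu p * (\<psi> (?u p) * (curlx E p \<bullet> cross3 (fst p) d) + \<psi>1 (?u p) * (E p \<bullet> cross3 (fst p) ?c))"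
  let ?g = "\<lambda>p. (norm (cross3 (curlx E p) (fst p)))\<^sup>2 + (norm (cross3 (E p) (fst p)))\<^sup>2"
  let ?I = "\<lambda>q p. indicator (cball 0 R \<times> {0..T}) p * (2 / \<delta> * ?bu p * q p)"
  let ?k = "(1 + n * K\<^sup>2) / (2 * \<mu>)"
  have C1E: "C1x E" and E0: "\<And>p. snd p \<le> 0 \<Longrightarrow> E p = 0" using E by (auto simp: maxwell_sol_def C1x_def)
  have n0: "n \<ge> 0" by (simp add: n)
  have cg: "continuous_on UNIV ?g"
    using C1E continuous_curlx[OF C1E] unfolding C1x_def
    by (intro continuous_intros continuous_on_cross) auto
  have nc: "(norm ?c)\<^sup>2 = n"
    unfolding norm_cross using nd ds by (simp add: n power2_norm_eq_inner)
  have ptw: "\<bar>?r p\<bar> \<le> \<mu> / 2 * ?I ?g p + ?k * ?I (\<lambda>_. 1) p" for p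
  proof (cases "p \<in> cball 0 R \<times> {0..T}")
    case True
    let ?A = "norm (cross3 (curlx E p) (fst p))" and ?B = "norm (cross3 (E p) (fst p))"
    have 1: "\<bar>\<psi> (?u p) * (curlx E p \<bullet> cross3 (fst p) d)\<bar> \<le> 1 * ?A"
    proof -
      have "curlx E p \<bullet> cross3 (fst p) d = cross3 (curlx E p) (fst p) \<bullet> d"
        by (simp add: inner3 algebra_simps)
      then have "\<bar>curlx E p \<bullet> cross3 (fst p) d\<bar> \<le> ?A"
        using Cauchy_Schwarz_ineq2[of "cross3 (curlx E p) (fst p)" d] nd by simp
      then show ?thesis unfolding abs_mult using bnd(1) by (intro mult_mono) auto
    qed
    have 2: "\<bar>\<psi>1 (?u p) * (E p \<bullet> cross3 (fst p) ?c)\<bar> \<le> (K * norm ?c) * ?B"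
    proof -
      have "E p \<bullet> cross3 (fst p) ?c = cross3 (E p) (fst p) \<bullet> ?c"
        by (simp add: inner3 algebra_simps)
      then have "\<bar>E p \<bullet> cross3 (fst p) ?c\<bar> \<le> ?B * norm ?c"
        using Cauchy_Schwarz_ineq2[of "cross3 (E p) (fst p)" ?c] by simp
      then have "\<bar>\<psi>1 (?u p) * (E p \<bullet> cross3 (fst p) ?c)\<bar> \<le> K * (?B * norm ?c)"
        unfolding abs_mult using bnd(2)[of "?u p"] by (intro mult_mono) auto
      then show ?thesis by (simp add: mult_ac)
    qed
    have "\<bar>?r p\<bar> = 2 / \<delta> * ?bu p * \<bar>\<psi> (?u p) * (curlx E p \<bullet> cross3 (fst p) d) + \<psi>1 (?u p) * (E p \<bullet> cross3 (fst p) ?c)\<bar>"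
      using \<delta> by (simp add: abs_mult bump_nonneg)
    also have "\<dots> \<le> 2 / \<delta> * ?bu p * (1 * ?A + (K * norm ?c) * ?B)"
      using \<delta> by (intro mult_left_mono order_trans[OF abs_triangle_ineq add_mono[OF 1 2]]) (auto simp: bump_nonneg)
    also have "\<dots> \<le> 2 / \<delta> * ?bu p * (\<mu> / 2 * (?A\<^sup>2 + ?B\<^sup>2) + (1\<^sup>2 + (K * norm ?c)\<^sup>2) / (2 * \<mu>))"
      using \<delta> by (intro mult_left_mono young_ineq \<mu>) (auto simp: bump_nonneg)
    also have "(1\<^sup>2 + (K * norm ?c)\<^sup>2) / (2 * \<mu>) = ?k" by (simp add: power_mult_distrib nc mult.commute)
    also have "2 / \<delta> * ?bu p * (\<mu> / 2 * (?A\<^sup>2 + ?B\<^sup>2) + ?k) = \<mu> / 2 * ?I ?g p + ?k * ?I (\<lambda>_. 1) p"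
      using True by (simp add: distrib_left mult_ac)
    finally show ?thesis .
  next
    \<comment> \<open>Off the cylinder the integrand vanishes for one of three reasons: outside the
      ball \<open>bump\<close> is zero, before time 0 the field is zero, and after \<open>T\<close>
      the phase exceeds \<open>U\<close>, since \<open>s \<bullet> fst p\<close> is at most
      \<open>norm s * R\<close>.\<close>
    case False
    have "?r p = 0"
    proof (cases "norm (fst p) \<le> R")
      case False
      then have "R\<^sup>2 \<le> (norm (fst p))\<^sup>2" using R by (intro power_mono) auto
      then have "radial_arg R \<delta> p \<le> 0" using \<delta> by (simp add: radial_arg_def power2_norm_eq_inner divide_nonpos_pos)
      then show ?thesis by (simp add: bump_0)
    next
      case True
      then consider "snd p \<le> 0" | "snd p > T" using False by (cases p) force
      then show ?thesis
      proof cases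
        case 1
        then show ?thesis using E0 curlx_eq_0_of_past[of E p, OF E0] by simp
      next
        case 2
        have "s \<bullet> fst p \<le> norm s * norm (fst p)" by (rule norm_cauchy_schwarz)
        also have "\<dots> \<le> norm s * R" using True by (intro mult_left_mono) auto
        finally have "?u p > U" using 2 T by (simp add: phase_def)
        then show ?thesis using late by simp
      qed
    qed
    with False show ?thesis by simp
  qed
  have i1: "integrable lborel (?I ?g)" and i2: "integrable lborel (?I (\<lambda>_. 1))"
    by (intro shell_integrable cg continuous_on_const)+
  have j1: "integrable lborel (\<lambda>p. \<mu> / 2 * ?I ?g p)" and j2: "integrable lborel (\<lambda>p. ?k * ?I (\<lambda>_. 1) p)"
    by (rule Bochner_Integration.integrable_mult_right[OF i1], rule Bochner_Integration.integrable_mult_right[OF i2])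
  have eq: "(\<integral>p. F p \<bullet> ((step (radial_arg R \<delta> p) * \<psi> (phase s p)) *\<^sub>R d) \<partial>lborel) = integral\<^sup>L lborel ?r"
    by (rule wave_identity[OF E n ds \<delta> R d1 d2 sm supp])
  have bound: "\<bar>integral\<^sup>L lborel ?r\<bar> \<le> (\<integral>p. \<mu> / 2 * ?I ?g p + ?k * ?I (\<lambda>_. 1) p \<partial>lborel)"
  proof (cases "integrable lborel ?r")
    case True
    have "norm (integral\<^sup>L lborel ?r) \<le> (\<integral>p. \<mu> / 2 * ?I ?g p + ?k * ?I (\<lambda>_. 1) p \<partial>lborel)"
      by (rule Bochner_Integration.integral_norm_bound_integral[OF True Bochner_Integration.integrable_add[OF j1 j2]])
         (simp only: real_norm_def ptw)
    then show ?thesis by simp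
  next
    \<comment> \<open>A non-integrable function has integral 0 by convention, and then the bound is
      trivial because the majorant is nonnegative.\<close>
    case False
    have ge: "0 \<le> (\<integral>p. \<mu> / 2 * ?I ?g p + ?k * ?I (\<lambda>_. 1) p \<partial>lborel)"
      by (rule Bochner_Integration.integral_nonneg) (rule order_trans[OF abs_ge_zero ptw])
    have z: "integral\<^sup>L lborel ?r = 0" by (rule not_integrable_integral_eq[OF False])
    show ?thesis unfolding z abs_zero by (rule ge)
  qed
  have split: "(\<integral>p. \<mu> / 2 * ?I ?g p + ?k * ?I (\<lambda>_. 1) p \<partial>lborel)
      = (\<integral>p. \<mu> / 2 * ?I ?g p \<partial>lborel) + (\<integral>p. ?k * ?I (\<lambda>_. 1) p \<partial>lborel)"
    by (rule Bochner_Integration.integral_add[OF j1 j2])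
  have e1: "(\<integral>p. \<mu> / 2 * ?I ?g p \<partial>lborel) = \<mu> / 2 * shell_integral R \<delta> T ?g"
    unfolding shell_integral_def by (rule integral_mult_right_zero)
  have e2: "(\<integral>p. ?k * ?I (\<lambda>_. 1) p \<partial>lborel) = ?k * shell_integral R \<delta> T (\<lambda>_. 1)"
    unfolding shell_integral_def by (rule integral_mult_right_zero)
  show ?thesis using bound unfolding eq split e1 e2 .
qed

section \<open>Spherical coordinates\<close>

definition unit_sphere :: "real \<Rightarrow> real \<Rightarrow> real^3" where
  "unit_sphere \<theta> \<phi> = vector [sin \<theta> * cos \<phi>, sin \<theta> * sin \<phi>, cos \<theta>]"

lemma unit_sphere_nth [simp]:
  "unit_sphere \<theta> \<phi> $ 1 = sin \<theta> * cos \<phi>" "unit_sphere \<theta> \<phi> $ 2 = sin \<theta> * sin \<phi>" "unit_sphere \<theta> \<phi> $ 3 = cos \<theta>"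
  by (simp_all add: unit_sphere_def)

lemma unit_sphere_inner [simp]: "unit_sphere \<theta> \<phi> \<bullet> unit_sphere \<theta> \<phi> = 1"
proof -
  have "unit_sphere \<theta> \<phi> \<bullet> unit_sphere \<theta> \<phi> = (sin \<theta>)\<^sup>2 * ((cos \<phi>)\<^sup>2 + (sin \<phi>)\<^sup>2) + (cos \<theta>)\<^sup>2"
  proof -
    have "(s * q) * (s * q) + (s * p) * (s * p) + c * c = s\<^sup>2 * (q\<^sup>2 + p\<^sup>2) + c\<^sup>2" for s q p c :: real
      by (simp add: power2_eq_square algebra_simps)
    then show ?thesis by (simp only: inner_vec_def sum_3 inner_real_def unit_sphere_nth)
  qed
  then show ?thesis by simp
qed

lemma norm_unit_sphere [simp]: "norm (unit_sphere \<theta> \<phi>) = 1"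
  by (simp add: norm_eq_sqrt_inner)

lemma continuous_on_unit_sphere [continuous_intros]:
  fixes S :: "'a::euclidean_space set"
  assumes "continuous_on S f" "continuous_on S g"
  shows "continuous_on S (\<lambda>x. unit_sphere (f x) (g x))"
proof -
  have c: "continuous_on S (\<lambda>x. unit_sphere (f x) (g x) $ 1)"
    "continuous_on S (\<lambda>x. unit_sphere (f x) (g x) $ 2)" "continuous_on S (\<lambda>x. unit_sphere (f x) (g x) $ 3)"
    unfolding unit_sphere_nth by (intro continuous_intros assms)+
  have "continuous_on S (\<lambda>x. unit_sphere (f x) (g x) $ k)" for k
    using exhaust_3[of k] c by auto
  then have "continuous_on S (\<lambda>x. \<chi> k. unit_sphere (f x) (g x) $ k)" by (rule continuous_on_vec_lambda)
  then show ?thesis by simp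
qed

definition spherical :: "real^3 \<Rightarrow> real^3" where
  "spherical y = y $ 1 *\<^sub>R unit_sphere (y $ 2) (y $ 3)"

definition spherical_jacobian :: "real^3 \<Rightarrow> real^3^3" where
  "spherical_jacobian y = vector
    [vector [sin (y$2) * cos (y$3), y$1 * cos (y$2) * cos (y$3), - (y$1 * sin (y$2) * sin (y$3))],
     vector [sin (y$2) * sin (y$3), y$1 * cos (y$2) * sin (y$3), y$1 * sin (y$2) * cos (y$3)],
     vector [cos (y$2), - (y$1 * sin (y$2)), 0]]"

lemma spherical_has_derivative:
  "(spherical has_derivative (\<lambda>h. spherical_jacobian y *v h)) (at y within S)"
proof -
  have n: "((\<lambda>y::real^3. y $ k) has_derivative (\<lambda>h. h $ k)) (at y within S)" for k
    by (intro bounded_linear.has_derivative[OF bounded_linear_vec_nth] has_derivative_ident)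
  have "((\<lambda>y. spherical y $ k) has_derivative (\<lambda>h. (spherical_jacobian y *v h) $ k)) (at y within S)" for k
    using exhaust_3[of k]
    apply (elim disjE)
      apply (simp_all add: spherical_def spherical_jacobian_def matrix_vector_mult_def sum_3)
      apply (auto intro!: derivative_eq_intros n simp: fun_eq_iff algebra_simps)
    done
  then show ?thesis
    unfolding has_derivative_componentwise_within[of spherical] Basis_vec_def by (auto simp: inner_axis)
qed

lemma det_spherical: "det (spherical_jacobian y) = (y$1)\<^sup>2 * sin (y$2)"
proof -
  have "det (spherical_jacobian y) = (y$1)\<^sup>2 * sin (y$2) *
     (((sin (y$2))\<^sup>2 + (cos (y$2))\<^sup>2) * ((sin (y$3))\<^sup>2 + (cos (y$3))\<^sup>2))"
  proof -
    have "s * q * (r * c * p) * 0 + r * c * q * (r * s * q) * c + - (r * s * p) * (s * p) * - (r * s)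
        - s * q * (r * s * q) * - (r * s) - r * c * q * (s * p) * 0 - - (r * s * p) * (r * c * p) * c
      = r\<^sup>2 * s * ((s\<^sup>2 + c\<^sup>2) * (p\<^sup>2 + q\<^sup>2))" for r s c p q :: real
      by (simp add: power2_eq_square algebra_simps)
    then show ?thesis by (simp only: det_3 spherical_jacobian_def vector_3)
  qed
  then show ?thesis by simp
qed

definition spherical_dom :: "(real^3) set" where
  "spherical_dom = {y. 0 < y$1 \<and> 0 < y$2 \<and> y$2 < pi \<and> 0 < y$3 \<and> y$3 < 2 * pi}"

lemma spherical_dom_open: "open spherical_dom"
  unfolding spherical_dom_def
  by (intro open_Collect_conj open_Collect_less continuous_intros)

lemma inj_on_spherical: "inj_on spherical spherical_dom"
proof (rule inj_onI)
  fix x y assume x: "x \<in> spherical_dom" and y: "y \<in> spherical_dom" and eq: "spherical x = spherical y"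
  have "norm (spherical x) = norm (spherical y)" by (simp add: eq)
  then have 1: "x $ 1 = y $ 1" using x y by (simp add: spherical_def spherical_dom_def)
  then have u: "unit_sphere (x$2) (x$3) = unit_sphere (y$2) (y$3)"
    using eq x by (simp add: spherical_def spherical_dom_def)
  then have "cos (x$2) = cos (y$2)" by (metis unit_sphere_nth(3))
  then have 2: "x $ 2 = y $ 2"
    using x y cos_inj_pi[of "x$2" "y$2"] by (auto simp: spherical_dom_def)
  have s: "sin (x$2) \<noteq> 0" using x sin_gt_zero[of "x$2"] by (auto simp: spherical_dom_def)
  have "cos (x$3) = cos (y$3)" "sin (x$3) = sin (y$3)"
    using u s 2 by (metis unit_sphere_nth mult_left_cancel)+
  then have "cos (x$3 - y$3) = 1" using sin_cos_squared_add3[of "y $ 3"] by (simp add: cos_diff)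
  then obtain k :: int where k: "x$3 - y$3 = of_int k * (2 * pi)"
    using cos_one_2pi_int by (metis mult.assoc mult.commute)
  have "\<bar>x$3 - y$3\<bar> < 2 * pi" using x y by (auto simp: spherical_dom_def)
  then have "\<bar>of_int k :: real\<bar> < 1" using k by (simp add: abs_mult)
  then have "k = 0" by linarith
  then have "x $ 3 = y $ 3" using k by simp
  with 1 2 show "x = y" by (simp add: vec_eq_iff forall_3)
qed

text \<open>What the open coordinate box misses is the polar axis and the half-plane of azimuth 0.
  Both lie in one coordinate plane, hence in a null set.\<close>

lemma spherical_image: "- spherical ` spherical_dom \<subseteq> {x. x $ 2 = 0}"
proof
  fix x :: "real^3" assume "x \<in> - spherical ` spherical_dom"
  then have nx: "x \<notin> spherical ` spherical_dom" by simp
  show "x \<in> {x. x $ 2 = 0}"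
  proof (rule ccontr)
    assume "x \<notin> {x. x $ 2 = 0}"
    then have x2: "x $ 2 \<noteq> 0" by simp
    define r where "r = norm x"
    have r: "r > 0" using x2 by (auto simp: r_def)
    have r2: "r\<^sup>2 = (x$1)\<^sup>2 + (x$2)\<^sup>2 + (x$3)\<^sup>2"
      unfolding r_def power2_norm_eq_inner by (simp add: inner_vec_def sum_3 power2_eq_square)
    define q where "q = sqrt ((x$1)\<^sup>2 + (x$2)\<^sup>2)"
    have q: "q > 0" using x2 by (simp add: q_def add_nonneg_pos)
    have q2: "q\<^sup>2 = (x$1)\<^sup>2 + (x$2)\<^sup>2" by (simp add: q_def)
    have "(q / r)\<^sup>2 + (x$3 / r)\<^sup>2 = 1"
    proof -
      have "(q / r)\<^sup>2 + (x$3 / r)\<^sup>2 = r\<^sup>2 / r\<^sup>2"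
        unfolding power_divide add_divide_distrib[symmetric] q2 r2 ..
      then show ?thesis using r by simp
    qed
    then obtain \<theta> where \<theta>: "0 \<le> \<theta>" "\<theta> \<le> pi" "x$3 / r = cos \<theta>" "q / r = sin \<theta>"
      using sincos_total_pi[of "q / r" "x$3 / r"] q r by (auto simp: add.commute)
    have "sin \<theta> > 0" using \<theta>(4) q r by (metis divide_pos_pos)
    then have \<theta>': "0 < \<theta>" "\<theta> < pi" using \<theta>(1,2) by (cases "\<theta> = 0"; cases "\<theta> = pi"; auto)+
    have "(x$1 / q)\<^sup>2 + (x$2 / q)\<^sup>2 = 1"
    proof -
      have "(x$1 / q)\<^sup>2 + (x$2 / q)\<^sup>2 = q\<^sup>2 / q\<^sup>2"
        unfolding power_divide add_divide_distrib[symmetric] q2 ..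
      then show ?thesis using q by simp
    qed
    then obtain \<phi> where \<phi>: "0 \<le> \<phi>" "\<phi> < 2 * pi" "x$1 / q = cos \<phi>" "x$2 / q = sin \<phi>"
      using sincos_total_2pi by metis
    have "\<phi> \<noteq> 0" using \<phi>(4) x2 q by auto
    then have \<phi>': "0 < \<phi>" using \<phi>(1) by simp
    let ?y = "vector [r, \<theta>, \<phi>] :: real^3"
    have "?y \<in> spherical_dom" using r \<theta>' \<phi>' \<phi>(2) by (simp add: spherical_dom_def)
    moreover have "spherical ?y = x"
      using \<theta>(3,4) \<phi>(3,4) q r
      by (simp add: vec_eq_iff forall_3 spherical_def \<theta>(3)[symmetric] \<theta>(4)[symmetric] \<phi>(3)[symmetric] \<phi>(4)[symmetric])
    ultimately show False using nx by (metis image_eqI)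
  qed
qed

text \<open>The boundary integral runs over triples of coordinates, whereas the change of variables
  takes place in \<open>real^3\<close>; this identifies the two Lebesgue measures.\<close>

lemma lborel_vector3:
  "lborel = distr lborel borel (\<lambda>(a, b, c). vector [a, b, c] :: real^3)"
proof (rule lborel_eqI)
  let ?v = "\<lambda>(a, b, c). vector [a, b, c] :: real^3"
  have "?v = (\<lambda>p. fst p *\<^sub>R axis 1 1 + fst (snd p) *\<^sub>R axis 2 1 + snd (snd p) *\<^sub>R axis 3 1)"
    by (auto simp: fun_eq_iff vec_eq_iff forall_3 axis_def)
  then have "continuous_on UNIV ?v" by (simp only:) (intro continuous_intros)
  then have m [measurable]: "?v \<in> borel_measurable borel" by (rule borel_measurable_continuous_onI)
  fix l u :: "real^3" assume lu: "\<And>b. b \<in> Basis \<Longrightarrow> l \<bullet> b \<le> u \<bullet> b"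
  have lu': "l $ k \<le> u $ k" for k
    using lu[of "axis k 1"] by (auto simp: Basis_vec_def inner_axis)
  have pre: "?v -` box l u = box (l$1, l$2, l$3) (u$1, u$2, u$3)"
    by (auto simp: mem_box_cart forall_3 mem_box Basis_prod_def)
  have "emeasure (distr lborel borel ?v) (box l u) = emeasure lborel (box (l$1, l$2, l$3) (u$1, u$2, u$3))"
    using m by (subst emeasure_distr) (auto simp: pre)
  also have "\<dots> = ennreal (prod ((\<bullet>) ((u$1, u$2, u$3) - (l$1, l$2, l$3))) Basis)"
    using lu' by (subst emeasure_lborel_box) (auto simp: Basis_prod_def)
  also have "prod ((\<bullet>) ((u$1, u$2, u$3) - (l$1, l$2, l$3))) Basis = (u$1 - l$1) * ((u$2 - l$2) * (u$3 - l$3))"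
  proof -
    have B: "Basis = {(1, 0, 0), (0, 1, 0), (0, 0, 1 :: real) :: real \<times> real \<times> real}"
      by (auto simp: Basis_prod_def zero_prod_def)
    show ?thesis unfolding B by simp
  qed
  also have "\<dots> = prod ((\<bullet>) (u - l)) Basis"
  proof -
    have B: "Basis = {axis 1 1, axis 2 1, axis 3 1 :: real^3}"
      by (auto simp: Basis_vec_def UNIV_3)
    show ?thesis unfolding B by (simp add: axis_eq_axis inner_axis)
  qed
  finally show "emeasure (distr lborel borel ?v) (box l u) = (\<Prod>b\<in>Basis. (u - l) \<bullet> b)" .
qed simp

definition spherical_box :: "(real \<times> real \<times> real) set" where
  "spherical_box = {0<..} \<times> {0<..<pi} \<times> {0<..<2 * pi}"

lemma spherical_integral:
  fixes f :: "real^3 \<Rightarrow> real"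
  assumes f: "integrable lborel f"
  shows "(\<integral>x. f x \<partial>lborel) =
     (\<integral>(r, \<theta>, \<phi>). indicator spherical_box (r, \<theta>, \<phi>) * (r\<^sup>2 * sin \<theta> * f (r *\<^sub>R unit_sphere \<theta> \<phi>)) \<partial>lborel)"
    and "integrable lborel (\<lambda>(r, \<theta>, \<phi>). indicator spherical_box (r, \<theta>, \<phi>) * (r\<^sup>2 * sin \<theta> * f (r *\<^sub>R unit_sphere \<theta> \<phi>)))"
proof -
  have fm [measurable]: "f \<in> borel_measurable borel" using borel_measurable_integrable[OF f] by simp
  let ?S = "spherical_dom" and ?g = "spherical"
  let ?v = "\<lambda>(a, b, c). vector [a, b, c] :: real^3"
  have S: "?S \<in> sets lebesgue" using spherical_dom_open by (simp add: borel_open)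
  have neg: "negligible (- ?g ` ?S)"
  proof (rule negligible_subset[OF _ spherical_image])
    have "negligible {x::real^3. axis 2 1 \<bullet> x = 0}"
      by (rule negligible_hyperplane) (simp add: axis_eq_0_iff)
    then show "negligible {x::real^3. x $ 2 = 0}" by (simp add: inner_axis')
  qed
  have abs: "f absolutely_integrable_on UNIV"
    using f by (simp add: set_integrable_def integrable_completion)
  have gS: "?g ` ?S \<in> sets lebesgue"
    by (rule differentiable_image_in_sets_lebesgue[OF S])
       (auto simp: differentiable_on_def differentiable_def intro: spherical_has_derivative)
  have absg: "f absolutely_integrable_on ?g ` ?S"
    by (rule set_integrable_subset[OF abs gS]) simp
  have "integral (?g ` ?S) f = integral UNIV f"
    by (rule integral_spike_set) (auto intro: negligible_subset[OF neg])
  also have "\<dots> = (\<integral>x. f x \<partial>lborel)" by (rule integral_lborel[OF f])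
  finally have intg: "integral (?g ` ?S) f = (\<integral>x. f x \<partial>lborel)" .
  let ?h = "\<lambda>y. (y$1)\<^sup>2 * sin (y$2) * f (spherical y)"
  have h: "?h absolutely_integrable_on ?S \<and> integral ?S ?h = (\<integral>x. f x \<partial>lborel)"
  proof -
    \<comment> \<open>The change of variables theorem speaks about vector-valued integrands, so the
      scalar \<open>f\<close> is passed through \<open>real^1\<close>.\<close>
    have "(\<lambda>y. \<bar>det (matrix (\<lambda>h. spherical_jacobian y *v h))\<bar> *\<^sub>R (vec (f (?g y)) :: real^1)) absolutely_integrable_on ?S \<and>
        integral ?S (\<lambda>y. \<bar>det (matrix (\<lambda>h. spherical_jacobian y *v h))\<bar> *\<^sub>R vec (f (?g y))) = (vec (\<integral>x. f x \<partial>lborel) :: real^1)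
      \<longleftrightarrow> (\<lambda>x. vec (f x) :: real^1) absolutely_integrable_on ?g ` ?S \<and>
        integral (?g ` ?S) (\<lambda>x. vec (f x)) = (vec (\<integral>x. f x \<partial>lborel) :: real^1)"
      by (rule has_absolute_integral_change_of_variables[OF S spherical_has_derivative inj_on_spherical])
    then have *: "(\<lambda>y. \<bar>(y$1)\<^sup>2 * sin (y$2)\<bar> * f (?g y)) absolutely_integrable_on ?S \<and>
        integral ?S (\<lambda>y. \<bar>(y$1)\<^sup>2 * sin (y$2)\<bar> * f (?g y)) = (\<integral>x. f x \<partial>lborel)"
      using absg intg by (simp add: absolutely_integrable_on_1_iff integral_on_1_eq det_spherical)
    have eq: "\<bar>(y$1)\<^sup>2 * sin (y$2)\<bar> * f (?g y) = ?h y" if "y \<in> ?S" for y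
      using that sin_gt_zero[of "y$2"] by (simp add: spherical_dom_def abs_mult)
    show ?thesis
      using * by (subst (asm) set_integrable_cong[OF refl refl eq]; simp) (simp add: eq cong: integral_cong)
  qed
  have spm [measurable]: "spherical \<in> borel_measurable borel"
    by (intro borel_measurable_continuous_onI differentiable_imp_continuous_on)
       (auto simp: differentiable_on_def differentiable_def intro: spherical_has_derivative)
  let ?H = "\<lambda>y. indicator ?S y * ?h y"
  have Sb [measurable]: "?S \<in> sets borel" using spherical_dom_open by simp
  have vn [measurable]: "(\<lambda>y::real^3. y $ k) \<in> borel_measurable borel" for k
    by (intro borel_measurable_continuous_onI continuous_intros)
  have Hm: "?H \<in> borel_measurable lborel" by measurable
  have "integrable lebesgue ?H" using h by (simp add: set_integrable_def)
  then have Hi: "integrable lborel ?H" using Hm by (simp add: integrable_completion)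
  have "integral ?S ?h = (\<integral>y. ?H y \<partial>lebesgue)"
    using set_lebesgue_integral_eq_integral(2)[of ?S ?h] h by (simp add: set_lebesgue_integral_def)
  also have "\<dots> = (\<integral>y. ?H y \<partial>lborel)" by (rule integral_completion[OF Hm])
  finally have HI: "(\<integral>x. f x \<partial>lborel) = (\<integral>y. ?H y \<partial>lborel)" using h by simp
  have "?v = (\<lambda>p. fst p *\<^sub>R axis 1 1 + fst (snd p) *\<^sub>R axis 2 1 + snd (snd p) *\<^sub>R axis 3 1)"
    by (auto simp: fun_eq_iff vec_eq_iff forall_3 axis_def)
  then have "continuous_on UNIV ?v" by (simp only:) (intro continuous_intros)
  then have vm: "?v \<in> borel_measurable borel" by (rule borel_measurable_continuous_onI)
  have comp: "(\<lambda>p. ?H (?v p)) = (\<lambda>(r, \<theta>, \<phi>). indicator spherical_box (r, \<theta>, \<phi>) * (r\<^sup>2 * sin \<theta> * f (r *\<^sub>R unit_sphere \<theta> \<phi>)))"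
    by (auto simp: fun_eq_iff spherical_def spherical_dom_def spherical_box_def indicator_def)
  have "(\<integral>y. ?H y \<partial>lborel) = (\<integral>p. ?H (?v p) \<partial>lborel)"
    using vm Hm by (subst lborel_vector3) (subst integral_distr, auto)
  then show "(\<integral>x. f x \<partial>lborel) =
     (\<integral>(r, \<theta>, \<phi>). indicator spherical_box (r, \<theta>, \<phi>) * (r\<^sup>2 * sin \<theta> * f (r *\<^sub>R unit_sphere \<theta> \<phi>)) \<partial>lborel)"
    unfolding HI comp .
  have "integrable (distr lborel borel ?v) ?H" using Hi by (simp only: lborel_vector3[symmetric])
  then have "integrable lborel (\<lambda>p. ?H (?v p))"
    using vm by (subst (asm) integrable_distr_eq) (use Hm in auto)
  then show "integrable lborel (\<lambda>(r, \<theta>, \<phi>). indicator spherical_box (r, \<theta>, \<phi>) * (r\<^sup>2 * sin \<theta> * f (r *\<^sub>R unit_sphere \<theta> \<phi>)))"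
    unfolding comp .
qed

section \<open>Concentration of the shell integral on the sphere\<close>

lemma lborel_integral_fst:
  fixes f :: "'a::euclidean_space \<times> 'b::euclidean_space \<Rightarrow> real"
  assumes "integrable lborel f"
  shows "(\<integral>x. \<integral>y. f (x, y) \<partial>lborel \<partial>lborel) = integral\<^sup>L lborel f"
    and "integrable lborel (\<lambda>x. \<integral>y. f (x, y) \<partial>lborel)"
  using lborel_pair.integral_fst'[of f] lborel_pair.integrable_fst'[of f] assms
  by (simp_all add: lborel_prod)

lemma lborel_integral_snd:
  fixes f :: "'a::euclidean_space \<times> 'b::euclidean_space \<Rightarrow> real"
  assumes "integrable lborel f"
  shows "(\<integral>y. \<integral>x. f (x, y) \<partial>lborel \<partial>lborel) = integral\<^sup>L lborel f"
    and "integrable lborel (\<lambda>y. \<integral>x. f (x, y) \<partial>lborel)"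
  using lborel_pair.integral_snd[of "\<lambda>x y. f (x, y)"] lborel_pair.integrable_snd[of "\<lambda>x y. f (x, y)"] assms
  by (simp_all add: lborel_prod)

text \<open>The integrand is the derivative of
  \<open>- step ((R\<^sup>2 - r\<^sup>2) / \<delta>)\<close>, so its mass is
  \<open>step (R\<^sup>2 / \<delta>)\<close>, which is at most 1 for every
  \<open>\<delta>\<close>.\<close>

lemma radial_bump_integral_le:
  assumes \<delta>: "\<delta> > 0" and R: "R > 0"
  shows "(\<integral>r. (2 * r / \<delta> * bump ((R\<^sup>2 - r\<^sup>2) / \<delta>)) * indicator {0..R} r \<partial>lborel) \<le> 1"
proof -
  have "(\<integral>r. (2 * r / \<delta> * bump ((R\<^sup>2 - r\<^sup>2) / \<delta>)) * indicator {0..R} r \<partial>lborel)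
    = - step ((R\<^sup>2 - R\<^sup>2) / \<delta>) - - step ((R\<^sup>2 - 0\<^sup>2) / \<delta>)"
  proof (rule integral_FTC_Icc_real)
    fix r
    have "((\<lambda>r. (R\<^sup>2 - r\<^sup>2) / \<delta>) has_real_derivative - (2 * r / \<delta>)) (at r)"
      using \<delta> by (auto intro!: derivative_eq_intros)
    then have "((\<lambda>r. step ((R\<^sup>2 - r\<^sup>2) / \<delta>)) has_real_derivative bump ((R\<^sup>2 - r\<^sup>2) / \<delta>) * - (2 * r / \<delta>)) (at r)"
      by (rule DERIV_chain2[OF step_deriv])
    then have "((\<lambda>r. - step ((R\<^sup>2 - r\<^sup>2) / \<delta>)) has_real_derivative - (bump ((R\<^sup>2 - r\<^sup>2) / \<delta>) * - (2 * r / \<delta>))) (at r)"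
      by (rule DERIV_minus)
    then show "((\<lambda>r. - step ((R\<^sup>2 - r\<^sup>2) / \<delta>)) has_real_derivative 2 * r / \<delta> * bump ((R\<^sup>2 - r\<^sup>2) / \<delta>)) (at r)"
      by (simp add: mult.commute)
    have "continuous_on UNIV (\<lambda>r. 2 * r / \<delta> * bump ((R\<^sup>2 - r\<^sup>2) / \<delta>))"
      using \<delta> by (intro continuous_on_mult continuous_on_divide continuous_on_const continuous_on_id
        continuous_on_compose2[OF continuous_bump[of UNIV]] continuous_on_diff continuous_on_power; simp)
    then show "isCont (\<lambda>r. 2 * r / \<delta> * bump ((R\<^sup>2 - r\<^sup>2) / \<delta>)) r"
      by (simp add: continuous_on_eq_continuous_at)
  qed (use R in auto)
  also have "\<dots> \<le> 1" using step_le_1[of "R\<^sup>2 / \<delta>"] by (simp add: step_0)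
  finally show ?thesis .
qed

definition sphere_box :: "real \<Rightarrow> (real \<times> real \<times> real) set" where
  "sphere_box T = {0..T} \<times> {0..pi} \<times> {0..2 * pi}"

lemma compact_sphere_box: "compact (sphere_box T)"
  unfolding sphere_box_def by (intro compact_Times compact_Icc)

text \<open>In spherical coordinates the radial density has mass at most 1 and lives near
  \<open>r = R\<close>, where uniform continuity replaces the integrand by its value on the sphere.
  An upper limit is all that the wave estimate asks for.\<close>

lemma shell_integral_limit:
  fixes q :: "pt \<Rightarrow> real"
  assumes q: "continuous_on UNIV q" and q0: "\<And>p. 0 \<le> q p" and R: "R > 0" and \<eta>: "\<eta> > 0"
  obtains \<delta>0 where "\<delta>0 > 0" "\<And>\<delta>. 0 < \<delta> \<Longrightarrow> \<delta> < \<delta>0 \<Longrightarrow>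
    shell_integral R \<delta> T q \<le> integral (sphere_box T) (\<lambda>(t, \<theta>, \<phi>). R * q (R *\<^sub>R unit_sphere \<theta> \<phi>, t) * sin \<theta>) + \<eta>"
proof -
  define V where "V = measure lborel (sphere_box T)"
  have V: "V \<ge> 0" by (simp add: V_def)
  define e where "e = \<eta> / (V + 1)"
  have e: "e > 0" "e * V \<le> \<eta>" using \<eta> V by (auto simp: e_def field_simps)
  \<comment> \<open>Of the two factors \<open>r\<close> in the volume element, one completes the
    radial density and the other stays with \<open>q\<close>.\<close>
  let ?k = "\<lambda>(r, t, \<theta>, \<phi>). r * q (r *\<^sub>R unit_sphere \<theta> \<phi>, t)"
  have ucont: "uniformly_continuous_on ({0..R} \<times> sphere_box T) ?k"
  proof (rule compact_uniformly_continuous)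
    have "continuous_on UNIV ?k"
      unfolding case_prod_beta
      by (intro continuous_intros continuous_on_compose2[OF q]) auto
    then show "continuous_on ({0..R} \<times> sphere_box T) ?k" by (rule continuous_on_subset) simp
    show "compact ({0..R} \<times> sphere_box T)" by (intro compact_Times compact_Icc compact_sphere_box)
  qed
  obtain \<rho> where \<rho>: "\<rho> > 0" and uc: "\<And>x x'. x \<in> {0..R} \<times> sphere_box T \<Longrightarrow> x' \<in> {0..R} \<times> sphere_box T \<Longrightarrow>
      dist x' x < \<rho> \<Longrightarrow> dist (?k x') (?k x) < e"
    by (rule uniformly_continuous_onE[OF ucont e(1)], rule that)
  have close: "r * q (r *\<^sub>R unit_sphere \<theta> \<phi>, t) \<le> R * q (R *\<^sub>R unit_sphere \<theta> \<phi>, t) + e"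
    if "0 \<le> r" "r \<le> R" "R - r < \<rho>" "(t, \<theta>, \<phi>) \<in> sphere_box T" for r t \<theta> \<phi>
  proof -
    have "dist (r, t, \<theta>, \<phi>) (R, t, \<theta>, \<phi>) < \<rho>"
      using that by (simp add: dist_Pair_Pair dist_real_def)
    moreover have "(r, t, \<theta>, \<phi>) \<in> {0..R} \<times> sphere_box T" "(R, t, \<theta>, \<phi>) \<in> {0..R} \<times> sphere_box T"
      using that R by simp_all
    ultimately have "dist (?k (r, t, \<theta>, \<phi>)) (?k (R, t, \<theta>, \<phi>)) < e" using uc by blast
    then show ?thesis by (simp add: dist_real_def abs_less_iff)
  qed
  show thesis
  \<comment> \<open>Where \<open>bump\<close> does not vanish,
    \<open>(R - r) * (R + r) < \<delta>\<close>, hence \<open>R - r < \<delta> / R\<close>; below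
    this threshold that is less than the modulus of continuity \<open>\<rho>\<close>.\<close>
  proof (rule that[of "\<rho> * R"])
    show "\<rho> * R > 0" using \<rho> R by simp
    fix \<delta> :: real assume \<delta>: "0 < \<delta>" "\<delta> < \<rho> * R"
    let ?h = "\<lambda>p. indicator (cball 0 R \<times> {0..T}) p * (2 / \<delta> * bump (radial_arg R \<delta> p) * q p) :: real"
    let ?A = "\<lambda>r. (2 * r / \<delta> * bump ((R\<^sup>2 - r\<^sup>2) / \<delta>)) * indicator {0..R} r"
    let ?G = "\<lambda>(t, \<theta>, \<phi>). indicator (sphere_box T) (t, \<theta>, \<phi>) * ((R * q (R *\<^sub>R unit_sphere \<theta> \<phi>, t) + e) * sin \<theta>)"
    have A0: "0 \<le> ?A r" for r using \<delta>(1) by (simp add: bump_nonneg indicator_def)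
    have sin0: "0 \<le> sin \<theta>" if "(t, \<theta>, \<phi>) \<in> sphere_box T" for t \<theta> \<phi>
      using that by (intro sin_ge_zero) (auto simp: sphere_box_def)
    have G0: "0 \<le> ?G x" for x
      using q0 R e(1) sin0 by (cases x) (auto simp: indicator_def intro!: mult_nonneg_nonneg add_nonneg_nonneg)
    have contG: "continuous_on S (\<lambda>(t, \<theta>, \<phi>). (R * q (R *\<^sub>R unit_sphere \<theta> \<phi>, t) + e) * sin \<theta>)" for S
      unfolding case_prod_beta by (intro continuous_intros continuous_on_compose2[OF q]) auto
    have intG: "integrable lborel ?G"
    proof -
      have "?G = (\<lambda>x. indicator (sphere_box T) x *\<^sub>R (case x of (t, \<theta>, \<phi>) \<Rightarrow> (R * q (R *\<^sub>R unit_sphere \<theta> \<phi>, t) + e) * sin \<theta>))"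
        by (auto simp: fun_eq_iff)
      then show ?thesis by (simp only: borel_integrable_compact[OF compact_sphere_box contG])
    qed
    let ?g = "\<lambda>(t, \<theta>, \<phi>). R * q (R *\<^sub>R unit_sphere \<theta> \<phi>, t) * sin \<theta>"
    have "continuous_on (sphere_box T) ?g"
      unfolding case_prod_beta by (intro continuous_intros continuous_on_compose2[OF q]) auto
    from borel_integrable_compact[OF compact_sphere_box this]
    have ig: "integrable lborel (\<lambda>x. indicator (sphere_box T) x *\<^sub>R ?g x)" .
    have ii: "integrable lborel (\<lambda>x. e * indicator (sphere_box T) x)"
      using emeasure_compact_finite[OF compact_sphere_box]
      by (intro Bochner_Integration.integrable_mult_right integrable_real_indicator)
         (auto intro: borel_compact compact_sphere_box)
    have inner: "(\<integral>x. ?h (x, t) \<partial>lborel) \<le> (\<integral>y. ?G (t, y) \<partial>lborel)" for t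
    proof -
      let ?ht = "\<lambda>x. ?h (x, t)"
      have iht: "integrable lborel ?ht"
      proof -
        have "continuous_on (cball 0 R) (\<lambda>x. indicator {0..T} t * (2 / \<delta> * bump (radial_arg R \<delta> (x, t)) * q (x, t)))"
          unfolding radial_arg_def using \<delta>
          by (intro continuous_intros continuous_on_compose2[OF q] continuous_on_compose2[OF continuous_bump[of UNIV]]) auto
        from borel_integrable_compact[OF compact_cball this] show ?thesis
          by (simp add: indicator_times mult_ac)
      qed
      note sph = spherical_integral[OF iht]
      let ?L = "\<lambda>(r, \<theta>, \<phi>). indicator spherical_box (r, \<theta>, \<phi>) * (r\<^sup>2 * sin \<theta> * ?ht (r *\<^sub>R unit_sphere \<theta> \<phi>))"
      let ?P = "\<lambda>(r, y). ?A r * ?G (t, y)"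
      have intP: "integrable lborel ?P"
      proof (cases "t \<in> {0..T}")
        case True
        have "continuous_on ({0..R} \<times> {0..pi} \<times> {0..2 * pi})
          (\<lambda>(r, \<theta>, \<phi>). (2 * r / \<delta> * bump ((R\<^sup>2 - r\<^sup>2) / \<delta>)) * ((R * q (R *\<^sub>R unit_sphere \<theta> \<phi>, t) + e) * sin \<theta>))"
          unfolding case_prod_beta using \<delta>
          by (intro continuous_intros continuous_on_compose2[OF q] continuous_on_compose2[OF continuous_bump[of UNIV]]) auto
        from borel_integrable_compact[OF compact_Times[OF compact_Icc compact_Times[OF compact_Icc compact_Icc]] this]
        show ?thesis
          by (rule back_subst[of "integrable lborel"]) (use True in \<open>auto simp: fun_eq_iff indicator_def sphere_box_def\<close>)
      next
        case False
        then have "?P = (\<lambda>_. 0)" by (auto simp: fun_eq_iff sphere_box_def)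
        then show ?thesis by simp
      qed
      have "integral\<^sup>L lborel ?ht = integral\<^sup>L lborel ?L" by (rule sph(1))
      also have "\<dots> \<le> integral\<^sup>L lborel ?P"
      proof (rule Bochner_Integration.integral_mono[OF sph(2) intP])
        fix x :: "real \<times> real \<times> real"
        obtain r \<theta> \<phi> where x: "x = (r, \<theta>, \<phi>)" by (cases x)
        have P0: "0 \<le> ?P x" using mult_nonneg_nonneg[OF A0[of r] G0[of "(t, \<theta>, \<phi>)"]] by (simp only: x prod.case)
        show "?L x \<le> ?P x"
        proof (cases "x \<in> spherical_box \<and> r \<le> R \<and> t \<in> {0..T} \<and> bump ((R\<^sup>2 - r\<^sup>2) / \<delta>) \<noteq> 0")
          case True
          then have r: "0 < r" "r \<le> R" and sb: "(t, \<theta>, \<phi>) \<in> sphere_box T"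
            by (auto simp: x spherical_box_def sphere_box_def)
          have "(R\<^sup>2 - r\<^sup>2) / \<delta> < 1" using True bump_0[of "(R\<^sup>2 - r\<^sup>2) / \<delta>"] by force
          then have "(R - r) * (R + r) < \<delta>" using \<delta>(1) by (simp add: power2_eq_square algebra_simps)
          moreover have "(R - r) * R \<le> (R - r) * (R + r)" using r by (intro mult_left_mono) auto
          ultimately have "(R - r) * R < \<rho> * R" using \<delta>(2) by linarith
          then have "R - r < \<rho>" using R by simp
          from close[OF _ r(2) this sb] r(1)
          have c: "r * q (r *\<^sub>R unit_sphere \<theta> \<phi>, t) \<le> R * q (R *\<^sub>R unit_sphere \<theta> \<phi>, t) + e" by simp
          have ra: "radial_arg R \<delta> (r *\<^sub>R unit_sphere \<theta> \<phi>, t) = (R\<^sup>2 - r\<^sup>2) / \<delta>"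
            by (simp add: radial_arg_def power2_eq_square)
          have "?L x = (2 * r / \<delta> * bump ((R\<^sup>2 - r\<^sup>2) / \<delta>)) * (sin \<theta> * (r * q (r *\<^sub>R unit_sphere \<theta> \<phi>, t)))"
            using True r by (simp add: x ra power2_eq_square)
          also have "\<dots> \<le> (2 * r / \<delta> * bump ((R\<^sup>2 - r\<^sup>2) / \<delta>)) * (sin \<theta> * (R * q (R *\<^sub>R unit_sphere \<theta> \<phi>, t) + e))"
            using r \<delta>(1) sin0[OF sb] c by (intro mult_left_mono) (auto simp: bump_nonneg)
          also have "\<dots> = ?P x" using r sb by (simp add: x mult_ac)
          finally show ?thesis .
        next
          case False
          have "?L x = 0"
            using False by (auto simp: x radial_arg_def power2_eq_square spherical_box_def indicator_def)
          then show ?thesis using P0 by simp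
        qed
      qed
      also have "integral\<^sup>L lborel ?P = (\<integral>r. \<integral>y. ?A r * ?G (t, y) \<partial>lborel \<partial>lborel)"
        using lborel_integral_fst(1)[OF intP] by simp
      also have "\<dots> = (\<integral>r. ?A r \<partial>lborel) * (\<integral>y. ?G (t, y) \<partial>lborel)" by simp
      also have "\<dots> \<le> 1 * (\<integral>y. ?G (t, y) \<partial>lborel)"
        by (intro mult_right_mono radial_bump_integral_le \<delta> R Bochner_Integration.integral_nonneg G0)
      finally show ?thesis by simp
    qed
    have "shell_integral R \<delta> T q = (\<integral>t. \<integral>x. ?h (x, t) \<partial>lborel \<partial>lborel)"
      unfolding shell_integral_def by (rule lborel_integral_snd(1)[OF shell_integrable[OF q], symmetric])
    also have "\<dots> \<le> (\<integral>t. \<integral>y. ?G (t, y) \<partial>lborel \<partial>lborel)"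
      by (intro Bochner_Integration.integral_mono inner lborel_integral_snd(2)[OF shell_integrable[OF q]]
          lborel_integral_fst(2)[OF intG])
    also have "\<dots> = integral\<^sup>L lborel ?G" by (rule lborel_integral_fst(1)[OF intG])
    also have "\<dots> \<le> (\<integral>x. indicator (sphere_box T) x *\<^sub>R ?g x + e * indicator (sphere_box T) x \<partial>lborel)"
    proof (rule Bochner_Integration.integral_mono[OF intG Bochner_Integration.integrable_add[OF ig ii]])
      fix x :: "real \<times> real \<times> real"
      obtain t \<theta> \<phi> where x: "x = (t, \<theta>, \<phi>)" by (cases x)
      have "e * sin \<theta> \<le> e * 1" using e(1) by (intro mult_left_mono) auto
      then show "?G x \<le> indicator (sphere_box T) x *\<^sub>R ?g x + e * indicator (sphere_box T) x"
        by (simp add: x indicator_def distrib_right)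
    qed
    also have "\<dots> = (\<integral>x. indicator (sphere_box T) x *\<^sub>R ?g x \<partial>lborel) + (\<integral>x. e * indicator (sphere_box T) x \<partial>lborel)"
      by (rule Bochner_Integration.integral_add[OF ig ii])
    also have "(\<integral>x. indicator (sphere_box T) x *\<^sub>R ?g x \<partial>lborel) = integral (sphere_box T) ?g"
      using set_borel_integral_eq_integral(2)[of "sphere_box T" ?g] ig
      by (simp only: set_integrable_def set_lebesgue_integral_def)
    also have "(\<integral>x. e * indicator (sphere_box T) x \<partial>lborel) = e * V" by (simp add: V_def)
    finally show "shell_integral R \<delta> T q \<le> integral (sphere_box T) ?g + \<eta>" using e(2) by linarith
  qed
qed

section \<open>The Fourier transform of the source at high frequencies\<close>

lemma smooth_expr_compose:
  fixes g :: "real \<Rightarrow> real" and f :: "'a::euclidean_space \<Rightarrow> real"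
  assumes "smooth_expr g" "smooth_expr f"
  shows "smooth_expr (\<lambda>x. g (f x))"
  using assms(1)
proof (induction rule: smooth_expr.induct)
  case (inner b)
  show ?case using smooth_expr.mult[OF assms(2) smooth_expr.const[of b]] by simp
next
  case (inverse h)
  then show ?case by (intro smooth_expr.inverse) auto
next
  case (const c)
  show ?case by (rule smooth_expr.const)
next
  case (add g1 g2)
  show ?case by (rule smooth_expr.add[OF add(3,4)])
next
  case (mult g1 g2)
  show ?case by (rule smooth_expr.mult[OF mult(3,4)])
next
  case (cos h)
  show ?case by (rule smooth_expr.cos[OF cos(2)])
next
  case (sin h)
  show ?case by (rule smooth_expr.sin[OF sin(2)])
next
  case (flat h m)
  show ?case by (rule smooth_expr.flat[OF flat(2)])
qed

lemma smooth_expr_real_deriv: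
  fixes g :: "real \<Rightarrow> real"
  assumes "smooth_expr g"
  obtains g' where "smooth_expr g'" "\<And>u. (g has_real_derivative g' u) (at u)"
proof
  let ?g' = "\<lambda>u. frechet_derivative g (at u) 1"
  show "smooth_expr ?g'" by (rule smooth_expr_frechet[OF assms])
  fix u
  have D: "(g has_derivative frechet_derivative g (at u)) (at u)" by (rule smooth_expr_has_derivative[OF assms])
  have "frechet_derivative g (at u) = (*) (?g' u)"
  proof
    fix v
    have "frechet_derivative g (at u) (v *\<^sub>R 1) = v *\<^sub>R ?g' u"
      by (rule linear_cmul[OF has_derivative_linear[OF D]])
    then show "frechet_derivative g (at u) v = ?g' u * v" by simp
  qed
  with D show "(g has_real_derivative ?g' u) (at u)" by (simp add: has_field_derivative_def)
qed

lemma smooth_expr_ident: "smooth_expr (\<lambda>u::real. u)"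
  using smooth_expr.inner[of "1::real"] by simp

text \<open>A plateau of height 1 on \<open>[- a, c]\<close> with flanks of width \<open>r\<close>;
  the left end enters with reversed sign.\<close>

definition window :: "real \<Rightarrow> real \<Rightarrow> real \<Rightarrow> real \<Rightarrow> real" where
  "window r a c u = step ((c + r - u) / r) * step ((u + a + r) / r)"

definition window' :: "real \<Rightarrow> real \<Rightarrow> real \<Rightarrow> real \<Rightarrow> real" where
  "window' r a c u = step ((c + r - u) / r) * (bump ((u + a + r) / r) / r) - bump ((c + r - u) / r) / r * step ((u + a + r) / r)"

lemma smooth_expr_window: "smooth_expr (window r a c)"
  unfolding window_def[abs_def] divide_inverse
  by (intro smooth_expr.mult smooth_expr_step smooth_expr.const smooth_expr_diff smooth_expr.add smooth_expr_ident)

lemma window_deriv: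
  assumes "r > 0" shows "(window r a c has_real_derivative window' r a c u) (at u)"
proof -
  have 1: "((\<lambda>u. step ((c + r - u) / r)) has_real_derivative bump ((c + r - u) / r) * (- 1 / r)) (at u)"
    by (rule DERIV_chain2[OF step_deriv]) (use assms in \<open>auto intro!: derivative_eq_intros\<close>)
  have 2: "((\<lambda>u. step ((u + a + r) / r)) has_real_derivative bump ((u + a + r) / r) * (1 / r)) (at u)"
    by (rule DERIV_chain2[OF step_deriv]) (use assms in \<open>auto intro!: derivative_eq_intros\<close>)
  show ?thesis
    unfolding window_def[abs_def] window'_def
    by (rule DERIV_cong[OF DERIV_mult[OF 1 2]]) (simp add: algebra_simps)
qed

lemma window_props:
  assumes "r > 0"
  shows "- a \<le> u \<Longrightarrow> u \<le> c \<Longrightarrow> window r a c u = 1"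
    and "u \<ge> c + r \<or> u \<le> - a - r \<Longrightarrow> window r a c u = 0"
    and "u \<ge> c + r \<or> u \<le> - a - r \<Longrightarrow> window' r a c u = 0"
    and "0 \<le> window r a c u" and "window r a c u \<le> 1"
proof -
  show "window r a c u = 1" if "- a \<le> u" "u \<le> c"
  proof -
    have "1 \<le> (c + r - u) / r" "1 \<le> (u + a + r) / r" using assms that by (simp_all add: pos_le_divide_eq)
    then show ?thesis by (simp add: window_def step_1)
  qed
  have "u \<ge> c + r \<or> u \<le> - a - r \<Longrightarrow> (c + r - u) / r \<le> 0 \<or> (u + a + r) / r \<le> 0"
    using assms by (auto simp: divide_le_0_iff)
  then show "u \<ge> c + r \<or> u \<le> - a - r \<Longrightarrow> window r a c u = 0"
    "u \<ge> c + r \<or> u \<le> - a - r \<Longrightarrow> window' r a c u = 0"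
    by (auto simp: window_def window'_def step_0 bump_0)
  show "0 \<le> window r a c u" "window r a c u \<le> 1"
    by (auto simp: window_def step_nonneg step_le_1 intro: mult_le_one)
qed

lemma window'_bound:
  assumes "r > 0" "\<And>x. bump x \<le> B"
  shows "\<bar>window' r a c u\<bar> \<le> B / r"
proof -
  have b: "0 \<le> bump x / r" "bump x / r \<le> B / r" for x
    using assms bump_nonneg[of x] by (auto simp: divide_right_mono)
  have p: "0 \<le> step x * (bump y / r)" "step x * (bump y / r) \<le> B / r" for x y
    using mult_nonneg_nonneg[OF step_nonneg[of x] b(1)[of y]]
      order_trans[OF mult_left_le_one_le[OF b(1)[of y] step_nonneg[of x] step_le_1[of x]] b(2)[of y]] by auto
  show ?thesis
    using p[of "(c + r - u) / r" "(u + a + r) / r"] p[of "(u + a + r) / r" "(c + r - u) / r"]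
    by (simp add: window'_def abs_le_iff mult.commute)
qed

lemma sphere_box_cbox: "sphere_box T = cbox (0, 0, 0) (T, pi, 2 * pi)"
  by (simp add: sphere_box_def cbox_Pair_eq)

text \<open>The shell estimate works with the position \<open>R *\<^sub>R \<nu>\<close> instead of
  the unit normal. The resulting \<open>R\<^sup>2\<close> is exactly the surface Jacobian in
  \<open>bdry_int\<close>, so a single factor \<open>R\<close> is left over.\<close>

lemma bdry_integral_le:
  assumes E: "C1x E" and R: "R > 0" and T: "T1 \<le> T"
  shows "integral (sphere_box T1) (\<lambda>(t, \<theta>, \<phi>). R * ((norm (cross3 (curlx E (R *\<^sub>R unit_sphere \<theta> \<phi>, t)) (R *\<^sub>R unit_sphere \<theta> \<phi>)))\<^sup>2
      + (norm (cross3 (E (R *\<^sub>R unit_sphere \<theta> \<phi>, t)) (R *\<^sub>R unit_sphere \<theta> \<phi>)))\<^sup>2) * sin \<theta>) \<le> R * bdry_int R E T"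
proof -
  let ?f = "\<lambda>(t, \<theta>, \<phi>). ((norm (cross3 (curlx E (R *\<^sub>R unit_sphere \<theta> \<phi>, t)) (unit_sphere \<theta> \<phi>)))\<^sup>2
      + (norm (cross3 (E (R *\<^sub>R unit_sphere \<theta> \<phi>, t)) (unit_sphere \<theta> \<phi>)))\<^sup>2) * R\<^sup>2 * sin \<theta>"
  have cE: "continuous_on UNIV E" and cc: "continuous_on UNIV (curlx E)"
    using E continuous_curlx[OF E] by (auto simp: C1x_def)
  have cf: "continuous_on S ?f" for S
    unfolding case_prod_beta
    by (intro continuous_intros continuous_on_cross continuous_on_compose2[OF cE] continuous_on_compose2[OF cc]) auto
  have eq: "bdry_int R E T = integral (sphere_box T) ?f"
    by (simp add: bdry_int_def sphere_box_def unit_sphere_def Let_def)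
  have int: "?f integrable_on sphere_box T" for T
    unfolding sphere_box_cbox by (rule integrable_continuous[OF cf])
  have cr: "cross3 v (R *\<^sub>R w) = R *\<^sub>R cross3 v w" for v w
    by (simp add: vec_eq_iff forall_3 algebra_simps)
  have "integral (sphere_box T1) (\<lambda>(t, \<theta>, \<phi>). R * ((norm (cross3 (curlx E (R *\<^sub>R unit_sphere \<theta> \<phi>, t)) (R *\<^sub>R unit_sphere \<theta> \<phi>)))\<^sup>2
      + (norm (cross3 (E (R *\<^sub>R unit_sphere \<theta> \<phi>, t)) (R *\<^sub>R unit_sphere \<theta> \<phi>)))\<^sup>2) * sin \<theta>)
     = integral (sphere_box T1) (\<lambda>x. R * ?f x)"
    by (rule integral_cong) (auto simp: cr power_mult_distrib algebra_simps)
  also have "\<dots> = R * integral (sphere_box T1) ?f" by simp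
  also have "\<dots> \<le> R * integral (sphere_box T) ?f"
  proof (rule mult_left_mono)
    show "integral (sphere_box T1) ?f \<le> integral (sphere_box T) ?f"
      using T by (intro integral_subset_le int) (auto simp: sphere_box_def sin_ge_zero)
  qed (use R in simp)
  finally show ?thesis by (simp add: eq)
qed

lemma sphere_area_le:
  assumes R: "R > 0" and T: "T \<ge> 0"
  shows "integral (sphere_box T) (\<lambda>(t, \<theta>, \<phi>). R * 1 * sin \<theta>) \<le> 2 * pi\<^sup>2 * R * T"
proof -
  have "integral (sphere_box T) (\<lambda>(t, \<theta>, \<phi>). R * 1 * sin \<theta>) \<le> integral (sphere_box T) (\<lambda>_. R)"
  proof (rule integral_le)
    show "(\<lambda>(t, \<theta>, \<phi>). R * 1 * sin \<theta>) integrable_on sphere_box T"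
      unfolding sphere_box_cbox case_prod_beta by (intro integrable_continuous continuous_intros)
    show "(\<lambda>_. R) integrable_on sphere_box T" unfolding sphere_box_cbox by (rule integrable_const)
  qed (use R in \<open>auto simp: mult_left_le\<close>)
  also have "\<dots> = measure lborel (cbox (0, 0, 0) (T, pi, 2 * pi)) * R"
    unfolding sphere_box_cbox by simp
  also have "measure lborel (cbox (0, 0, 0 :: real) (T, pi, 2 * pi)) = T * (pi * (2 * pi))"
    using T by (simp add: content_Pair)
  finally show ?thesis by (simp add: power2_eq_square mult_ac)
qed

text \<open>A closed support inside a bounded open set is compact, so it keeps a positive distance
  from the sphere and from time 0. This leaves room for cutoffs that equal 1 on the support.\<close>

lemma compact_support_margins:
  fixes F :: "pt \<Rightarrow> real^3"
  assumes R: "R > 0" and T0: "T0 > 0" and supp: "closure {p. F p \<noteq> 0} \<subseteq> ball 0 R \<times> {0<..<T0}"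
  obtains r \<tau> where "0 \<le> r" "r < R" "0 < \<tau>" "\<And>p. F p \<noteq> 0 \<Longrightarrow> norm (fst p) \<le> r \<and> \<tau> \<le> snd p \<and> snd p < T0"
proof (cases "{p. F p \<noteq> 0} = {}")
  case True
  then show ?thesis using R by (intro that[of 0 1]) auto
next
  case False
  let ?S = "closure {p. F p \<noteq> 0}"
  have "bounded ?S"
    by (rule bounded_subset[OF _ supp]) (intro bounded_Times bounded_ball bounded_subset[OF bounded_closed_interval[of 0 T0]]; auto)
  then have c: "compact ?S" by (simp add: compact_eq_bounded_closed)
  have ne: "?S \<noteq> {}" using False by simp
  have c1: "continuous_on ?S (\<lambda>p. norm (fst p))" and c2: "continuous_on ?S snd"
    by (intro continuous_intros)+
  obtain p where p: "p \<in> ?S" "\<And>q. q \<in> ?S \<Longrightarrow> norm (fst q) \<le> norm (fst p)"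
    using continuous_attains_sup[OF c ne c1] by blast
  obtain p' where p': "p' \<in> ?S" "\<And>q. q \<in> ?S \<Longrightarrow> snd p' \<le> snd q"
    using continuous_attains_inf[OF c ne c2] by blast
  show ?thesis
  proof (rule that[of "norm (fst p)" "snd p'"])
    have "p \<in> ball 0 R \<times> {0<..<T0}" "p' \<in> ball 0 R \<times> {0<..<T0}" using p(1) p'(1) supp by blast+
    then show "norm (fst p) < R" "0 < snd p'" by (simp_all add: mem_Times_iff)
    show "norm (fst q) \<le> norm (fst p) \<and> snd p' \<le> snd q \<and> snd q < T0" if "F q \<noteq> 0" for q
    proof -
      have q: "q \<in> ?S" by (rule subsetD[OF closure_subset]) (simp add: that)
      have "q \<in> ball 0 R \<times> {0<..<T0}" by (rule subsetD[OF supp q])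
      with p(2)[OF q] p'(2)[OF q] show ?thesis by (simp add: mem_Times_iff)
    qed
  qed simp
qed

text \<open>The cosine is multiplied by a window that equals 1 at every phase met by the support of
  \<open>F\<close>, so the windowed wave gives the same integral against \<open>F\<close>. The
  window contributes \<open>B / R\<close> to the derivative bound, and letting the shell shrink
  leaves the boundary data on the right.\<close>

lemma wave_bound:
  fixes s d :: "real^3"
  assumes R: "R > 0" and T0: "T0 > 0" and b: "b > 1"
    and supp: "closure {p. F p \<noteq> 0} \<subseteq> ball 0 R \<times> {0<..<T0}"
    and E: "maxwell_sol n F E" and n: "n = s \<bullet> s" and s: "norm s \<le> b / 2"
    and T: "2 * R * b\<^sup>2 + T0 \<le> T" and bdry: "bdry_int R E T \<le> \<epsilon>\<^sup>2" and \<epsilon>: "\<epsilon> > 0"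
    and ds: "d \<bullet> s = 0" and nd: "norm d = 1" and B: "\<And>x. bump x \<le> B"
  shows "\<bar>\<integral>p. cos (\<omega> * phase s p + \<theta>) * (F p \<bullet> d) \<partial>lborel\<bar>
    \<le> \<epsilon> * sqrt (2 * pi\<^sup>2 * R\<^sup>2 * ((T0 + 2 * R) * b) * (1 + n * (B / R + \<bar>\<omega>\<bar>)\<^sup>2))" (is "\<bar>?X\<bar> \<le> _")
proof -
  define \<sigma> where "\<sigma> = norm s"
  have \<sigma>: "0 \<le> \<sigma>" "\<sigma> \<le> b / 2" using s by (auto simp: \<sigma>_def)
  \<comment> \<open>The source lasts until \<open>T0\<close>; phases differ from times by at most
    \<open>R * \<sigma>\<close>, once on the support of \<open>F\<close> and once on the sphere; the
    last \<open>R\<close> is the flank of the window. With \<open>\<sigma> \<le> b / 2\<close> this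
    time fits below \<open>T\<close>.\<close>
  define T1 where "T1 = T0 + 2 * R * \<sigma> + R"
  have T1b: "T1 \<le> (T0 + 2 * R) * b"
  proof -
    have "R * (2 * \<sigma>) \<le> R * b" using R \<sigma> by (intro mult_left_mono) auto
    moreover have "T0 * 1 \<le> T0 * b" "R * 1 \<le> R * b" using T0 R b by (intro mult_left_mono; simp)+
    ultimately show ?thesis by (simp add: T1_def algebra_simps)
  qed
  have T1T: "T1 \<le> T"
  proof -
    have "R * (2 * \<sigma>) \<le> R * b" using R \<sigma> by (intro mult_left_mono) auto
    moreover have bb: "1 \<le> b\<^sup>2" "b \<le> b\<^sup>2" using b by (simp_all add: power2_eq_square mult_le_cancel_left1 less_1_mult less_imp_le)
    have "R * 1 \<le> R * b\<^sup>2" "R * b \<le> R * b\<^sup>2" using R bb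
      by (intro mult_left_mono; simp)+
    ultimately show ?thesis using T by (simp add: T1_def algebra_simps)
  qed
  have T10: "T1 \<ge> 0" using T0 R \<sigma> by (simp add: T1_def)
  define w where "w = window R (R * \<sigma>) (T0 + R * \<sigma>)"
  define w' where "w' = window' R (R * \<sigma>) (T0 + R * \<sigma>)"
  define \<psi> where "\<psi> = (\<lambda>u. w u * cos (\<omega> * u + \<theta>))"
  define \<psi>1 where "\<psi>1 = (\<lambda>u. w' u * cos (\<omega> * u + \<theta>) - \<omega> * (w u * sin (\<omega> * u + \<theta>)))"
  have "smooth_expr \<psi>" unfolding \<psi>_def w_def
    by (intro smooth_expr.mult smooth_expr_window smooth_expr.cos smooth_expr.add smooth_expr.const smooth_expr_ident)
  have d\<psi>: "(\<psi> has_real_derivative \<psi>1 u) (at u)" for u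
    unfolding \<psi>_def \<psi>1_def
    by (rule DERIV_cong[OF DERIV_mult[of w "w' u" u UNIV "\<lambda>u. cos (\<omega> * u + \<theta>)" "- (\<omega> * sin (\<omega> * u + \<theta>))"]])
       (auto intro!: derivative_eq_intros window_deriv R simp: w_def w'_def)
  obtain g where g: "smooth_expr g" "\<And>u. (\<psi> has_real_derivative g u) (at u)"
    by (rule smooth_expr_real_deriv[OF \<open>smooth_expr \<psi>\<close>], rule that)
  \<comment> \<open>Smoothness of \<open>\<psi>1\<close> comes for free: it coincides with the
    derivative of a smooth expression.\<close>
  have "g = \<psi>1" using DERIV_unique[OF g(2) d\<psi>] by auto
  then have "smooth_expr \<psi>1" using g(1) by simp
  obtain \<psi>2 where d\<psi>1: "\<And>u. (\<psi>1 has_real_derivative \<psi>2 u) (at u)"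
    by (rule smooth_expr_real_deriv[OF \<open>smooth_expr \<psi>1\<close>], rule that)
  let ?U = "T0 + R * \<sigma> + R" and ?K = "B / R + \<bar>\<omega>\<bar>"
  have w0: "w u = 0" "w' u = 0" if "u \<ge> ?U \<or> u \<le> - (R * \<sigma>) - R" for u
    using that window_props(2,3)[OF R] by (auto simp: w_def w'_def)
  have late: "\<psi> u = 0" "\<psi>1 u = 0" if "u > ?U" for u using w0[of u] that by (auto simp: \<psi>_def \<psi>1_def)
  have out: "\<psi> u = 0" "\<psi>1 u = 0" if "\<bar>u\<bar> > ?U" for u
    using w0[of u] that T0 by (auto simp: \<psi>_def \<psi>1_def abs_if split: if_splits)
  have w1: "0 \<le> w u" "w u \<le> 1" for u using window_props(4,5)[OF R] by (auto simp: w_def)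
  have b\<psi>: "\<bar>\<psi> u\<bar> \<le> 1" for u
    using w1[of u] by (simp add: \<psi>_def abs_mult mult_le_one)
  have b\<psi>1: "\<bar>\<psi>1 u\<bar> \<le> ?K" for u
  proof -
    have "\<bar>w' u * cos (\<omega> * u + \<theta>)\<bar> \<le> B / R * 1"
      unfolding abs_mult w'_def using window'_bound[OF R B, of "R * \<sigma>" "T0 + R * \<sigma>" u]
      by (intro mult_mono) auto
    moreover have "\<bar>\<omega> * (w u * sin (\<omega> * u + \<theta>))\<bar> \<le> \<bar>\<omega>\<bar> * (1 * 1)"
      unfolding abs_mult using w1[of u] by (intro mult_left_mono mult_mono) auto
    ultimately show ?thesis unfolding \<psi>1_def by linarith
  qed
  obtain r \<tau> where r: "0 \<le> r" "r < R" "\<And>p. F p \<noteq> 0 \<Longrightarrow> norm (fst p) \<le> r \<and> \<tau> \<le> snd p \<and> snd p < T0" and "\<tau> > 0"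
    by (rule compact_support_margins[OF R T0 supp], rule that)
  let ?g = "\<lambda>p. (norm (cross3 (curlx E p) (fst p)))\<^sup>2 + (norm (cross3 (E p) (fst p)))\<^sup>2"
  have C1E: "C1x E" using E by (auto simp: maxwell_sol_def C1x_def)
  have cg: "continuous_on UNIV ?g"
    using C1E continuous_curlx[OF C1E] unfolding C1x_def
    by (intro continuous_intros continuous_on_cross) auto
  have n0: "n \<ge> 0" by (simp add: n)
  have rR: "r\<^sup>2 < R\<^sup>2" using r(1,2) by (intro power_strict_mono) auto
  define P where "P = R * \<epsilon>\<^sup>2"
  define Q where "Q = (1 + n * ?K\<^sup>2) * (2 * pi\<^sup>2 * R * T1)"
  have T1p: "T1 > 0" using T0 R \<sigma> by (simp add: T1_def add_pos_nonneg add_nonneg_pos)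
  have P: "P > 0" using R \<epsilon> by (simp add: P_def)
  have Q: "Q > 0" using R T1p n0 unfolding Q_def by (intro mult_pos_pos add_pos_nonneg) auto
  \<comment> \<open>The minimizer of \<open>\<mu> / 2 * P + Q / (2 * \<mu>)\<close>, whose minimum
    is \<open>sqrt (P * Q)\<close>.\<close>
  define \<mu> where "\<mu> = sqrt (Q / P)"
  have \<mu>: "\<mu> > 0" using P Q by (simp add: \<mu>_def)
  have main: "\<bar>?X\<bar> \<le> \<mu> / 2 * (P + e) + (1 + n * ?K\<^sup>2) / (2 * \<mu>) * (2 * pi\<^sup>2 * R * T1 + e)" if e: "e > 0" for e
  proof -
    obtain \<delta>1 where \<delta>1: "\<delta>1 > 0" "\<And>\<delta>. 0 < \<delta> \<Longrightarrow> \<delta> < \<delta>1 \<Longrightarrow>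
      shell_integral R \<delta> T1 ?g \<le> integral (sphere_box T1) (\<lambda>(t, \<theta>, \<phi>). R * ?g (R *\<^sub>R unit_sphere \<theta> \<phi>, t) * sin \<theta>) + e"
      by (rule shell_integral_limit[OF cg _ R e, of T1], simp, rule that)
    obtain \<delta>2 where \<delta>2: "\<delta>2 > 0" "\<And>\<delta>. 0 < \<delta> \<Longrightarrow> \<delta> < \<delta>2 \<Longrightarrow>
      shell_integral R \<delta> T1 (\<lambda>_. 1) \<le> integral (sphere_box T1) (\<lambda>(t, \<theta>, \<phi>). R * 1 * sin \<theta>) + e"
      by (rule shell_integral_limit[OF continuous_on_const[of UNIV "1::real"] _ R e, of T1], simp, rule that)
    \<comment> \<open>The first two entries meet the two limit statements; the third makes the
      cutoff equal to 1 up to radius \<open>r\<close>, hence on the support of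
      \<open>F\<close>.\<close>
    define \<delta> where "\<delta> = min (min (\<delta>1 / 2) (\<delta>2 / 2)) (R\<^sup>2 - r\<^sup>2)"
    have \<delta>: "\<delta> > 0" "\<delta> < \<delta>1" "\<delta> < \<delta>2" "\<delta> \<le> R\<^sup>2 - r\<^sup>2" using \<delta>1(1) \<delta>2(1) rR by (auto simp: \<delta>_def)
    have same: "F p \<bullet> ((step (radial_arg R \<delta> p) * \<psi> (phase s p)) *\<^sub>R d) = cos (\<omega> * phase s p + \<theta>) * (F p \<bullet> d)" for p
    proof (cases "F p = 0")
      case False
      then have fr: "norm (fst p) \<le> r" "0 \<le> snd p" "snd p \<le> T0" using r(3)[of p] \<open>\<tau> > 0\<close> by auto
      have "(norm (fst p))\<^sup>2 \<le> r\<^sup>2" using fr(1) by (intro power_mono) auto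
      then have "1 \<le> radial_arg R \<delta> p"
        using \<delta>(1,4) by (simp add: radial_arg_def power2_norm_eq_inner pos_le_divide_eq)
      moreover have "\<bar>s \<bullet> fst p\<bar> \<le> R * \<sigma>"
      proof -
        have "\<bar>s \<bullet> fst p\<bar> \<le> norm s * norm (fst p)" by (rule Cauchy_Schwarz_ineq2)
        also have "\<dots> \<le> \<sigma> * R" unfolding \<sigma>_def using fr(1) r(2) by (intro mult_left_mono) auto
        finally show ?thesis by (simp add: mult.commute)
      qed
      then have "w (phase s p) = 1" unfolding w_def using fr
        by (intro window_props(1)[OF R]) (auto simp: phase_def)
      ultimately show ?thesis by (simp add: step_1 \<psi>_def)
    qed simp
    have Xeq: "?X = (\<integral>p. F p \<bullet> ((step (radial_arg R \<delta> p) * \<psi> (phase s p)) *\<^sub>R d) \<partial>lborel)"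
      by (rule Bochner_Integration.integral_cong[OF refl same[symmetric]])
    have sm: "smooth_expr (\<lambda>p. \<psi> (f p))" "smooth_expr (\<lambda>p. \<psi>1 (f p))" if "smooth_expr f" for f :: "pt \<Rightarrow> real"
      by (rule smooth_expr_compose[OF \<open>smooth_expr \<psi>\<close> that], rule smooth_expr_compose[OF \<open>smooth_expr \<psi>1\<close> that])
    have "?U + norm s * R \<le> T1" by (simp add: T1_def \<sigma>_def algebra_simps)
    note W = wave_estimate_shell[OF E n ds nd \<delta>(1) R \<mu> d\<psi> d\<psi>1 sm out b\<psi> b\<psi>1 late this]
    have S1: "shell_integral R \<delta> T1 ?g \<le> P + e"
    proof -
      have "integral (sphere_box T1) (\<lambda>(t, \<theta>, \<phi>). R * ?g (R *\<^sub>R unit_sphere \<theta> \<phi>, t) * sin \<theta>) \<le> R * bdry_int R E T"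
        using bdry_integral_le[OF C1E R T1T] by (simp only: fst_conv)
      moreover have "R * bdry_int R E T \<le> P" using bdry R by (simp add: P_def)
      ultimately show ?thesis using \<delta>1(2)[OF \<delta>(1,2)] by linarith
    qed
    have S2: "shell_integral R \<delta> T1 (\<lambda>_. 1) \<le> 2 * pi\<^sup>2 * R * T1 + e"
      using \<delta>2(2)[OF \<delta>(1,3)] sphere_area_le[OF R T10] by linarith
    have "0 \<le> \<mu> / 2" "0 \<le> (1 + n * ?K\<^sup>2) / (2 * \<mu>)" using \<mu> n0 by auto
    note Z = add_mono[OF mult_left_mono[OF S1 this(1)] mult_left_mono[OF S2 this(2)]]
    show ?thesis unfolding Xeq by (rule order_trans[OF W Z])
  qed
  have X1: "\<bar>?X\<bar> \<le> \<mu> / 2 * P + Q / (2 * \<mu>)"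
  proof (rule field_le_epsilon)
    fix e :: real assume e: "e > 0"
    let ?c = "\<mu> / 2 + (1 + n * ?K\<^sup>2) / (2 * \<mu>)"
    have c: "?c > 0" using \<mu> n0 by (intro add_pos_nonneg) auto
    have "\<bar>?X\<bar> \<le> \<mu> / 2 * (P + e / ?c) + (1 + n * ?K\<^sup>2) / (2 * \<mu>) * (2 * pi\<^sup>2 * R * T1 + e / ?c)"
      by (rule main) (use e c in simp)
    also have "\<dots> = \<mu> / 2 * P + Q / (2 * \<mu>) + ?c * (e / ?c)"
    proof -
      have gen: "m * (P + x) + k * (Y + x) = m * P + k * Y + (m + k) * x" for m k x Y :: real
        by (simp add: algebra_simps)
      have "(1 + n * ?K\<^sup>2) / (2 * \<mu>) * (2 * pi\<^sup>2 * R * T1) = Q / (2 * \<mu>)"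
        unfolding Q_def by (rule times_divide_eq_left)
      then show ?thesis by (simp only: gen)
    qed
    also have "?c * (e / ?c) = e" using c by simp
    finally show "\<bar>?X\<bar> \<le> \<mu> / 2 * P + Q / (2 * \<mu>) + e" .
  qed
  have X2: "\<mu> / 2 * P + Q / (2 * \<mu>) = sqrt (P * Q)"
  proof -
    define p where "p = sqrt P"
    define q where "q = sqrt Q"
    have pq: "p > 0" "q > 0" "P = p * p" "Q = q * q" using P Q by (auto simp: p_def q_def)
    have m: "\<mu> = q / p" by (simp add: \<mu>_def real_sqrt_divide p_def q_def)
    have "\<mu> / 2 * P + Q / (2 * \<mu>) = p * q" using pq(1,2) unfolding m pq(3,4) by (simp add: field_simps)
    then show ?thesis by (simp add: real_sqrt_mult p_def q_def)
  qed
  have X3: "sqrt (P * Q) \<le> sqrt (\<epsilon>\<^sup>2 * (2 * pi\<^sup>2 * R\<^sup>2 * ((T0 + 2 * R) * b) * (1 + n * ?K\<^sup>2)))"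
  proof (rule real_sqrt_le_mono)
    have "P * Q = \<epsilon>\<^sup>2 * (2 * pi\<^sup>2 * R\<^sup>2 * (1 + n * ?K\<^sup>2)) * T1"
      by (simp add: P_def Q_def power2_eq_square mult_ac)
    also have "\<dots> \<le> \<epsilon>\<^sup>2 * (2 * pi\<^sup>2 * R\<^sup>2 * (1 + n * ?K\<^sup>2)) * ((T0 + 2 * R) * b)"
      using n0 by (intro mult_left_mono T1b) auto
    finally show "P * Q \<le> \<epsilon>\<^sup>2 * (2 * pi\<^sup>2 * R\<^sup>2 * ((T0 + 2 * R) * b) * (1 + n * ?K\<^sup>2))"
      by (simp add: mult_ac)
  qed
  have X4: "sqrt (\<epsilon>\<^sup>2 * (2 * pi\<^sup>2 * R\<^sup>2 * ((T0 + 2 * R) * b) * (1 + n * ?K\<^sup>2)))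
      = \<epsilon> * sqrt (2 * pi\<^sup>2 * R\<^sup>2 * ((T0 + 2 * R) * b) * (1 + n * ?K\<^sup>2))"
    using \<epsilon> by (simp only: real_sqrt_mult[of "\<epsilon>\<^sup>2"] real_sqrt_abs abs_of_pos)
  show ?thesis by (rule order_trans[OF X1[unfolded X2] X3[unfolded X4]])
qed

section \<open>The divergence condition on the Fourier side\<close>

lemma div_free_smooth:
  fixes g :: "pt \<Rightarrow> real"
  assumes R: "R > 0" and T0: "T0 > 0" and df: "div_free F"
    and supp: "\<And>p. F p \<noteq> 0 \<Longrightarrow> p \<in> ball 0 R \<times> {0<..<T0}"
    and g: "smooth_expr g" and Dg: "\<And>p. (g has_derivative D p) (at p)"
  shows "(\<Sum>j\<in>UNIV. \<integral>p. D p (axis j 1, 0) * F p $ j \<partial>lborel) = 0"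
proof -
  \<comment> \<open>Plane waves have no compact support, so they are multiplied by a cutoff that is
    1 on the cylinder containing \<open>F\<close>. The width \<open>3 * R\<^sup>2\<close> is
    \<open>(2 * R)\<^sup>2 - R\<^sup>2\<close>, which puts the plateau exactly on the ball of radius
    \<open>R\<close>.\<close>
  define cut where "cut = (\<lambda>p::pt. step (radial_arg (2 * R) (3 * R\<^sup>2) p) * window T0 0 T0 (phase 0 p))"
  have sc: "smooth_expr cut" unfolding cut_def
    by (intro smooth_expr.mult smooth_expr_step smooth_expr_radial_arg smooth_expr_compose[OF smooth_expr_window] smooth_expr_phase)
  have c1: "cut p = 1" if "p \<in> ball 0 R \<times> {0<..<T0}" for p
  proof -
    have "norm (fst p) < R" using that by (auto simp: mem_Times_iff)
    then have "(norm (fst p))\<^sup>2 \<le> R\<^sup>2" by (intro power_mono) auto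
    then have "1 \<le> radial_arg (2 * R) (3 * R\<^sup>2) p"
      using R by (simp add: radial_arg_def power2_norm_eq_inner pos_le_divide_eq power_mult_distrib)
    moreover have "window T0 0 T0 (phase 0 p) = 1"
      using that by (intro window_props(1)[OF T0]) (auto simp: phase_def mem_Times_iff)
    ultimately show ?thesis by (simp add: cut_def step_1)
  qed
  have c0: "cut p = 0" if "p \<notin> cball 0 (2 * R) \<times> {- (2 * T0 + norm (0::real^3) * (2 * R))..2 * T0 + norm (0::real^3) * (2 * R)}" for p
    unfolding cut_def
  proof (rule cutoff_wave_support(1)[OF _ _ _ that])
    show "window T0 0 T0 u = 0" if "2 * T0 < \<bar>u\<bar>" for u
      using that T0 by (intro window_props(2)[OF T0]) (auto simp: abs_if split: if_splits)
  qed (use R in auto)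
  have test: "test_fun (\<lambda>p. cut p * g p)"
  proof (rule test_fun_smooth_expr)
    show "smooth_expr (\<lambda>p. cut p * g p)" by (intro smooth_expr.mult sc g)
    show "bounded {p. cut p * g p \<noteq> 0}"
      by (rule bounded_subset[of "cball 0 (2 * R) \<times> {- (2 * T0 + norm (0::real^3) * (2 * R))..2 * T0 + norm (0::real^3) * (2 * R)}"])
         (use c0 in \<open>auto intro!: bounded_Times\<close>)
  qed
  have sd: "sderiv j (\<lambda>p. cut p * g p) p = D p (axis j 1, 0)" if p: "p \<in> ball 0 R \<times> {0<..<T0}" for j p
  proof -
    have "((\<lambda>y. (y, snd p)) has_derivative (\<lambda>h. (h, 0))) (at (fst p))"
      by (auto intro!: derivative_eq_intros)
    moreover have "(g has_derivative D p) (at (fst p, snd p))" using Dg[of p] by simp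
    ultimately have "((\<lambda>y. g (y, snd p)) has_derivative (\<lambda>h. D p (h, 0))) (at (fst p))"
      by (rule has_derivative_compose)
    then have "((\<lambda>y. cut (y, snd p) * g (y, snd p)) has_derivative (\<lambda>h. D p (h, 0))) (at (fst p))"
    proof (rule has_derivative_transform_within_open[where s = "ball 0 R"])
      show "g (y, snd p) = cut (y, snd p) * g (y, snd p)" if "y \<in> ball 0 R" for y
        using c1[of "(y, snd p)"] that p by (auto simp: mem_Times_iff)
    qed (use p in \<open>auto simp: mem_Times_iff\<close>)
    then have "frechet_derivative (\<lambda>y. cut (y, snd p) * g (y, snd p)) (at (fst p)) = (\<lambda>h. D p (h, 0))"
      by (rule frechet_derivative_at[symmetric])
    then show ?thesis by (simp add: sderiv_def)
  qed
  have "(\<Sum>j\<in>UNIV. \<integral>p. sderiv j (\<lambda>p. cut p * g p) p * F p $ j \<partial>lborel) = 0"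
    using df test unfolding div_free_def by blast
  moreover have "sderiv j (\<lambda>p. cut p * g p) p * F p $ j = D p (axis j 1, 0) * F p $ j" for j p
    using sd[of p j] supp[of p] by (cases "F p = 0") simp_all
  ultimately show ?thesis by simp
qed

lemma integrable_cos_scaleR:
  fixes F :: "pt \<Rightarrow> real^3"
  assumes "integrable lborel F"
  shows "integrable lborel (\<lambda>p. cos (\<zeta> \<bullet> p + \<theta>) *\<^sub>R F p)"
proof (rule Bochner_Integration.integrable_bound[OF assms])
  have "continuous_on UNIV (\<lambda>p. cos (\<zeta> \<bullet> p + \<theta>))" by (intro continuous_intros)
  then have "(\<lambda>p. cos (\<zeta> \<bullet> p + \<theta>)) \<in> borel_measurable lborel" by (simp add: borel_measurable_continuous_onI)
  then show "(\<lambda>p. cos (\<zeta> \<bullet> p + \<theta>) *\<^sub>R F p) \<in> borel_measurable lborel"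
    using borel_measurable_integrable[OF assms] by (rule borel_measurable_scaleR)
  show "AE p in lborel. norm (cos (\<zeta> \<bullet> p + \<theta>) *\<^sub>R F p) \<le> norm (F p)"
    by (rule AE_I2) (simp add: mult_left_le_one_le)
qed

text \<open>Testing with a sine of the plane phase gives orthogonality to the spatial frequency. At
  spatial frequency 0 that is empty, but testing with a coordinate times a cosine then isolates each
  component in turn, so the whole vector vanishes.\<close>

lemma fourier_transversal:
  assumes R: "R > 0" and T0: "T0 > 0" and df: "div_free F" and F: "integrable lborel F"
    and supp: "\<And>p. F p \<noteq> 0 \<Longrightarrow> p \<in> ball 0 R \<times> {0<..<T0}"
  shows "(\<integral>p. cos (\<zeta> \<bullet> p + \<theta>) *\<^sub>R F p \<partial>lborel) \<bullet> fst \<zeta> = 0"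
    and "fst \<zeta> = 0 \<Longrightarrow> (\<integral>p. cos (\<zeta> \<bullet> p + \<theta>) *\<^sub>R F p \<partial>lborel) = 0"
proof -
  let ?X = "\<integral>p. cos (\<zeta> \<bullet> p + \<theta>) *\<^sub>R F p \<partial>lborel"
  have I: "integrable lborel (\<lambda>p. cos (\<zeta> \<bullet> p + \<theta>) *\<^sub>R F p)" by (rule integrable_cos_scaleR[OF F])
  have Xj: "?X $ j = (\<integral>p. cos (\<zeta> \<bullet> p + \<theta>) * F p $ j \<partial>lborel)" for j
    using integral_bounded_linear[OF bounded_linear_vec_nth[of j] I] by simp
  have sl: "smooth_expr (\<lambda>p. \<zeta> \<bullet> p + \<theta>)"
    using smooth_expr.add[OF smooth_expr.inner[of \<zeta>] smooth_expr.const[of \<theta>]] by (simp add: inner_commute)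
  have "(\<Sum>j\<in>UNIV. \<integral>p. (cos (\<zeta> \<bullet> p + \<theta>) * (\<zeta> \<bullet> (axis j 1, 0))) * F p $ j \<partial>lborel) = 0"
  proof (rule div_free_smooth[OF R T0 df supp smooth_expr.sin[OF sl]])
    show "((\<lambda>p. sin (\<zeta> \<bullet> p + \<theta>)) has_derivative (\<lambda>h. cos (\<zeta> \<bullet> p + \<theta>) * (\<zeta> \<bullet> h))) (at p)" for p
      by (auto intro!: derivative_eq_intros simp: mult.commute)
  qed
  moreover have "(\<integral>p. (cos (\<zeta> \<bullet> p + \<theta>) * (\<zeta> \<bullet> (axis j 1, 0))) * F p $ j \<partial>lborel) = fst \<zeta> $ j * ?X $ j" for j
  proof -
    have "\<zeta> \<bullet> (axis j 1, 0) = fst \<zeta> $ j" by (cases \<zeta>) (simp add: inner_axis)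
    then have "(\<integral>p. (cos (\<zeta> \<bullet> p + \<theta>) * (\<zeta> \<bullet> (axis j 1, 0))) * F p $ j \<partial>lborel)
        = (\<integral>p. fst \<zeta> $ j * (cos (\<zeta> \<bullet> p + \<theta>) * F p $ j) \<partial>lborel)"
      by (simp add: mult_ac)
    then show ?thesis unfolding Xj by simp
  qed
  ultimately show "?X \<bullet> fst \<zeta> = 0" by (simp add: inner_vec_def mult.commute)
  assume z: "fst \<zeta> = 0"
  have "?X $ k = 0" for k
  proof -
    have "(\<Sum>j\<in>UNIV. \<integral>p. ((p \<bullet> (axis k 1, 0)) * (- sin (\<zeta> \<bullet> p + \<theta>) * (\<zeta> \<bullet> (axis j 1, 0)))
        + ((axis j 1, 0) \<bullet> (axis k 1 :: real^3, 0 :: real)) * cos (\<zeta> \<bullet> p + \<theta>)) * F p $ j \<partial>lborel) = 0"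
    proof (rule div_free_smooth[OF R T0 df supp smooth_expr.mult[OF smooth_expr.inner[of "(axis k 1, 0)"] smooth_expr.cos[OF sl]]])
      show "((\<lambda>p. p \<bullet> (axis k 1, 0) * cos (\<zeta> \<bullet> p + \<theta>)) has_derivative
        (\<lambda>h. (p \<bullet> (axis k 1, 0)) * (- sin (\<zeta> \<bullet> p + \<theta>) * (\<zeta> \<bullet> h)) + (h \<bullet> (axis k 1, 0)) * cos (\<zeta> \<bullet> p + \<theta>))) (at p)" for p
        by (rule has_derivative_mult) (auto intro!: derivative_eq_intros simp: mult.commute)
    qed
    moreover have "\<zeta> \<bullet> (axis j 1, 0) = 0" for j using z by (cases \<zeta>) simp
    moreover have "(axis j 1, 0) \<bullet> (axis k 1 :: real^3, 0 :: real) = (if j = k then 1 else 0)" for j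
      by (simp add: inner_axis_axis)
    ultimately have "(\<Sum>j\<in>UNIV. \<integral>p. ((if j = k then 1 else 0) * cos (\<zeta> \<bullet> p + \<theta>)) * F p $ j \<partial>lborel) = 0"
      by simp
    also have "(\<Sum>j\<in>UNIV. \<integral>p. ((if j = k then 1 else 0) * cos (\<zeta> \<bullet> p + \<theta>)) * F p $ j \<partial>lborel)
        = (\<Sum>j\<in>UNIV. if j = k then ?X $ k else 0)"
      by (intro sum.cong refl) (simp add: Xj)
    finally show ?thesis by simp
  qed
  then show "?X = 0" by (simp add: vec_eq_iff)
qed

text \<open>The slowness \<open>- \<xi> / \<omega>\<close> turns the plane phase into
  \<open>\<omega> * phase s p\<close>, and the cone condition puts \<open>n = s \<bullet> s\<close>
  at most at \<open>b\<^sup>2 / 4\<close>. The frequency \<open>\<omega>\<close> disappears from the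
  bound because \<open>n * \<omega>\<^sup>2\<close> is the squared spatial frequency.\<close>

lemma fourier_bound:
  assumes R: "R > 0" and T0: "T0 > 0" and b: "b > 1" and df: "div_free F" and F: "integrable lborel F"
    and supp: "closure {p. F p \<noteq> 0} \<subseteq> ball 0 R \<times> {0<..<T0}"
    and E: "\<And>n. n \<in> {0<..<b\<^sup>2} \<Longrightarrow> maxwell_sol n F (E n)"
    and T: "2 * R * b\<^sup>2 + T0 \<le> T" and bdry: "\<And>n. n \<in> {0<..<b\<^sup>2} \<Longrightarrow> bdry_int R (E n) T \<le> \<epsilon>\<^sup>2" and \<epsilon>: "\<epsilon> > 0"
    and B: "\<And>x. bump x \<le> B" and \<zeta>: "norm (fst \<zeta>) \<le> b / 2 * \<bar>snd \<zeta>\<bar>"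
  shows "norm (\<integral>p. cos (\<zeta> \<bullet> p + \<theta>) *\<^sub>R F p \<partial>lborel)
    \<le> \<epsilon> * sqrt (2 * pi\<^sup>2 * R\<^sup>2 * (T0 + 2 * R) * (2 + 2 * (B / R)\<^sup>2) * (b * (b\<^sup>2 + (norm (fst \<zeta>))\<^sup>2)))" (is "norm ?X \<le> ?rhs")
proof -
  have supp': "p \<in> ball 0 R \<times> {0<..<T0}" if "F p \<noteq> 0" for p
    by (rule subsetD[OF supp], rule subsetD[OF closure_subset]) (simp add: that)
  note tr = fourier_transversal[OF R T0 df F supp', where \<zeta> = \<zeta> and \<theta> = \<theta>]
  have rhs0: "?rhs \<ge> 0" using \<epsilon> R T0 b
    by (intro mult_nonneg_nonneg real_sqrt_ge_zero) auto
  show ?thesis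
  proof (cases "?X = 0")
    case True
    then show ?thesis using rhs0 by simp
  next
    case False
    then have f0: "fst \<zeta> \<noteq> 0" using tr(2) by blast
    define \<omega> where "\<omega> = snd \<zeta>"
    have \<omega>: "\<omega> \<noteq> 0" using \<zeta> f0 by (auto simp: \<omega>_def)
    define s where "s = - (1 / \<omega>) *\<^sub>R fst \<zeta>"
    define n where "n = s \<bullet> s"
    have ns: "norm s = norm (fst \<zeta>) / \<bar>\<omega>\<bar>" by (simp add: s_def)
    then have sb: "norm s \<le> b / 2" using \<zeta> \<omega> by (simp add: \<omega>_def pos_divide_le_eq)
    have n2: "n = (norm s)\<^sup>2" by (simp add: n_def power2_norm_eq_inner)
    have npos: "0 < n" using f0 \<omega> by (simp add: n2 ns)
    have nle: "n \<le> (b / 2)\<^sup>2" unfolding n2 using sb by (intro power_mono) auto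
    have "(b / 2)\<^sup>2 < b\<^sup>2" using b by (intro power_strict_mono) auto
    then have nin: "n \<in> {0<..<b\<^sup>2}" using npos nle by simp
    have n\<omega>: "n * \<omega>\<^sup>2 = (norm (fst \<zeta>))\<^sup>2" using \<omega> by (simp add: n2 ns power_divide)
    have ph: "\<zeta> \<bullet> p = \<omega> * phase s p" for p
      using \<omega> by (cases \<zeta>; cases p) (simp add: phase_def s_def \<omega>_def algebra_simps)
    \<comment> \<open>The direction of the transform itself: a single wave then recovers the full
      norm, and transversality makes \<open>d\<close> an admissible polarization.\<close>
    define d where "d = (1 / norm ?X) *\<^sub>R ?X"
    have nd: "norm d = 1" using False by (simp add: d_def)
    have ds: "d \<bullet> s = 0" using tr(1) by (simp add: d_def s_def)
    have "(\<integral>p. cos (\<zeta> \<bullet> p + \<theta>) * (F p \<bullet> d) \<partial>lborel) = ?X \<bullet> d"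
      using integral_bounded_linear[OF bounded_linear_inner_left[of d] integrable_cos_scaleR[OF F, of \<zeta> \<theta>]] by simp
    also have "\<dots> = norm ?X" using False by (simp add: d_def power2_norm_eq_inner[symmetric] power2_eq_square)
    finally have "norm ?X = \<bar>\<integral>p. cos (\<omega> * phase s p + \<theta>) * (F p \<bullet> d) \<partial>lborel\<bar>" by (simp add: ph)
    also have "\<dots> \<le> \<epsilon> * sqrt (2 * pi\<^sup>2 * R\<^sup>2 * ((T0 + 2 * R) * b) * (1 + n * (B / R + \<bar>\<omega>\<bar>)\<^sup>2))"
      by (rule wave_bound[OF R T0 b supp E[OF nin] n_def sb T bdry[OF nin] \<epsilon> ds nd B])
    also have "\<dots> \<le> ?rhs"
    proof (intro mult_left_mono real_sqrt_le_mono)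
      have "(B / R + \<bar>\<omega>\<bar>)\<^sup>2 \<le> 2 * (B / R)\<^sup>2 + 2 * \<omega>\<^sup>2"
        using sum_squares_bound[of "B / R" "\<bar>\<omega>\<bar>"] by (simp add: power2_sum)
      then have "n * (B / R + \<bar>\<omega>\<bar>)\<^sup>2 \<le> n * (2 * (B / R)\<^sup>2 + 2 * \<omega>\<^sup>2)" using npos by (intro mult_left_mono) auto
      also have "\<dots> = n * (2 * (B / R)\<^sup>2) + 2 * (norm (fst \<zeta>))\<^sup>2" by (simp add: distrib_left n\<omega>[symmetric])
      also have "n * (2 * (B / R)\<^sup>2) \<le> b\<^sup>2 * (2 * (B / R)\<^sup>2)" using nin by (intro mult_right_mono) auto
      finally have "1 + n * (B / R + \<bar>\<omega>\<bar>)\<^sup>2 \<le> 1 + (b\<^sup>2 * (2 * (B / R)\<^sup>2) + 2 * (norm (fst \<zeta>))\<^sup>2)" by simp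
      also have "\<dots> \<le> (2 + 2 * (B / R)\<^sup>2) * (b\<^sup>2 + (norm (fst \<zeta>))\<^sup>2)"
      proof -
        have "1 \<le> b\<^sup>2" using b by (simp add: one_le_power)
        have gen: "1 + (x * (2 * y) + 2 * z) \<le> (2 + 2 * y) * (x + z)" if "1 \<le> x" "0 \<le> y * z" for x y z :: real
          using that by (simp add: algebra_simps)
        show ?thesis by (rule gen) (use \<open>1 \<le> b\<^sup>2\<close> in simp_all)
      qed
      finally have le: "1 + n * (B / R + \<bar>\<omega>\<bar>)\<^sup>2 \<le> (2 + 2 * (B / R)\<^sup>2) * (b\<^sup>2 + (norm (fst \<zeta>))\<^sup>2)" .
      have "2 * pi\<^sup>2 * R\<^sup>2 * ((T0 + 2 * R) * b) * (1 + n * (B / R + \<bar>\<omega>\<bar>)\<^sup>2)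
         \<le> 2 * pi\<^sup>2 * R\<^sup>2 * ((T0 + 2 * R) * b) * ((2 + 2 * (B / R)\<^sup>2) * (b\<^sup>2 + (norm (fst \<zeta>))\<^sup>2))"
        using R T0 b by (intro mult_left_mono le) auto
      also have "\<dots> = 2 * pi\<^sup>2 * R\<^sup>2 * (T0 + 2 * R) * (2 + 2 * (B / R)\<^sup>2) * (b * (b\<^sup>2 + (norm (fst \<zeta>))\<^sup>2))"
        by (simp only: mult_ac)
      finally show "2 * pi\<^sup>2 * R\<^sup>2 * ((T0 + 2 * R) * b) * (1 + n * (B / R + \<bar>\<omega>\<bar>)\<^sup>2)
         \<le> 2 * pi\<^sup>2 * R\<^sup>2 * (T0 + 2 * R) * (2 + 2 * (B / R)\<^sup>2) * (b * (b\<^sup>2 + (norm (fst \<zeta>))\<^sup>2))" .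
    qed (use \<epsilon> in simp)
    finally show ?thesis .
  qed
qed

section \<open>Cosine series on a cube\<close>

definition cos_prod :: "real \<Rightarrow> ('a::euclidean_space \<Rightarrow> nat) \<Rightarrow> 'a \<Rightarrow> real" where
  "cos_prod h m x = (\<Prod>b\<in>Basis. cos (real (m b) * (pi / (2 * h)) * (x \<bullet> b + h)))"

text \<open>Up to sign and factor the derivative of \<open>cos_prod\<close> along \<open>j\<close>.
  Since 0 is no basis vector, \<open>j = 0\<close> gives back \<open>cos_prod\<close>, so both
  systems share one orthogonality computation.\<close>

definition sin_cos_prod :: "real \<Rightarrow> 'a::euclidean_space \<Rightarrow> ('a \<Rightarrow> nat) \<Rightarrow> 'a \<Rightarrow> real" where
  "sin_cos_prod h j m x =
     (\<Prod>b\<in>Basis. (if b = j then sin else cos) (real (m b) * (pi / (2 * h)) * (x \<bullet> b + h)))"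

text \<open>Multi-indices are taken from \<open>Basis \<rightarrow>\<^sub>E UNIV\<close>, so that
  two of them differ only if they differ on some basis vector; orthogonality depends on
  this.\<close>

definition cos_poly :: "real \<Rightarrow> ('a::euclidean_space \<Rightarrow> real) \<Rightarrow> bool" where
  "cos_poly h f \<longleftrightarrow> (\<exists>Z c. finite Z \<and> Z \<subseteq> Basis \<rightarrow>\<^sub>E UNIV \<and> (\<forall>x. f x = (\<Sum>m\<in>Z. c m * cos_prod h m x)))"

lemma cos_poly_cos_prod: "m \<in> Basis \<rightarrow>\<^sub>E UNIV \<Longrightarrow> cos_poly h (cos_prod h m)"
  unfolding cos_poly_def by (rule exI[of _ "{m}"], rule exI[of _ "\<lambda>_. 1"]) auto

lemma cos_poly_cmult: "cos_poly h f \<Longrightarrow> cos_poly h (\<lambda>x. c * f x)"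
proof -
  assume "cos_poly h f"
  then obtain Z d where "finite Z" "Z \<subseteq> Basis \<rightarrow>\<^sub>E UNIV" "\<forall>x. f x = (\<Sum>m\<in>Z. d m * cos_prod h m x)"
    unfolding cos_poly_def by blast
  then show ?thesis
    unfolding cos_poly_def
    by (intro exI[of _ Z] exI[of _ "\<lambda>m. c * d m"]) (auto simp: sum_distrib_left mult.assoc)
qed

lemma cos_poly_add:
  assumes "cos_poly h f" "cos_poly h g" shows "cos_poly h (\<lambda>x. f x + g x)"
proof -
  obtain Z c where Z: "finite Z" "Z \<subseteq> Basis \<rightarrow>\<^sub>E UNIV" "\<forall>x. f x = (\<Sum>m\<in>Z. c m * cos_prod h m x)"
    using assms(1) unfolding cos_poly_def by blast
  obtain W d where W: "finite W" "W \<subseteq> Basis \<rightarrow>\<^sub>E UNIV" "\<forall>x. g x = (\<Sum>m\<in>W. d m * cos_prod h m x)"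
    using assms(2) unfolding cos_poly_def by blast
  have "f x + g x = (\<Sum>m\<in>Z \<union> W. ((if m \<in> Z then c m else 0) + (if m \<in> W then d m else 0)) * cos_prod h m x)"
    for x
  proof -
    have "f x = (\<Sum>m\<in>Z \<union> W. (if m \<in> Z then c m else 0) * cos_prod h m x)"
      using Z W by (auto intro!: sum.mono_neutral_cong_left)
    moreover have "g x = (\<Sum>m\<in>Z \<union> W. (if m \<in> W then d m else 0) * cos_prod h m x)"
      using Z W by (auto intro!: sum.mono_neutral_cong_left)
    ultimately show ?thesis by (simp add: sum.distrib distrib_right)
  qed
  with Z W show ?thesis
    unfolding cos_poly_def
    by (intro exI[of _ "Z \<union> W"] exI[of _ "\<lambda>m. (if m \<in> Z then c m else 0) + (if m \<in> W then d m else 0)"]) auto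
qed

lemma cos_poly_0: "cos_poly h (\<lambda>x. 0)"
  unfolding cos_poly_def by (rule exI[of _ "{}"]) auto

lemma cos_poly_sum:
  assumes "finite I" "\<And>i. i \<in> I \<Longrightarrow> cos_poly h (f i)"
  shows "cos_poly h (\<lambda>x. \<Sum>i\<in>I. f i x)"
  using assms by (induction I rule: finite_induct) (auto intro: cos_poly_0 cos_poly_add)

lemma cos_poly_1: "cos_poly h (\<lambda>x. 1)"
proof -
  have "cos_poly h (cos_prod h (\<lambda>b\<in>Basis. 0) :: 'a \<Rightarrow> real)" by (rule cos_poly_cos_prod) auto
  moreover have "cos_prod h (\<lambda>b\<in>Basis. 0) = (\<lambda>x::'a. 1)" by (auto simp: cos_prod_def fun_eq_iff)
  ultimately show ?thesis by simp
qed

lemma cos_prod_upd: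
  assumes "b \<in> Basis"
  shows "cos_prod h (m(b := k)) x = cos (real k * (pi / (2 * h)) * (x \<bullet> b + h)) *
     (\<Prod>c\<in>Basis - {b}. cos (real (m c) * (pi / (2 * h)) * (x \<bullet> c + h)))"
  unfolding cos_prod_def by (subst prod.remove[OF finite_Basis assms]) auto

lemma cos_poly_mult_cos1:
  assumes b: "b \<in> Basis" and "cos_poly h f"
  shows "cos_poly h (\<lambda>x. f x * cos (pi / (2 * h) * (x \<bullet> b + h)))"
proof -
  let ?c = "\<lambda>x. cos (pi / (2 * h) * (x \<bullet> b + h))"
  obtain Z c where Z: "finite Z" "Z \<subseteq> Basis \<rightarrow>\<^sub>E UNIV" "\<forall>x. f x = (\<Sum>m\<in>Z. c m * cos_prod h m x)"
    using assms(2) unfolding cos_poly_def by blast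
  have one: "cos_poly h (\<lambda>x. cos_prod h m x * ?c x)" if m: "m \<in> Basis \<rightarrow>\<^sub>E UNIV" for m
  proof -
    have up: "m(b := k) \<in> Basis \<rightarrow>\<^sub>E UNIV" for k using m b by (auto simp: PiE_iff extensional_def)
    have m0: "cos_prod h m x = cos (real (m b) * (pi / (2 * h)) * (x \<bullet> b + h)) *
       (\<Prod>c\<in>Basis - {b}. cos (real (m c) * (pi / (2 * h)) * (x \<bullet> c + h)))" for x
      using cos_prod_upd[OF b, of h m "m b"] by simp
    show ?thesis
    proof (cases "m b")
      \<comment> \<open>Index 0 is separate: the product-to-sum formula would lower it to -1, while
        here the factor simply raises it to 1.\<close>
      case 0
      have "(\<lambda>x. cos_prod h m x * ?c x) = cos_prod h (m(b := 1))"
        by (rule ext) (simp add: m0 cos_prod_upd[OF b] 0)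
      then show ?thesis using cos_poly_cos_prod[OF up[of 1]] by simp
    next
      case (Suc k)
      have trig: "cos (real (Suc k) * (pi / (2 * h)) * u) * cos (pi / (2 * h) * u)
        = 1/2 * cos (real (Suc (Suc k)) * (pi / (2 * h)) * u) + 1/2 * cos (real k * (pi / (2 * h)) * u)" for u
      proof -
        have 1: "real (Suc (Suc k)) * (pi / (2 * h)) * u = real (Suc k) * (pi / (2 * h)) * u + pi / (2 * h) * u"
          "real k * (pi / (2 * h)) * u = real (Suc k) * (pi / (2 * h)) * u - pi / (2 * h) * u"
          by (simp_all add: algebra_simps add_divide_distrib)
        show ?thesis unfolding 1 by (simp add: cos_times_cos add.commute)
      qed
      have gen: "A * P * C = 1/2 * (D * P) + 1/2 * (E * P)" if "A * C = 1/2 * D + 1/2 * E" for A P C D E :: real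
      proof -
        have "A * P * C = (A * C) * P" by simp
        then show ?thesis unfolding that by (simp add: distrib_right)
      qed
      have "(\<lambda>x. cos_prod h m x * ?c x) =
        (\<lambda>x. 1/2 * cos_prod h (m(b := Suc (Suc k))) x + 1/2 * cos_prod h (m(b := k)) x)"
        unfolding m0 cos_prod_upd[OF b] Suc by (intro ext gen trig)
      then show ?thesis
        using cos_poly_add[OF cos_poly_cmult[OF cos_poly_cos_prod[OF up[of "Suc (Suc k)"]], where c = "1/2"]
          cos_poly_cmult[OF cos_poly_cos_prod[OF up[of k]], where c = "1/2"]] by simp
    qed
  qed
  have "(\<lambda>x. f x * ?c x) = (\<lambda>x. \<Sum>m\<in>Z. c m * (cos_prod h m x * ?c x))"
    using Z by (auto simp: sum_distrib_right mult.assoc)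
  moreover have "cos_poly h (\<lambda>x. \<Sum>m\<in>Z. c m * (cos_prod h m x * ?c x))"
    using Z by (intro cos_poly_sum cos_poly_cmult one) auto
  ultimately show ?thesis by simp
qed

definition cos_map :: "real \<Rightarrow> 'a::euclidean_space \<Rightarrow> 'a" where
  "cos_map h x = (\<Sum>b\<in>Basis. cos (pi / (2 * h) * (x \<bullet> b + h)) *\<^sub>R b)"

text \<open>The extra factor \<open>f\<close> lets a product of polynomials be handled by applying
  the two hypotheses in succession; only multiplication by a single cosine has to be
  understood.\<close>

lemma cos_poly_mult_polynomial:
  "real_polynomial_function q \<Longrightarrow> cos_poly h f \<Longrightarrow> cos_poly h (\<lambda>x. f x * q (cos_map h x))"
proof (induction arbitrary: f rule: real_polynomial_function.induct)
  case (linear L)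
  have "(\<lambda>x. f x * L (cos_map h x)) = (\<lambda>x. \<Sum>b\<in>Basis. L b * (f x * cos (pi / (2 * h) * (x \<bullet> b + h))))"
    using linear(1)
    by (auto simp: cos_map_def linear_sum[OF bounded_linear.linear] linear_cmul[OF bounded_linear.linear]
        sum_distrib_left algebra_simps)
  moreover have "cos_poly h (\<lambda>x. \<Sum>b\<in>Basis. L b * (f x * cos (pi / (2 * h) * (x \<bullet> b + h))))"
    by (intro cos_poly_sum cos_poly_cmult cos_poly_mult_cos1 linear(2) finite_Basis)
  ultimately show ?case by simp
next
  case (const c)
  then show ?case using cos_poly_cmult[of h f c] by (simp add: mult.commute)
next
  case (add p q)
  then show ?case using cos_poly_add[OF add(3)[OF add(5)] add(4)[OF add(5)]] by (simp add: distrib_left)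
next
  case (mult p q)
  then show ?case using mult(4)[OF mult(3)[OF mult(5)]] by (simp add: mult.assoc)
qed

definition cube :: "real \<Rightarrow> 'a::euclidean_space set" where
  "cube h = cbox (- h *\<^sub>R One) (h *\<^sub>R One)"

lemma mem_cube: "x \<in> cube h \<longleftrightarrow> (\<forall>b\<in>Basis. - h \<le> x \<bullet> b \<and> x \<bullet> b \<le> h)"
  by (auto simp: cube_def mem_box)

lemma compact_cube: "compact (cube h)"
  by (simp add: cube_def compact_cbox)

lemma cube_in_sets [measurable, simp]: "cube h \<in> sets borel"
  by (simp add: cube_def)

text \<open>On the cube \<open>cos_map\<close> is injective, with inverse given by
  \<open>arccos\<close>, so \<open>f\<close> becomes a continuous function on a compact image.
  Stone-Weierstrass applies there, and polynomials in \<open>cos_map\<close> are cosine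
  polynomials.\<close>

lemma cos_poly_dense:
  fixes f :: "'a::euclidean_space \<Rightarrow> real"
  assumes h: "h > 0" and f: "continuous_on (cube h) f" and e: "e > 0"
  obtains g where "cos_poly h g" "\<And>x. x \<in> cube h \<Longrightarrow> \<bar>f x - g x\<bar> < e"
proof -
  let ?Q = "cube h :: 'a set"
  let ?\<Psi> = "\<lambda>y::'a. \<Sum>b\<in>Basis. (2 * h / pi * arccos (y \<bullet> b) - h) *\<^sub>R b"
  have Qb: "- h \<le> x \<bullet> b" "x \<bullet> b \<le> h" if "x \<in> ?Q" "b \<in> Basis" for x b
    using that by (auto simp: mem_cube)
  have inv: "?\<Psi> (cos_map h x) = x" if "x \<in> ?Q" for x
  proof (rule euclidean_eqI)
    fix b :: 'a assume b: "b \<in> Basis"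
    have "arccos (cos (pi / (2 * h) * (x \<bullet> b + h))) = pi / (2 * h) * (x \<bullet> b + h)"
    proof (rule arccos_cos)
      show "0 \<le> pi / (2 * h) * (x \<bullet> b + h)" using Qb[OF that b] h by simp
      have "pi / (2 * h) * (x \<bullet> b + h) \<le> pi / (2 * h) * (h + h)"
        using Qb[OF that b] h by (intro mult_left_mono) auto
      then show "pi / (2 * h) * (x \<bullet> b + h) \<le> pi" using h by simp
    qed
    then show "?\<Psi> (cos_map h x) \<bullet> b = x \<bullet> b"
      using b h by (simp add: cos_map_def inner_sum_left inner_Basis if_distrib sum.delta cong: if_cong)
  qed
  have cc: "continuous_on S (cos_map h)" for S :: "'a set"
    unfolding cos_map_def by (intro continuous_intros)
  have comp: "compact (cos_map h ` ?Q)" by (intro compact_continuous_image cc compact_cube)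
  have "continuous_on (cos_map h ` ?Q) ?\<Psi>"
    by (rule continuous_on_inv[OF cc compact_cube]) (use inv in auto)
  then have "continuous_on (cos_map h ` ?Q) (f \<circ> ?\<Psi>)"
    by (rule continuous_on_compose) (rule continuous_on_subset[OF f], use inv in auto)
  then obtain q where q: "real_polynomial_function q" "\<And>y. y \<in> cos_map h ` ?Q \<Longrightarrow> \<bar>(f \<circ> ?\<Psi>) y - q y\<bar> < e"
    using Stone_Weierstrass_real_polynomial_function[OF comp _ e] by blast
  show ?thesis
  proof
    show "cos_poly h (\<lambda>x. q (cos_map h x))"
      using cos_poly_mult_polynomial[OF q(1) cos_poly_1] by simp
    show "\<bar>f x - q (cos_map h x)\<bar> < e" if "x \<in> ?Q" for x
      using q(2)[of "cos_map h x"] that inv[OF that] by simp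
  qed
qed

section \<open>Orthogonality, Bessel's inequality and completeness\<close>

lemma lborel_integral_prod_Basis:
  fixes f :: "'a::euclidean_space \<Rightarrow> real \<Rightarrow> real"
  assumes "\<And>b. b \<in> Basis \<Longrightarrow> integrable lborel (f b)"
  shows "(\<integral>x. (\<Prod>b\<in>Basis. f b (x \<bullet> b)) \<partial>lborel) = (\<Prod>b\<in>Basis. \<integral>t. f b t \<partial>lborel)"
proof -
  interpret product_sigma_finite "\<lambda>_::'a. lborel :: real measure" by standard
  have m: "f b \<in> borel_measurable borel" if "b \<in> Basis" for b
    using borel_measurable_integrable[OF assms[OF that]] by simp
  have [measurable]: "(\<lambda>x. \<Prod>b\<in>Basis. f b (x \<bullet> b)) \<in> borel_measurable borel"
    by (intro borel_measurable_prod) (use m in \<open>auto intro!: measurable_compose[OF _ m]\<close>)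
  have "(\<integral>x. (\<Prod>b\<in>Basis. f b (x \<bullet> b)) \<partial>lborel)
      = (\<integral>g. (\<Prod>b\<in>Basis. f b ((\<Sum>c\<in>Basis. g c *\<^sub>R c) \<bullet> b)) \<partial>(\<Pi>\<^sub>M b\<in>(Basis::'a set). lborel))"
    by (subst lborel_eq, subst integral_distr) simp_all
  also have "\<dots> = (\<integral>g. (\<Prod>b\<in>Basis. f b (g b)) \<partial>(\<Pi>\<^sub>M b\<in>(Basis::'a set). lborel))"
    by (intro Bochner_Integration.integral_cong refl prod.cong) simp
  also have "\<dots> = (\<Prod>b\<in>Basis. \<integral>t. f b t \<partial>lborel)"
    by (rule product_integral_prod) (use assms in auto)
  finally show ?thesis .
qed

lemma integral_cos_freq:
  fixes k :: int
  assumes "h > 0"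
  shows "(\<integral>t. cos (of_int k * (pi / (2 * h)) * (t + h)) * indicator {- h..h} t \<partial>lborel)
     = (if k = 0 then 2 * h else 0)"
proof (cases "k = 0")
  case True
  then show ?thesis using assms by simp
next
  case False
  define \<kappa> where "\<kappa> = of_int k * (pi / (2 * h))"
  have \<kappa>: "\<kappa> \<noteq> 0" using False assms by (simp add: \<kappa>_def)
  have "(\<integral>t. cos (\<kappa> * (t + h)) * indicator {- h..h} t \<partial>lborel)
     = sin (\<kappa> * (h + h)) / \<kappa> - sin (\<kappa> * (- h + h)) / \<kappa>"
  proof (rule integral_FTC_Icc_real)
    show "((\<lambda>t. sin (\<kappa> * (t + h)) / \<kappa>) has_real_derivative cos (\<kappa> * (x + h))) (at x)" for x
      using \<kappa> by (auto intro!: derivative_eq_intros)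
  qed (use assms in \<open>auto intro!: continuous_intros\<close>)
  also have "\<kappa> * (h + h) = of_int k * pi" using assms by (simp add: \<kappa>_def)
  finally show ?thesis using False by (simp add: \<kappa>_def sin_zero_iff_int2)
qed

lemma integral_trig_freq:
  fixes s :: bool and m n :: nat
  assumes h: "h > 0"
  shows "(\<integral>t. (if s then sin else cos) (real m * (pi / (2 * h)) * (t + h)) *
      (if s then sin else cos) (real n * (pi / (2 * h)) * (t + h)) * indicator {- h..h} t \<partial>lborel)
     = (if m \<noteq> n then 0 else if m = 0 then (if s then 0 else 2 * h) else h)"
proof -
  define c where "c = (\<lambda>k::int. \<lambda>t. cos (of_int k * (pi / (2 * h)) * (t + h)) * indicator {- h..h} t)"
  have int: "integrable lborel (c k)" for k
    unfolding c_def by (rule borel_integrable_atLeastAtMost) (use h in \<open>intro continuous_intros; simp\<close>)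
  have J: "integral\<^sup>L lborel (c k) = (if k = 0 then 2 * h else 0)" for k
    unfolding c_def by (rule integral_cos_freq[OF h])
  have eq: "(if s then sin else cos) (real m * (pi / (2 * h)) * (t + h)) *
      (if s then sin else cos) (real n * (pi / (2 * h)) * (t + h)) * indicator {- h..h} t
     = (c (int m - int n) t + (if s then -1 else 1) * c (int m + int n) t) / 2" for t
    by (simp add: c_def sin_times_sin cos_times_cos left_diff_distrib distrib_right diff_divide_distrib add_divide_distrib)
  show ?thesis
    unfolding eq using h int by (simp add: J)
qed

lemma sin_cos_prod_0: "sin_cos_prod h 0 m = cos_prod h m"
  by (auto simp: sin_cos_prod_def cos_prod_def fun_eq_iff intro!: prod.cong)

lemma continuous_on_sin_cos_prod: "continuous_on S (sin_cos_prod h j m)"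
  unfolding sin_cos_prod_def
proof (intro continuous_on_prod)
  show "continuous_on S (\<lambda>x. (if b = j then sin else cos) (real (m b) * (pi / (2 * h)) * (x \<bullet> b + h)))" for b
    by (cases "b = j"; simp only: if_True if_False simp_thms) (intro continuous_on_sin continuous_on_cos continuous_on_mult_left continuous_on_add continuous_on_inner continuous_on_id continuous_on_const)+
qed

lemma borel_measurable_sin_cos_prod [measurable]: "sin_cos_prod h j m \<in> borel_measurable borel"
  by (intro borel_measurable_continuous_onI continuous_on_sin_cos_prod)

lemma abs_sin_cos_prod_le: "\<bar>sin_cos_prod h j m x\<bar> \<le> 1"
  unfolding sin_cos_prod_def abs_prod by (intro prod_le_1) auto

text \<open>The squared norm of \<open>sin_cos_prod\<close> on the cube. It is 0 when the sine
  factor has frequency 0, so Bessel's inequality for the mixed system is stated with the cosine norm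
  \<open>sc_norm h 0 m\<close>, which is positive and at least as large.\<close>

definition sc_norm :: "real \<Rightarrow> 'a::euclidean_space \<Rightarrow> ('a \<Rightarrow> nat) \<Rightarrow> real" where
  "sc_norm h j m = (\<Prod>b\<in>Basis. if m b = 0 then (if b = j then 0 else 2 * h) else h)"

lemma sc_norm_le: "h > 0 \<Longrightarrow> sc_norm h j m \<le> sc_norm h 0 m"
  unfolding sc_norm_def by (intro prod_mono) auto

lemma sc_norm_ge: "h > 0 \<Longrightarrow> h ^ DIM('a) \<le> sc_norm h (0::'a::euclidean_space) m"
proof -
  assume h: "h > 0"
  have "(\<Prod>b\<in>(Basis::'a set). h) \<le> sc_norm h 0 m"
    unfolding sc_norm_def by (intro prod_mono) (use h in auto)
  then show ?thesis by simp
qed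

lemma indicator_cube: "indicator (cube h) x = (\<Prod>b\<in>Basis. indicator {- h..h} (x \<bullet> b) :: real)"
proof (cases "x \<in> cube h")
  case True
  then show ?thesis by (auto simp: mem_cube indicator_def intro!: prod.neutral[symmetric])
next
  case False
  then obtain b where "b \<in> Basis" "x \<bullet> b \<notin> {- h..h}" by (auto simp: mem_cube)
  then have "(\<Prod>b\<in>Basis. indicator {- h..h} (x \<bullet> b) :: real) = 0"
    by (intro prod_zero) (auto simp: indicator_def)
  with False show ?thesis by simp
qed

lemma integral_cube_sin_cos_prod:
  fixes j :: "'a::euclidean_space"
  assumes h: "h > 0" and mn: "m \<in> Basis \<rightarrow>\<^sub>E UNIV" "n \<in> Basis \<rightarrow>\<^sub>E UNIV"
  shows "(\<integral>x. sin_cos_prod h j m x * sin_cos_prod h j n x \<partial>restrict_space lborel (cube h))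
    = (if m = n then sc_norm h j m else 0)"
proof -
  let ?f = "\<lambda>b t. (if b = j then sin else cos) (real (m b) * (pi / (2 * h)) * (t + h)) *
      (if b = j then sin else cos) (real (n b) * (pi / (2 * h)) * (t + h)) * indicator {- h..h} t"
  have "(\<integral>x. sin_cos_prod h j m x * sin_cos_prod h j n x \<partial>restrict_space lborel (cube h))
     = (\<integral>x. (\<Prod>b\<in>Basis. ?f b (x \<bullet> b)) \<partial>lborel)"
    by (subst integral_restrict_space)
       (auto simp: sin_cos_prod_def indicator_cube prod.distrib mult_ac)
  also have "\<dots> = (\<Prod>b\<in>Basis. \<integral>t. ?f b t \<partial>lborel)"
  proof (rule lborel_integral_prod_Basis)
    show "integrable lborel (?f b)" for b
      by (rule borel_integrable_atLeastAtMost) (cases "b = j"; use h in \<open>simp; intro continuous_intros; simp\<close>)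
  qed
  also have "\<dots> = (\<Prod>b\<in>Basis. if m b \<noteq> n b then 0 else if m b = 0 then (if b = j then 0 else 2 * h) else h)"
    by (intro prod.cong refl integral_trig_freq h)
  also have "\<dots> = (if m = n then sc_norm h j m else 0)"
  proof (cases "m = n")
    case False
    then obtain b where "b \<in> Basis" "m b \<noteq> n b" using mn by (metis PiE_ext)
    with False show ?thesis by (auto intro!: prod_zero)
  qed (simp add: sc_norm_def)
  finally show ?thesis .
qed

lemma orthogonal_square_expand:
  fixes g :: "'x \<Rightarrow> real" and u :: "'i \<Rightarrow> 'x \<Rightarrow> real"
  assumes Z: "finite Z"
    and g: "integrable M (\<lambda>x. (g x)\<^sup>2)"
    and gu: "\<And>m. m \<in> Z \<Longrightarrow> integrable M (\<lambda>x. g x * u m x)"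
    and uu: "\<And>m n. m \<in> Z \<Longrightarrow> n \<in> Z \<Longrightarrow> integrable M (\<lambda>x. u m x * u n x)"
    and orth: "\<And>m n. m \<in> Z \<Longrightarrow> n \<in> Z \<Longrightarrow> m \<noteq> n \<Longrightarrow> (\<integral>x. u m x * u n x \<partial>M) = 0"
  shows "(\<integral>x. (g x - (\<Sum>m\<in>Z. c m * u m x))\<^sup>2 \<partial>M)
    = (\<integral>x. (g x)\<^sup>2 \<partial>M) - 2 * (\<Sum>m\<in>Z. c m * (\<integral>x. g x * u m x \<partial>M))
      + (\<Sum>m\<in>Z. (c m)\<^sup>2 * (\<integral>x. u m x * u m x \<partial>M))"
proof -
  have eq: "(g x - (\<Sum>m\<in>Z. c m * u m x))\<^sup>2
     = (g x)\<^sup>2 - 2 * (\<Sum>m\<in>Z. c m * (g x * u m x)) + (\<Sum>m\<in>Z. \<Sum>n\<in>Z. c m * c n * (u m x * u n x))" for x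
  proof -
    have "(\<Sum>m\<in>Z. c m * u m x)\<^sup>2 = (\<Sum>m\<in>Z. \<Sum>n\<in>Z. c m * c n * (u m x * u n x))"
      by (simp add: power2_eq_square sum_product mult_ac)
    moreover have "g x * (\<Sum>m\<in>Z. c m * u m x) = (\<Sum>m\<in>Z. c m * (g x * u m x))"
      by (simp add: sum_distrib_left mult_ac)
    ultimately show ?thesis by (simp add: power2_diff)
  qed
  have "(\<integral>x. (g x - (\<Sum>m\<in>Z. c m * u m x))\<^sup>2 \<partial>M)
    = (\<integral>x. (g x)\<^sup>2 \<partial>M) - 2 * (\<Sum>m\<in>Z. c m * (\<integral>x. g x * u m x \<partial>M))
      + (\<Sum>m\<in>Z. \<Sum>n\<in>Z. c m * c n * (\<integral>x. u m x * u n x \<partial>M))"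
    unfolding eq using g gu uu by simp
  also have "(\<Sum>m\<in>Z. \<Sum>n\<in>Z. c m * c n * (\<integral>x. u m x * u n x \<partial>M))
    = (\<Sum>m\<in>Z. (c m)\<^sup>2 * (\<integral>x. u m x * u m x \<partial>M))"
  proof (rule sum.cong[OF refl])
    fix m assume m: "m \<in> Z"
    have "(\<Sum>n\<in>Z. c m * c n * (\<integral>x. u m x * u n x \<partial>M)) = (\<Sum>n\<in>Z. if n = m then c m * c m * (\<integral>x. u m x * u m x \<partial>M) else 0)"
      using orth m by (intro sum.cong) auto
    then show "(\<Sum>n\<in>Z. c m * c n * (\<integral>x. u m x * u n x \<partial>M)) = (c m)\<^sup>2 * (\<integral>x. u m x * u m x \<partial>M)"
      using Z m by (simp add: power2_eq_square)
  qed
  finally show ?thesis .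
qed

lemma finite_measure_cube: "finite_measure (restrict_space lborel (cube h :: 'a::euclidean_space set))"
  by (rule finite_measureI) (use emeasure_compact_finite[OF compact_cube[of h]] in
       \<open>simp add: emeasure_restrict_space space_restrict_space less_top\<close>)

lemma integrable_cube_mult_bounded:
  fixes g u :: "'a::euclidean_space \<Rightarrow> real"
  assumes "g \<in> borel_measurable borel" "u \<in> borel_measurable borel"
    and "integrable (restrict_space lborel (cube h)) (\<lambda>x. (g x)\<^sup>2)" and "\<And>x. \<bar>u x\<bar> \<le> 1"
  shows "integrable (restrict_space lborel (cube h)) (\<lambda>x. g x * u x)"
proof (rule Bochner_Integration.integrable_bound)
  interpret finite_measure "restrict_space lborel (cube h :: 'a set)" by (rule finite_measure_cube)
  show "integrable (restrict_space lborel (cube h)) (\<lambda>x. 1 + (g x)\<^sup>2)"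
    using assms(3) by simp
  have [measurable]: "g \<in> borel_measurable borel" "u \<in> borel_measurable borel" by fact+
  show "(\<lambda>x. g x * u x) \<in> borel_measurable (restrict_space lborel (cube h))"
    by (intro measurable_restrict_space1) simp
  show "AE x in restrict_space lborel (cube h). norm (g x * u x) \<le> norm (1 + (g x)\<^sup>2)"
  proof (rule AE_I2)
    fix x
    have "\<bar>g x * u x\<bar> \<le> \<bar>g x\<bar>" using assms(4)[of x] by (simp add: abs_mult mult_left_le)
    also have "\<bar>g x\<bar> \<le> 1 + (g x)\<^sup>2"
      using sum_squares_bound[of "\<bar>g x\<bar>" 1] by (simp add: power2_eq_square)
    finally show "norm (g x * u x) \<le> norm (1 + (g x)\<^sup>2)" by simp
  qed
qed

lemma bessel_sin_cos_prod:
  fixes g :: "'a::euclidean_space \<Rightarrow> real"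
  assumes h: "h > 0" and Z: "finite Z" "Z \<subseteq> Basis \<rightarrow>\<^sub>E UNIV"
    and [measurable]: "g \<in> borel_measurable borel"
    and g: "integrable (restrict_space lborel (cube h)) (\<lambda>x. (g x)\<^sup>2)"
  shows "(\<Sum>m\<in>Z. (\<integral>x. g x * sin_cos_prod h j m x \<partial>restrict_space lborel (cube h))\<^sup>2 / sc_norm h 0 m)
     \<le> (\<integral>x. (g x)\<^sup>2 \<partial>restrict_space lborel (cube h))"
proof -
  let ?M = "restrict_space lborel (cube h :: 'a set)"
  interpret finite_measure ?M by (rule finite_measure_cube)
  let ?y = "\<lambda>m. \<integral>x. g x * sin_cos_prod h j m x \<partial>?M"
  let ?c = "\<lambda>m. ?y m / sc_norm h 0 m"
  have uu: "integrable ?M (\<lambda>x. sin_cos_prod h j m x * sin_cos_prod h j n x)" for m n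
  proof (rule integrable_cube_mult_bounded)
    show "integrable ?M (\<lambda>x. (sin_cos_prod h j m x)\<^sup>2)"
      by (rule integrable_const_bound[of _ 1])
         (auto simp: abs_square_le_1 abs_sin_cos_prod_le intro!: measurable_restrict_space1)
  qed (auto simp: abs_sin_cos_prod_le)
  have pos: "0 < sc_norm h (0::'a) m" for m
    using sc_norm_ge[OF h, of m] h by (meson less_le_trans zero_less_power)
  have "0 \<le> (\<integral>x. (g x - (\<Sum>m\<in>Z. ?c m * sin_cos_prod h j m x))\<^sup>2 \<partial>?M)"
    by (rule integral_nonneg_AE) simp
  also have "\<dots> = (\<integral>x. (g x)\<^sup>2 \<partial>?M) - 2 * (\<Sum>m\<in>Z. ?c m * ?y m)
      + (\<Sum>m\<in>Z. (?c m)\<^sup>2 * (\<integral>x. sin_cos_prod h j m x * sin_cos_prod h j m x \<partial>?M))"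
    using Z by (intro orthogonal_square_expand g uu integrable_cube_mult_bounded)
               (auto simp: abs_sin_cos_prod_le integral_cube_sin_cos_prod[OF h] subset_iff)
  also have "(\<Sum>m\<in>Z. (?c m)\<^sup>2 * (\<integral>x. sin_cos_prod h j m x * sin_cos_prod h j m x \<partial>?M))
      \<le> (\<Sum>m\<in>Z. ?c m * ?y m)"
  proof (rule sum_mono)
    fix m assume "m \<in> Z"
    then have "(?c m)\<^sup>2 * (\<integral>x. sin_cos_prod h j m x * sin_cos_prod h j m x \<partial>?M) \<le> (?c m)\<^sup>2 * sc_norm h 0 m"
      using Z sc_norm_le[OF h, of j m] by (intro mult_left_mono) (auto simp: integral_cube_sin_cos_prod[OF h] subset_iff)
    also have "\<dots> = ?c m * ?y m" using pos[of m] by (simp add: power2_eq_square)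
    finally show "(?c m)\<^sup>2 * (\<integral>x. sin_cos_prod h j m x * sin_cos_prod h j m x \<partial>?M) \<le> ?c m * ?y m" .
  qed
  finally show ?thesis by (simp add: power2_eq_square)
qed

text \<open>Truncating \<open>f\<close> first gives a bounded function, which is an almost
  everywhere limit of continuous ones; truncating those at the same level makes dominated
  convergence applicable on the cube. Errors of \<open>\<eta> / 4\<close> suffice because squaring a
  sum of two costs a factor 2.\<close>

lemma L2_cube_approx_continuous:
  fixes f :: "'a::euclidean_space \<Rightarrow> real"
  assumes [measurable]: "f \<in> borel_measurable borel"
    and f2: "integrable (restrict_space lborel (cube h)) (\<lambda>x. (f x)\<^sup>2)" and \<eta>: "\<eta> > 0"
  obtains g where "continuous_on UNIV g" "(\<integral>x. (f x - g x)\<^sup>2 \<partial>restrict_space lborel (cube h)) < \<eta>"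
    "integrable (restrict_space lborel (cube h)) (\<lambda>x. (f x - g x)\<^sup>2)"
proof -
  let ?M = "restrict_space lborel (cube h :: 'a set)"
  interpret finite_measure ?M by (rule finite_measure_cube)
  let ?clip = "\<lambda>c y::real. max (- c) (min c y)"
  have meas: "u \<in> borel_measurable ?M" if "u \<in> borel_measurable borel" for u :: "'a \<Rightarrow> real"
    using that by (intro measurable_restrict_space1) simp
  have "(\<lambda>n. \<integral>x. (f x - ?clip (real n) (f x))\<^sup>2 \<partial>?M) \<longlonglongrightarrow> (\<integral>x. 0 \<partial>?M)"
  proof (rule integral_dominated_convergence[where w = "\<lambda>x. (f x)\<^sup>2"])
    show "AE x in ?M. (\<lambda>n. (f x - ?clip (real n) (f x))\<^sup>2) \<longlonglongrightarrow> 0"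
    proof (rule AE_I2)
      fix x
      obtain n0 where n0: "\<bar>f x\<bar> \<le> real n0" using real_arch_simple by blast
      have "\<forall>\<^sub>F n in sequentially. (f x - ?clip (real n) (f x))\<^sup>2 = 0"
        using eventually_ge_at_top[of n0] by eventually_elim (use n0 in auto)
      then show "(\<lambda>n. (f x - ?clip (real n) (f x))\<^sup>2) \<longlonglongrightarrow> 0"
        by (rule tendsto_eventually)
    qed
    show "AE x in ?M. norm ((f x - ?clip (real n) (f x))\<^sup>2) \<le> (f x)\<^sup>2" for n
      by (rule AE_I2) (auto simp: abs_le_square_iff[symmetric])
  qed (use f2 in \<open>auto intro!: meas\<close>)
  then have "\<forall>\<^sub>F n in sequentially. (\<integral>x. (f x - ?clip (real n) (f x))\<^sup>2 \<partial>?M) < \<eta> / 4"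
    using \<eta> by (intro order_tendstoD) auto
  then obtain k where k: "(\<integral>x. (f x - ?clip (real k) (f x))\<^sup>2 \<partial>?M) < \<eta> / 4"
    by (auto simp: eventually_sequentially)
  define c where "c = real k"
  let ?fc = "\<lambda>x. ?clip c (f x)"
  have "?fc measurable_on UNIV"
    by (rule lebesgue_measurable_imp_measurable_on) (auto intro!: measurable_completion)
  then obtain N g where N: "negligible N" and g: "\<And>n. continuous_on UNIV (g n)"
    and lim: "\<And>x. x \<notin> N \<Longrightarrow> (\<lambda>n. g n x) \<longlonglongrightarrow> ?fc x"
    unfolding measurable_on_def by auto
  have [measurable]: "g n \<in> borel_measurable borel" for n
    by (intro borel_measurable_continuous_onI g)
  have c0: "c \<ge> 0" by (simp add: c_def)
  have clip2: "(?clip c y - ?clip c z)\<^sup>2 \<le> (2 * c)\<^sup>2" for y z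
    using c0 by (simp only: abs_le_square_iff[symmetric])
  have "AE x in lebesgue. x \<notin> N"
    using N by (auto simp: negligible_iff_null_sets intro: AE_not_in)
  then have "AE x in lborel. x \<notin> N" by (simp add: AE_completion_iff)
  then have AEM: "AE x in ?M. x \<notin> N"
    by (subst AE_restrict_space_iff) auto
  have "(\<lambda>n. \<integral>x. (?fc x - ?clip c (g n x))\<^sup>2 \<partial>?M) \<longlonglongrightarrow> (\<integral>x. 0 \<partial>?M)"
  proof (rule integral_dominated_convergence[where w = "\<lambda>x. (2 * c)\<^sup>2"])
    show "AE x in ?M. (\<lambda>n. (?fc x - ?clip c (g n x))\<^sup>2) \<longlonglongrightarrow> 0"
      using AEM
    proof eventually_elim
      case (elim x)
      have "(\<lambda>n. (?fc x - ?clip c (g n x))\<^sup>2) \<longlonglongrightarrow> (?fc x - ?clip c (?fc x))\<^sup>2"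
        using lim[OF elim] by (intro tendsto_intros)
      moreover have "?clip c (?fc x) = ?fc x" using c0 by auto
      ultimately show ?case by simp
    qed
    show "AE x in ?M. norm ((?fc x - ?clip c (g n x))\<^sup>2) \<le> (2 * c)\<^sup>2" for n
      using clip2 by (intro AE_I2) simp
  qed (auto intro!: meas)
  then have "\<forall>\<^sub>F n in sequentially. (\<integral>x. (?fc x - ?clip c (g n x))\<^sup>2 \<partial>?M) < \<eta> / 4"
    using \<eta> by (intro order_tendstoD) auto
  then obtain n where n: "(\<integral>x. (?fc x - ?clip c (g n x))\<^sup>2 \<partial>?M) < \<eta> / 4"
    by (auto simp: eventually_sequentially)
  let ?g = "\<lambda>x. ?clip c (g n x)"
  have i1: "integrable ?M (\<lambda>x. (f x - ?fc x)\<^sup>2)"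
    by (rule Bochner_Integration.integrable_bound[OF f2])
       (use c0 in \<open>auto intro!: meas AE_I2 simp: abs_le_square_iff[symmetric]\<close>)
  have i2: "integrable ?M (\<lambda>x. (?fc x - ?g x)\<^sup>2)"
    by (rule integrable_const_bound[of _ "(2 * c)\<^sup>2"])
       (use clip2 in \<open>auto intro!: meas AE_I2\<close>)
  have ptw: "(f x - ?g x)\<^sup>2 \<le> 2 * (f x - ?fc x)\<^sup>2 + 2 * (?fc x - ?g x)\<^sup>2" for x
    using sum_squares_bound[of "f x - ?fc x" "?fc x - ?g x"] by (simp add: power2_eq_square algebra_simps)
  have i3: "integrable ?M (\<lambda>x. (f x - ?g x)\<^sup>2)"
    by (rule Bochner_Integration.integrable_bound[of _ "\<lambda>x. 2 * (f x - ?fc x)\<^sup>2 + 2 * (?fc x - ?g x)\<^sup>2"])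
       (use i1 i2 ptw in \<open>auto intro!: meas AE_I2\<close>)
  have "(\<integral>x. (f x - ?g x)\<^sup>2 \<partial>?M) \<le> (\<integral>x. 2 * (f x - ?fc x)\<^sup>2 + 2 * (?fc x - ?g x)\<^sup>2 \<partial>?M)"
    using i1 i2 by (intro integral_mono i3 ptw) auto
  also have "\<dots> = 2 * (\<integral>x. (f x - ?fc x)\<^sup>2 \<partial>?M) + 2 * (\<integral>x. (?fc x - ?g x)\<^sup>2 \<partial>?M)"
    using i1 i2 by simp
  also have "\<dots> < \<eta>" using k n by (simp add: c_def)
  finally show ?thesis
    by (intro that[of ?g] i3) (auto intro!: continuous_intros g)
qed

text \<open>No infinite series is summed: one cosine polynomial close to \<open>f\<close> in square
  mean already provides the finite index set, and its coefficients may then be exchanged for the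
  Fourier coefficients.\<close>

lemma parseval_cos_prod:
  fixes f :: "'a::euclidean_space \<Rightarrow> real"
  assumes h: "h > 0" and fm [measurable]: "f \<in> borel_measurable borel"
    and f2: "integrable (restrict_space lborel (cube h)) (\<lambda>x. (f x)\<^sup>2)" and \<eta>: "\<eta> > 0"
  obtains Z where "finite Z" "Z \<subseteq> Basis \<rightarrow>\<^sub>E UNIV"
    "(\<integral>x. (f x)\<^sup>2 \<partial>restrict_space lborel (cube h))
      \<le> (\<Sum>m\<in>Z. (\<integral>x. f x * cos_prod h m x \<partial>restrict_space lborel (cube h))\<^sup>2 / sc_norm h 0 m) + \<eta>"
proof -
  let ?M = "restrict_space lborel (cube h :: 'a set)"
  interpret finite_measure ?M by (rule finite_measure_cube)
  have meas: "u \<in> borel_measurable ?M" if "u \<in> borel_measurable borel" for u :: "'a \<Rightarrow> real"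
    using that by (intro measurable_restrict_space1) simp
  obtain g where g: "continuous_on UNIV g" and fg: "(\<integral>x. (f x - g x)\<^sup>2 \<partial>?M) < \<eta> / 4"
    "integrable ?M (\<lambda>x. (f x - g x)\<^sup>2)"
    using L2_cube_approx_continuous[OF fm f2, of "\<eta> / 4"] \<eta> by auto
  have [measurable]: "g \<in> borel_measurable borel" by (intro borel_measurable_continuous_onI g)
  define V where "V = measure ?M (space ?M)"
  have V: "V \<ge> 0" by (simp add: V_def)
  define e where "e = sqrt (\<eta> / (4 * (V + 1)))"
  have e: "e > 0" "e\<^sup>2 = \<eta> / (4 * (V + 1))" using \<eta> V by (auto simp: e_def)
  obtain p where p: "cos_poly h p" and gp: "\<And>x. x \<in> cube h \<Longrightarrow> \<bar>g x - p x\<bar> < e"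
    using cos_poly_dense[OF h continuous_on_subset[OF g] e(1)] by auto
  obtain Z c where Z: "finite Z" "Z \<subseteq> Basis \<rightarrow>\<^sub>E UNIV" "\<And>x. p x = (\<Sum>m\<in>Z. c m * cos_prod h m x)"
    using p unfolding cos_poly_def by blast
  have cpm [measurable]: "cos_prod h m \<in> borel_measurable borel" for m :: "'a \<Rightarrow> nat"
    using borel_measurable_sin_cos_prod[of h 0 m] by (simp add: sin_cos_prod_0)
  have cp1: "\<bar>cos_prod h m x\<bar> \<le> 1" for m :: "'a \<Rightarrow> nat" and x
    using abs_sin_cos_prod_le[of h 0 m x] by (simp add: sin_cos_prod_0)
  have [measurable]: "p \<in> borel_measurable borel"
    using Z(3) by (subst measurable_cong[of _ _ "\<lambda>x. \<Sum>m\<in>Z. c m * cos_prod h m x"]) auto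
  have bnd: "(g x - p x)\<^sup>2 \<le> e\<^sup>2" if "x \<in> cube h" for x
    using gp[OF that] e(1) by (simp add: abs_le_square_iff[symmetric])
  have AEx: "AE x in ?M. x \<in> cube h" by (rule AE_I2) (simp add: space_restrict_space)
  have i2: "integrable ?M (\<lambda>x. (g x - p x)\<^sup>2)"
    by (rule integrable_const_bound[of _ "e\<^sup>2"]) (use AEx bnd in \<open>auto intro!: meas\<close>)
  have le: "(\<integral>x. (g x - p x)\<^sup>2 \<partial>?M) \<le> (\<integral>x. e\<^sup>2 \<partial>?M)"
    by (rule integral_mono_AE) (use i2 AEx bnd in auto)
  also have "\<dots> = e\<^sup>2 * V" by (simp add: V_def)
  also have "\<dots> \<le> \<eta> / 4" using V \<eta> by (simp add: e(2) field_simps)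
  finally have gp2: "(\<integral>x. (g x - p x)\<^sup>2 \<partial>?M) \<le> \<eta> / 4" .
  have ptw: "(f x - p x)\<^sup>2 \<le> 2 * (f x - g x)\<^sup>2 + 2 * (g x - p x)\<^sup>2" for x
    using sum_squares_bound[of "f x - g x" "g x - p x"] by (simp add: power2_eq_square algebra_simps)
  have i3: "integrable ?M (\<lambda>x. (f x - p x)\<^sup>2)"
    by (rule Bochner_Integration.integrable_bound[of _ "\<lambda>x. 2 * (f x - g x)\<^sup>2 + 2 * (g x - p x)\<^sup>2"])
       (use fg i2 ptw in \<open>auto intro!: meas AE_I2\<close>)
  have "(\<integral>x. (f x - p x)\<^sup>2 \<partial>?M) \<le> (\<integral>x. 2 * (f x - g x)\<^sup>2 + 2 * (g x - p x)\<^sup>2 \<partial>?M)"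
    using fg i2 by (intro integral_mono i3 ptw) auto
  also have "\<dots> = 2 * (\<integral>x. (f x - g x)\<^sup>2 \<partial>?M) + 2 * (\<integral>x. (g x - p x)\<^sup>2 \<partial>?M)"
    using fg i2 by simp
  also have "\<dots> \<le> \<eta>" using fg gp2 by simp
  finally have fp: "(\<integral>x. (f x - p x)\<^sup>2 \<partial>?M) \<le> \<eta>" .
  let ?y = "\<lambda>m. \<integral>x. f x * cos_prod h m x \<partial>?M"
  have uu: "integrable ?M (\<lambda>x. cos_prod h m x * cos_prod h n x)" for m n
  proof (rule integrable_cube_mult_bounded)
    show "integrable ?M (\<lambda>x. (cos_prod h m x)\<^sup>2)"
      by (rule integrable_const_bound[of _ 1])
         (auto simp: abs_square_le_1 cp1 intro!: meas)
  qed (auto simp: cp1)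
  have oo: "(\<integral>x. cos_prod h m x * cos_prod h n x \<partial>?M) = (if m = n then sc_norm h 0 m else 0)"
    if "m \<in> Z" "n \<in> Z" for m n
  proof -
    have "m \<in> Basis \<rightarrow>\<^sub>E UNIV" "n \<in> Basis \<rightarrow>\<^sub>E UNIV" using that Z(2) by blast+
    from integral_cube_sin_cos_prod[OF h this, of 0] show ?thesis by (simp only: sin_cos_prod_0)
  qed
  have pos: "0 < sc_norm h (0::'a) m" for m
    using sc_norm_ge[OF h, of m] h by (meson less_le_trans zero_less_power)
  have "(\<integral>x. (f x - p x)\<^sup>2 \<partial>?M) = (\<integral>x. (f x)\<^sup>2 \<partial>?M) - 2 * (\<Sum>m\<in>Z. c m * ?y m)
      + (\<Sum>m\<in>Z. (c m)\<^sup>2 * (\<integral>x. cos_prod h m x * cos_prod h m x \<partial>?M))"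
    unfolding Z(3) using Z(1)
    by (intro orthogonal_square_expand f2 uu integrable_cube_mult_bounded) (auto simp: cp1 oo)
  also have "(\<Sum>m\<in>Z. (c m)\<^sup>2 * (\<integral>x. cos_prod h m x * cos_prod h m x \<partial>?M)) = (\<Sum>m\<in>Z. (c m)\<^sup>2 * sc_norm h 0 m)"
    by (intro sum.cong) (auto simp: oo)
  finally have "(\<integral>x. (f x)\<^sup>2 \<partial>?M) \<le> \<eta> + (\<Sum>m\<in>Z. 2 * (c m * ?y m) - (c m)\<^sup>2 * sc_norm h 0 m)"
    using fp by (simp add: sum_subtractf sum_distrib_left)
  \<comment> \<open>Completing the square: in each mode the approximant gains at most what the
    Fourier coefficient gains.\<close>
  also have "(\<Sum>m\<in>Z. 2 * (c m * ?y m) - (c m)\<^sup>2 * sc_norm h 0 m) \<le> (\<Sum>m\<in>Z. (?y m)\<^sup>2 / sc_norm h 0 m)"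
  proof (rule sum_mono)
    fix m
    have "0 \<le> (c m * sc_norm h 0 m - ?y m)\<^sup>2 / sc_norm h 0 m" using pos[of m] by simp
    also have "\<dots> = (c m)\<^sup>2 * sc_norm h 0 m - 2 * (c m * ?y m) + (?y m)\<^sup>2 / sc_norm h 0 m"
      using pos[of m] by (simp add: field_simps power2_eq_square)
    finally show "2 * (c m * ?y m) - (c m)\<^sup>2 * sc_norm h 0 m \<le> (?y m)\<^sup>2 / sc_norm h 0 m" by simp
  qed
  finally show ?thesis using that[OF Z(1,2)] by (simp add: add.commute)
qed

text \<open>Modes with all frequencies at most \<open>\<rho>\<close> are counted and bounded by
  \<open>B\<close>. In any other mode some frequency exceeds \<open>\<rho>\<close>, so one
  derivative coefficient outweighs the mode by that factor, and Bessel's inequality sums the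
  derivative coefficients.\<close>

lemma cos_series_tail_bound:
  fixes f :: "'a::euclidean_space \<Rightarrow> real" and g :: "'a \<Rightarrow> 'a \<Rightarrow> real"
  assumes h: "h > 0" and \<rho>: "\<rho> > 0"
    and fm: "f \<in> borel_measurable borel"
    and f2: "integrable (restrict_space lborel (cube h)) (\<lambda>x. (f x)\<^sup>2)"
    and gm: "\<And>b. b \<in> Basis \<Longrightarrow> g b \<in> borel_measurable borel"
    and g2: "\<And>b. b \<in> Basis \<Longrightarrow> integrable (restrict_space lborel (cube h)) (\<lambda>x. (g b x)\<^sup>2)"
    and deriv: "\<And>b m. b \<in> Basis \<Longrightarrow> m \<in> Basis \<rightarrow>\<^sub>E UNIV \<Longrightarrow>
       \<bar>\<integral>x. g b x * sin_cos_prod h b m x \<partial>restrict_space lborel (cube h)\<bar>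
        = real (m b) * (pi / (2 * h)) * \<bar>\<integral>x. f x * cos_prod h m x \<partial>restrict_space lborel (cube h)\<bar>"
    and low: "\<And>m. m \<in> Basis \<rightarrow>\<^sub>E UNIV \<Longrightarrow> (\<And>b. b \<in> Basis \<Longrightarrow> real (m b) * (pi / (2 * h)) \<le> \<rho>) \<Longrightarrow>
       \<bar>\<integral>x. f x * cos_prod h m x \<partial>restrict_space lborel (cube h)\<bar> \<le> B"
  shows "(\<integral>x. (f x)\<^sup>2 \<partial>restrict_space lborel (cube h))
     \<le> ((2 * \<rho> / pi + 1 / h) ^ DIM('a)) * B\<^sup>2 +
       (\<Sum>b\<in>Basis. \<integral>x. (g b x)\<^sup>2 \<partial>restrict_space lborel (cube h)) / \<rho>\<^sup>2"
proof (rule field_le_epsilon)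
  fix \<eta> :: real assume \<eta>: "\<eta> > 0"
  let ?M = "restrict_space lborel (cube h :: 'a set)"
  let ?\<kappa> = "pi / (2 * h)"
  let ?y = "\<lambda>m. \<integral>x. f x * cos_prod h m x \<partial>?M"
  obtain Z where Z: "finite Z" "Z \<subseteq> Basis \<rightarrow>\<^sub>E UNIV"
    and le: "(\<integral>x. (f x)\<^sup>2 \<partial>?M) \<le> (\<Sum>m\<in>Z. (?y m)\<^sup>2 / sc_norm h 0 m) + \<eta>"
    by (rule parseval_cos_prod[OF h fm f2 \<eta>])
  have \<kappa>: "?\<kappa> > 0" using h by simp
  \<comment> \<open>The largest index whose frequency is at most \<open>\<rho>\<close>, leaving
    \<open>K + 1\<close> choices per axis. Dividing by the side \<open>h\<close> from
    \<open>sc_norm\<close> produces \<open>2 * \<rho> / pi + 1 / h\<close>.\<close>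
  define K where "K = nat \<lfloor>\<rho> / ?\<kappa>\<rfloor>"
  have K: "real k * ?\<kappa> \<le> \<rho> \<longleftrightarrow> k \<le> K" for k
  proof -
    have "real k * ?\<kappa> \<le> \<rho> \<longleftrightarrow> real k \<le> \<rho> / ?\<kappa>" by (rule pos_le_divide_eq[OF \<kappa>, symmetric])
    also have "\<dots> \<longleftrightarrow> k \<le> K"
    proof
      assume "k \<le> K"
      then have "real k \<le> real (nat \<lfloor>\<rho> / ?\<kappa>\<rfloor>)" by (simp only: K_def of_nat_le_iff)
      also have "\<dots> \<le> \<rho> / ?\<kappa>" by (rule of_nat_floor) (use \<rho> h in simp)
      finally show "real k \<le> \<rho> / ?\<kappa>" .
    qed (simp only: K_def le_nat_floor)
    finally show ?thesis .
  qed
  define Lo where "Lo = (Basis \<rightarrow>\<^sub>E {..K}) \<inter> Z"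
  have pos: "0 < sc_norm h (0::'a) m" for m
    using sc_norm_ge[OF h, of m] h by (meson less_le_trans zero_less_power)
  have termle: "(?y m)\<^sup>2 / sc_norm h 0 m \<le> (if m \<in> Lo then B\<^sup>2 / h ^ DIM('a) else 0)
     + (\<Sum>b\<in>Basis. (\<integral>x. g b x * sin_cos_prod h b m x \<partial>?M)\<^sup>2 / sc_norm h 0 m) / \<rho>\<^sup>2" if m: "m \<in> Z" for m
  proof (cases "m \<in> Lo")
    case True
    then have mK: "m b \<le> K" if "b \<in> Basis" for b using that by (auto simp: Lo_def PiE_iff)
    have "m \<in> Basis \<rightarrow>\<^sub>E UNIV" using m Z(2) by blast
    then have "\<bar>?y m\<bar> \<le> B" by (rule low) (rule K[THEN iffD2, OF mK])
    then have "(?y m)\<^sup>2 \<le> B\<^sup>2" by (metis abs_le_square_iff abs_of_nonneg abs_ge_zero order_trans)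
    then have "(?y m)\<^sup>2 / sc_norm h 0 m \<le> B\<^sup>2 / h ^ DIM('a)"
      using sc_norm_ge[OF h, of m] h by (intro frac_le) auto
    moreover have "0 \<le> (\<Sum>b\<in>Basis. (\<integral>x. g b x * sin_cos_prod h b m x \<partial>?M)\<^sup>2 / sc_norm h 0 m) / \<rho>\<^sup>2"
      using pos[of m] by (intro divide_nonneg_nonneg sum_nonneg) auto
    ultimately show ?thesis using True by simp
  next
    case False
    then obtain b where b: "b \<in> Basis" "\<not> m b \<le> K" using m Z(2) by (auto simp: Lo_def PiE_iff subset_iff)
    then have big: "\<rho> \<le> real (m b) * ?\<kappa>" using K[of "m b"] by simp
    have "\<rho>\<^sup>2 * (?y m)\<^sup>2 \<le> (real (m b) * ?\<kappa>)\<^sup>2 * (?y m)\<^sup>2"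
      using big \<rho> by (intro mult_right_mono power_mono) auto
    also have "\<dots> = (real (m b) * ?\<kappa> * \<bar>?y m\<bar>)\<^sup>2"
      by (simp only: power_mult_distrib power2_abs)
    also have "\<dots> = \<bar>\<integral>x. g b x * sin_cos_prod h b m x \<partial>?M\<bar>\<^sup>2"
      using deriv[OF b(1), of m] m Z(2) by (simp only: subset_iff)
    also have "\<dots> = (\<integral>x. g b x * sin_cos_prod h b m x \<partial>?M)\<^sup>2"
      by (rule power2_abs)
    finally have "\<rho>\<^sup>2 * (?y m)\<^sup>2 / sc_norm h 0 m \<le> (\<integral>x. g b x * sin_cos_prod h b m x \<partial>?M)\<^sup>2 / sc_norm h 0 m"
      using pos[of m] by (intro divide_right_mono) auto
    also have "\<dots> \<le> (\<Sum>b\<in>Basis. (\<integral>x. g b x * sin_cos_prod h b m x \<partial>?M)\<^sup>2 / sc_norm h 0 m)"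
      using b pos[of m] by (intro member_le_sum) auto
    finally have "(?y m)\<^sup>2 / sc_norm h 0 m \<le> (\<Sum>b\<in>Basis. (\<integral>x. g b x * sin_cos_prod h b m x \<partial>?M)\<^sup>2 / sc_norm h 0 m) / \<rho>\<^sup>2"
      using \<rho> by (simp add: pos_le_divide_eq mult.commute)
    with False show ?thesis by simp
  qed
  have finLo: "finite Lo" using Z by (simp add: Lo_def)
  have "card Lo \<le> card ((Basis::'a set) \<rightarrow>\<^sub>E {..K})"
    unfolding Lo_def by (intro card_mono) (auto intro: finite_PiE)
  also have "\<dots> = (K + 1) ^ DIM('a)" by (simp add: card_PiE)
  finally have "real (card Lo) \<le> (real K + 1) ^ DIM('a)"
    by (metis of_nat_Suc of_nat_le_iff of_nat_power Suc_eq_plus1 add.commute)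
  also have "\<dots> \<le> (\<rho> / ?\<kappa> + 1) ^ DIM('a)"
  proof (rule power_mono)
    have "real K \<le> \<rho> / ?\<kappa>" using K[of K] \<kappa> by (simp only: pos_le_divide_eq order_refl)
    then show "real K + 1 \<le> \<rho> / ?\<kappa> + 1" by (rule add_right_mono)
  qed simp
  finally have card: "real (card Lo) \<le> (\<rho> / ?\<kappa> + 1) ^ DIM('a)" .
  have "(\<Sum>m\<in>Z. (?y m)\<^sup>2 / sc_norm h 0 m) \<le> (\<Sum>m\<in>Z. (if m \<in> Lo then B\<^sup>2 / h ^ DIM('a) else 0)
     + (\<Sum>b\<in>Basis. (\<integral>x. g b x * sin_cos_prod h b m x \<partial>?M)\<^sup>2 / sc_norm h 0 m) / \<rho>\<^sup>2)"
    by (intro sum_mono termle)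
  also have "\<dots> = (\<Sum>m\<in>Z. if m \<in> Lo then B\<^sup>2 / h ^ DIM('a) else 0)
     + (\<Sum>m\<in>Z. \<Sum>b\<in>Basis. (\<integral>x. g b x * sin_cos_prod h b m x \<partial>?M)\<^sup>2 / sc_norm h 0 m) / \<rho>\<^sup>2"
    by (simp add: sum.distrib sum_divide_distrib)
  also have "(\<Sum>m\<in>Z. if m \<in> Lo then B\<^sup>2 / h ^ DIM('a) else 0) = real (card Lo) * (B\<^sup>2 / h ^ DIM('a))"
  proof -
    have "Z \<inter> Lo = Lo" by (auto simp: Lo_def)
    then show ?thesis using Z(1) by (simp add: sum.If_cases Int_def[symmetric])
  qed
  also have "\<dots> \<le> (\<rho> / ?\<kappa> + 1) ^ DIM('a) * (B\<^sup>2 / h ^ DIM('a))"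
    using card h by (intro mult_right_mono) auto
  also have "\<dots> = (2 * \<rho> / pi + 1 / h) ^ DIM('a) * B\<^sup>2"
  proof -
    have "2 * \<rho> / pi + 1 / h = (\<rho> / ?\<kappa> + 1) / h" using h by (simp add: field_simps)
    then show ?thesis by (simp add: power_divide)
  qed
  also have "(\<Sum>m\<in>Z. \<Sum>b\<in>Basis. (\<integral>x. g b x * sin_cos_prod h b m x \<partial>?M)\<^sup>2 / sc_norm h 0 m)
     = (\<Sum>b\<in>Basis. \<Sum>m\<in>Z. (\<integral>x. g b x * sin_cos_prod h b m x \<partial>?M)\<^sup>2 / sc_norm h 0 m)"
    by (rule sum.swap)
  also have "\<dots> \<le> (\<Sum>b\<in>Basis. \<integral>x. (g b x)\<^sup>2 \<partial>?M)"
    by (intro sum_mono bessel_sin_cos_prod h Z gm g2)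
  finally show "(\<integral>x. (f x)\<^sup>2 \<partial>?M) \<le> (2 * \<rho> / pi + 1 / h) ^ DIM('a) * B\<^sup>2
      + (\<Sum>b\<in>Basis. \<integral>x. (g b x)\<^sup>2 \<partial>?M) / \<rho>\<^sup>2 + \<eta>"
    using le \<rho> by (simp add: divide_right_mono)
qed

section \<open>Extrapolation in frequency\<close>

definition lagrange_coeff :: "('i \<Rightarrow> real) \<Rightarrow> 'i set \<Rightarrow> real \<Rightarrow> 'i \<Rightarrow> real" where
  "lagrange_coeff x I w j = (\<Prod>i\<in>I - {j}. (w - x i) / (x j - x i))"

text \<open>The interpolant minus the monomial has degree below \<open>N\<close> and vanishes at
  \<open>N\<close> distinct nodes, hence identically; this is what allows evaluation at a point
  \<open>w\<close> away from the nodes.\<close>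

lemma lagrange_exact:
  fixes x :: "nat \<Rightarrow> real"
  assumes inj: "inj_on x {..<N}" and k: "k < N"
  shows "(\<Sum>j<N. lagrange_coeff x {..<N} w j * x j ^ k) = w ^ k"
proof -
  define L where "L = (\<lambda>j. \<Prod>i\<in>{..<N} - {j}. smult (inverse (x j - x i)) [:- x i, 1:])"
  define p where "p = (\<Sum>j<N. smult (x j ^ k) (L j)) - monom 1 k"
  have L: "poly (L j) w = lagrange_coeff x {..<N} w j" for j w
    unfolding L_def lagrange_coeff_def poly_prod
    by (intro prod.cong refl) (simp add: divide_inverse mult.commute left_diff_distrib)
  have degL: "degree (L j) \<le> N - 1" if "j < N" for j
  proof -
    have "degree (L j) \<le> (\<Sum>i\<in>{..<N} - {j}. degree (smult (inverse (x j - x i)) [:- x i, 1:]))"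
      unfolding L_def by (rule order_trans[OF degree_prod_sum_le]) (simp_all only: o_def order_refl finite_Diff finite_lessThan)
    also have "\<dots> \<le> (\<Sum>i\<in>{..<N} - {j}. 1)"
      by (intro sum_mono) (simp add: degree_smult_eq)
    finally show ?thesis using that by simp
  qed
  have "degree p \<le> N - 1"
    unfolding p_def using k degL
    by (intro degree_diff_le degree_sum_le)
       (auto intro: order_trans[OF degree_smult_le] simp: degree_monom_eq)
  moreover have "poly p (x l) = 0" if "l < N" for l
  proof -
    have "lagrange_coeff x {..<N} (x l) j = (if j = l then 1 else 0)" if "j < N" for j
    proof (cases "j = l")
      case True
      have "x l \<noteq> x i" if "i \<in> {..<N} - {l}" for i
        using inj that \<open>l < N\<close> by (auto simp: inj_on_def)
      then show ?thesis using True by (auto simp: lagrange_coeff_def intro!: prod.neutral)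
    next
      case False
      then show ?thesis using \<open>l < N\<close> by (auto simp: lagrange_coeff_def intro!: prod_zero)
    qed
    then have "(\<Sum>j<N. x j ^ k * lagrange_coeff x {..<N} (x l) j) = (\<Sum>j<N. if j = l then x l ^ k else 0)"
      by (intro sum.cong) auto
    then show ?thesis using that by (simp add: p_def poly_sum L poly_monom)
  qed
  ultimately have "p = 0"
  proof -
    assume deg: "degree p \<le> N - 1" and root: "\<And>l. l < N \<Longrightarrow> poly p (x l) = 0"
    show "p = 0"
    proof (rule ccontr)
      assume p: "p \<noteq> 0"
      have "card (x ` {..<N}) \<le> card {r. poly p r = 0}"
        using root poly_roots_finite[OF p] by (intro card_mono) auto
      also have "\<dots> \<le> degree p" by (rule card_poly_roots_bound[OF p])
      finally show False using deg k by (simp add: card_image[OF inj])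
    qed
  qed
  then have "poly p w = 0" by simp
  then show ?thesis by (simp add: p_def poly_sum L poly_monom mult.commute)
qed

text \<open>The order of quantifiers matters: the coefficients may depend on \<open>y\<close> and
  \<open>c\<close> but not on \<open>w\<close>, so that all nodes and the target see one and the
  same polynomial in \<open>w\<close> of degree below \<open>N\<close>.\<close>

lemma cos_taylor:
  fixes c y :: real
  shows "\<exists>a. \<forall>w. \<bar>cos (w * y + c) - (\<Sum>k<N. a k * w ^ k)\<bar> \<le> \<bar>w * y\<bar> ^ N / fact N"
proof (intro exI allI)
  fix w
  \<comment> \<open>Each derivative of the cosine is a shift by a quarter period, which avoids
    distinguishing cases modulo 4.\<close>
  define diff where "diff = (\<lambda>m t. cos (t + c + real m * (pi / 2)))"
  have "\<exists>t. \<bar>t\<bar> \<le> \<bar>w * y\<bar> \<and> cos (w * y + c) = (\<Sum>m<N. (diff m 0 / fact m) * (w * y) ^ m) + (diff N t / fact N) * (w * y) ^ N"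
  proof (rule Maclaurin_all_le)
    show "diff 0 = (\<lambda>t. cos (t + c))" by (simp add: diff_def)
    show "\<forall>m x. DERIV (diff m) x :> diff (Suc m) x"
    proof (intro allI)
      fix m t
      have "diff (Suc m) t = - sin (t + c + real m * (pi / 2))"
      proof -
        have eq: "t + c + real (Suc m) * (pi / 2) = (t + c + real m * (pi / 2)) + pi / 2"
          by (simp add: algebra_simps)
        have "cos (u + pi / 2) = - sin u" for u :: real by (simp add: cos_add)
        then show ?thesis unfolding diff_def eq .
      qed
      then show "DERIV (diff m) t :> diff (Suc m) t"
        unfolding diff_def by (auto intro!: derivative_eq_intros)
    qed
  qed
  then obtain t where t: "cos (w * y + c) = (\<Sum>m<N. (diff m 0 / fact m) * (w * y) ^ m) + (diff N t / fact N) * (w * y) ^ N"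
    by blast
  have "(\<Sum>m<N. (diff m 0 / fact m) * (w * y) ^ m) = (\<Sum>m<N. (diff m 0 / fact m * y ^ m) * w ^ m)"
    by (intro sum.cong) (auto simp: power_mult_distrib)
  then have "\<bar>cos (w * y + c) - (\<Sum>m<N. (diff m 0 / fact m * y ^ m) * w ^ m)\<bar> = \<bar>diff N t\<bar> * (\<bar>w * y\<bar> ^ N / fact N)"
    using t by (simp add: abs_mult power_abs)
  also have "\<dots> \<le> 1 * (\<bar>w * y\<bar> ^ N / fact N)"
    by (intro mult_right_mono) (auto simp: diff_def)
  finally show "\<bar>cos (w * y + c) - (\<Sum>m<N. (cos (0 + c + real m * (pi / 2)) / fact m * y ^ m) * w ^ m)\<bar> \<le> \<bar>w * y\<bar> ^ N / fact N"
    by (simp add: diff_def)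
qed

lemma power_div_fact_le_exp:
  fixes x :: real
  assumes "x \<ge> 0"
  shows "x ^ n / fact n \<le> exp x"
proof -
  have "(\<lambda>n. x ^ n /\<^sub>R fact n) sums exp x" by (rule exp_converges)
  then have "(\<Sum>n\<in>{n}. x ^ n /\<^sub>R fact n) \<le> exp x"
    unfolding sums_iff using sum_le_suminf[of "\<lambda>n. x ^ n /\<^sub>R fact n" "{n}"] assms by simp
  then show ?thesis by (simp add: field_simps)
qed

lemma prod_abs_diff_fact:
  assumes "j < N"
  shows "(\<Prod>i\<in>{..<N} - {j}. \<bar>real j - real i\<bar>) = fact j * fact (N - 1 - j)"
proof -
  have eq: "{..<N} - {j} = {..<j} \<union> {Suc j..<N}" using assms by auto
  have "(\<Prod>i\<in>{..<N} - {j}. \<bar>real j - real i\<bar>)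
     = (\<Prod>i<j. \<bar>real j - real i\<bar>) * (\<Prod>i\<in>{Suc j..<N}. \<bar>real j - real i\<bar>)"
    unfolding eq by (rule prod.union_disjoint) auto
  also have "(\<Prod>i<j. \<bar>real j - real i\<bar>) = (\<Prod>i<j. real (Suc (j - Suc i)))"
    by (intro prod.cong) (auto simp: of_nat_diff)
  also have "\<dots> = (\<Prod>i<j. real (Suc i))"
    by (rule prod.nat_diff_reindex)
  also have "\<dots> = fact j"
    by (simp add: fact_prod_Suc lessThan_atLeast0)
  also have "(\<Prod>i\<in>{Suc j..<N}. \<bar>real j - real i\<bar>) = (\<Prod>i\<in>{0 + Suc j..<(N - 1 - j) + Suc j}. \<bar>real j - real i\<bar>)"
    using assms by (intro prod.cong) auto
  also have "\<dots> = (\<Prod>i\<in>{0..<N - 1 - j}. \<bar>real j - real (i + Suc j)\<bar>)"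
    by (rule prod.shift_bounds_nat_ivl)
  also have "\<dots> = (\<Prod>i\<in>{0..<N - 1 - j}. real (Suc i))"
    by (intro prod.cong) auto
  also have "\<dots> = fact (N - 1 - j)"
    by (simp add: fact_prod_Suc)
  finally show ?thesis .
qed

text \<open>The nodes fill \<open>[a, 3 * a]\<close> with spacing \<open>2 * a / N\<close> and lie
  within \<open>4 * a\<close> of \<open>w\<close>, so each factor is at most
  \<open>2 * N / |j - i|\<close>. The products of differences are factorials, whose reciprocals sum
  up to binomials, leaving at most \<open>4 ^ N * (N ^ N / fact N)\<close>. Together with
  \<open>exp 1 \<le> 3\<close> this gives 12.\<close>

lemma lagrange_coeff_uniform_bound:
  fixes a w :: real
  assumes N: "N > 0" and a: "a > 0" and w: "\<bar>w\<bar> \<le> a"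
  shows "(\<Sum>j<N. \<bar>lagrange_coeff (\<lambda>j. a + 2 * a / real N * real j) {..<N} w j\<bar>) \<le> 12 ^ N"
proof -
  let ?x = "\<lambda>j. a + 2 * a / real N * real j"
  have "\<bar>lagrange_coeff ?x {..<N} w j\<bar> \<le> (2 * real N) ^ (N - 1) / (fact j * fact (N - 1 - j))" if j: "j < N" for j
  proof -
    have x3: "a \<le> ?x i" "?x i \<le> 3 * a" if "i < N" for i
      using a that N by (auto simp: field_simps)
    have "\<bar>lagrange_coeff ?x {..<N} w j\<bar> = (\<Prod>i\<in>{..<N} - {j}. \<bar>w - ?x i\<bar> / \<bar>?x j - ?x i\<bar>)"
      by (simp add: lagrange_coeff_def abs_prod)
    also have "\<dots> \<le> (\<Prod>i\<in>{..<N} - {j}. 2 * real N / \<bar>real j - real i\<bar>)"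
    proof (rule prod_mono, intro conjI)
      fix i assume i: "i \<in> {..<N} - {j}"
      have "?x j - ?x i = 2 * a / real N * (real j - real i)" by (simp add: algebra_simps diff_divide_distrib)
      then have "\<bar>?x j - ?x i\<bar> = 2 * a / real N * \<bar>real j - real i\<bar>" using a N by (simp add: abs_mult)
      then have "\<bar>w - ?x i\<bar> / \<bar>?x j - ?x i\<bar> = \<bar>w - ?x i\<bar> / (2 * a / real N * \<bar>real j - real i\<bar>)" by simp
      also have "\<bar>w - y\<bar> \<le> 4 * a" if "a \<le> y" "y \<le> 3 * a" for y using that w a by linarith
      from this[OF x3] i have "\<bar>w - ?x i\<bar> \<le> 4 * a" by blast
      then have "\<bar>w - ?x i\<bar> / (2 * a / real N * \<bar>real j - real i\<bar>) \<le> 4 * a / (2 * a / real N * \<bar>real j - real i\<bar>)"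
        using a by (intro divide_right_mono) auto
      also have "4 * a / (2 * a / real N * \<bar>real j - real i\<bar>) = 2 * real N / \<bar>real j - real i\<bar>"
        using a N by simp
      finally show "\<bar>w - ?x i\<bar> / \<bar>?x j - ?x i\<bar> \<le> 2 * real N / \<bar>real j - real i\<bar>" .
    qed simp
    also have "\<dots> = (2 * real N) ^ (N - 1) / (fact j * fact (N - 1 - j))"
      using j by (simp add: prod_dividef prod_abs_diff_fact)
    finally show ?thesis .
  qed
  then have "(\<Sum>j<N. \<bar>lagrange_coeff ?x {..<N} w j\<bar>) \<le> (\<Sum>j<N. (2 * real N) ^ (N - 1) / (fact j * fact (N - 1 - j)))"
    by (intro sum_mono) auto
  also have "\<dots> = (2 * real N) ^ (N - 1) / fact (N - 1) * (\<Sum>j<N. real ((N - 1) choose j))"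
    unfolding sum_distrib_left
    by (intro sum.cong refl) (subst binomial_fact, auto)
  also have "(\<Sum>j<N. real ((N - 1) choose j)) = 2 ^ (N - 1)"
  proof -
    have "{..<N} = {..N - 1}" using N by auto
    then show ?thesis using choose_row_sum[of "N - 1"] by (metis of_nat_sum of_nat_power of_nat_numeral)
  qed
  also have "(2 * real N) ^ (N - 1) / fact (N - 1) * 2 ^ (N - 1) = (4 * real N) ^ N / fact N / 4"
  proof -
    obtain M where M: "N = Suc M" using N gr0_implies_Suc by blast
    have "(2 * real N) ^ M * 2 ^ M = (4 * real N) ^ M" unfolding power_mult_distrib[symmetric] by simp
    then have "(2 * real N) ^ M / fact M * 2 ^ M = (4 * real N) ^ M / fact M"
      by (simp add: field_simps)
    also have "\<dots> = (4 * real N) ^ N / fact N / 4"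
    proof -
      have 1: "(4 * real N) ^ N = 4 * (real N * (4 * real N) ^ M)"
        by (subst M, subst power_Suc) (simp add: M)
      have 2: "(fact N :: real) = real N * fact M" by (simp add: M)
      show ?thesis unfolding 1 2 using N by simp
    qed
    finally show ?thesis using M by simp
  qed
  also have "(4 * real N) ^ N / fact N / 4 \<le> (4 * real N) ^ N / fact N"
  proof -
    have "A / 4 \<le> A" if "0 \<le> A" for A :: real using that by simp
    moreover have "0 \<le> (4 * real N) ^ N / fact N" by (intro divide_nonneg_nonneg zero_le_power; simp)
    ultimately show ?thesis by blast
  qed
  also have "\<dots> = 4 ^ N * (real N ^ N / fact N)" by (simp add: power_mult_distrib)
  also have "\<dots> \<le> 4 ^ N * exp (real N)" by (intro mult_left_mono power_div_fact_le_exp) auto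
  also have "exp (real N) = exp 1 ^ N" by (simp add: exp_of_nat_mult[symmetric])
  also have "\<dots> \<le> 3 ^ N" using exp_le by (intro power_mono) auto
  finally show ?thesis by (simp add: power_mult_distrib[symmetric])
qed

text \<open>Extrapolation is exact on the Taylor polynomial. What remains is the remainder at
  \<open>w\<close> plus the remainders at the nodes, all at arguments of size at most
  \<open>3 * a\<close>, the latter weighted by coefficients of total size at most
  \<open>12 ^ N\<close>.\<close>

lemma cos_extrapolation:
  fixes a w :: real
  assumes N: "N > 0" and a: "a > 0" and w: "\<bar>w\<bar> \<le> a"
  obtains x l :: "nat \<Rightarrow> real" where "\<And>j. j < N \<Longrightarrow> a \<le> x j" "(\<Sum>j<N. \<bar>l j\<bar>) \<le> 12 ^ N"
    "\<And>y c :: real. \<bar>cos (w * y + c) - (\<Sum>j<N. l j * cos (x j * y + c))\<bar> \<le> (1 + 12 ^ N) * ((3 * a * \<bar>y\<bar>) ^ N / fact N)"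
proof
  let ?x = "\<lambda>j. a + 2 * a / real N * real j"
  let ?l = "lagrange_coeff ?x {..<N} w"
  show "a \<le> ?x j" for j using a N by simp
  show l: "(\<Sum>j<N. \<bar>?l j\<bar>) \<le> 12 ^ N" by (rule lagrange_coeff_uniform_bound[OF assms])
  fix y c :: real
  obtain A where A: "\<And>w. \<bar>cos (w * y + c) - (\<Sum>k<N. A k * w ^ k)\<bar> \<le> \<bar>w * y\<bar> ^ N / fact N"
    using cos_taylor[of y c N] by blast
  let ?E = "(3 * a * \<bar>y\<bar>) ^ N / fact N"
  have R: "\<bar>cos (v * y + c) - (\<Sum>k<N. A k * v ^ k)\<bar> \<le> ?E" if "\<bar>v\<bar> \<le> 3 * a" for v
  proof -
    have "\<bar>v * y\<bar> ^ N / fact N \<le> ?E"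
      using that by (intro divide_right_mono power_mono) (auto simp: abs_mult mult_right_mono)
    with A[of v] show ?thesis by linarith
  qed
  have inj: "inj_on ?x {..<N}" using a N by (auto simp: inj_on_def)
  have exact: "(\<Sum>j<N. ?l j * (\<Sum>k<N. A k * ?x j ^ k)) = (\<Sum>k<N. A k * w ^ k)"
  proof -
    have "(\<Sum>j<N. ?l j * (\<Sum>k<N. A k * ?x j ^ k)) = (\<Sum>k<N. A k * (\<Sum>j<N. ?l j * ?x j ^ k))"
      unfolding sum_distrib_left by (subst sum.swap) (simp add: mult_ac)
    also have "\<dots> = (\<Sum>k<N. A k * w ^ k)" using lagrange_exact[OF inj] by (intro sum.cong) auto
    finally show ?thesis .
  qed
  have eq: "cos (w * y + c) - (\<Sum>j<N. ?l j * cos (?x j * y + c))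
    = (cos (w * y + c) - (\<Sum>k<N. A k * w ^ k)) - (\<Sum>j<N. ?l j * (cos (?x j * y + c) - (\<Sum>k<N. A k * ?x j ^ k)))"
    by (simp add: exact[symmetric] sum_subtractf right_diff_distrib)
  have "\<bar>\<Sum>j<N. ?l j * (cos (?x j * y + c) - (\<Sum>k<N. A k * ?x j ^ k))\<bar> \<le> (\<Sum>j<N. \<bar>?l j\<bar> * ?E)"
  proof (rule order_trans[OF sum_abs], rule sum_mono)
    fix j assume "j \<in> {..<N}"
    then have "\<bar>?x j\<bar> \<le> 3 * a" using a by (auto simp: field_simps)
    from R[OF this] show "\<bar>?l j * (cos (?x j * y + c) - (\<Sum>k<N. A k * ?x j ^ k))\<bar> \<le> \<bar>?l j\<bar> * ?E"
      unfolding abs_mult by (intro mult_left_mono) auto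
  qed
  also have "\<dots> \<le> 12 ^ N * ?E"
    unfolding sum_distrib_right[symmetric] using l a by (intro mult_right_mono) auto
  finally have B: "\<bar>\<Sum>j<N. ?l j * (cos (?x j * y + c) - (\<Sum>k<N. A k * ?x j ^ k))\<bar> \<le> 12 ^ N * ?E" .
  have "\<bar>w\<bar> \<le> 3 * a" using w a by linarith
  note r = R[OF this]
  show "\<bar>cos (w * y + c) - (\<Sum>j<N. ?l j * cos (?x j * y + c))\<bar> \<le> (1 + 12 ^ N) * ?E"
    unfolding eq by (rule order_trans[OF abs_triangle_ineq4 order_trans[OF add_mono[OF r B]]]) (simp only: distrib_right mult_1_left order_refl)
qed

section \<open>Energy in the low spatial modes\<close>

lemma integrable_mult_continuous_bounded:
  fixes f u :: "'a::euclidean_space \<Rightarrow> real"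
  assumes "integrable lborel f" "continuous_on UNIV u" "\<And>x. \<bar>u x\<bar> \<le> 1"
  shows "integrable lborel (\<lambda>x. f x * u x)"
proof (rule Bochner_Integration.integrable_bound[OF assms(1)])
  have "u \<in> borel_measurable lborel" using assms(2) by (simp add: borel_measurable_continuous_onI)
  then show "(\<lambda>x. f x * u x) \<in> borel_measurable lborel"
    using borel_measurable_integrable[OF assms(1)] by (intro borel_measurable_times)
  show "AE x in lborel. norm (f x * u x) \<le> norm (f x)"
    by (rule AE_I2) (simp add: abs_mult mult_left_le assms(3))
qed

text \<open>A product of cosines is an average of plane cosines over all choices of sign of the
  frequencies, so a bound for every sign pattern passes to the product without loss.\<close>

lemma integral_prod_cos_bound:
  fixes f :: "'a::euclidean_space \<Rightarrow> real"
  assumes f: "integrable lborel f"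
    and B: "\<And>\<zeta> \<theta>. (\<And>b. b \<in> Basis \<Longrightarrow> \<bar>\<zeta> \<bullet> b\<bar> = \<bar>\<alpha> b\<bar>) \<Longrightarrow> \<bar>\<integral>x. f x * cos (\<zeta> \<bullet> x + \<theta>) \<partial>lborel\<bar> \<le> B"
  shows "\<bar>\<integral>x. f x * (\<Prod>b\<in>Basis. cos (\<alpha> b * (x \<bullet> b + h))) \<partial>lborel\<bar> \<le> B"
proof -
  \<comment> \<open>Generalized for the induction: the factors indexed by \<open>C\<close> are still
    separate, the others are already merged into the plane phase. The goal is the case where nothing
    is merged and \<open>\<zeta> = 0\<close>.\<close>
  have "\<bar>\<integral>x. f x * (cos (\<zeta> \<bullet> x + \<theta>) * (\<Prod>b\<in>C. cos (\<alpha> b * (x \<bullet> b + h)))) \<partial>lborel\<bar> \<le> B"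
    if "finite C" "C \<subseteq> Basis" "\<And>b. b \<in> C \<Longrightarrow> \<zeta> \<bullet> b = 0" "\<And>b. b \<in> Basis - C \<Longrightarrow> \<bar>\<zeta> \<bullet> b\<bar> = \<bar>\<alpha> b\<bar>" for C \<zeta> \<theta>
    using that
  proof (induction C arbitrary: \<zeta> \<theta> rule: finite_induct)
    case empty
    then show ?case using B by simp
  next
    case (insert c C)
    let ?P = "\<lambda>x. \<Prod>b\<in>C. cos (\<alpha> b * (x \<bullet> b + h))"
    let ?I = "\<lambda>\<zeta> \<theta>. \<integral>x. f x * (cos (\<zeta> \<bullet> x + \<theta>) * ?P x) \<partial>lborel"
    have cB: "c \<in> Basis" using insert.prems by simp
    have int: "integrable lborel (\<lambda>x. f x * (cos (\<zeta> \<bullet> x + \<theta>) * ?P x))" for \<zeta> \<theta>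
    proof (rule integrable_mult_continuous_bounded[OF f])
      show "continuous_on UNIV (\<lambda>x. cos (\<zeta> \<bullet> x + \<theta>) * ?P x)"
        by (intro continuous_intros)
      show "\<bar>cos (\<zeta> \<bullet> x + \<theta>) * ?P x\<bar> \<le> 1" for x
        unfolding abs_mult abs_prod by (intro mult_le_one prod_le_1 prod_nonneg) auto
    qed
    have cc: "c \<bullet> b = (if b = c then 1 else 0)" if "b \<in> Basis" for b
      using that cB by (auto simp: inner_Basis)
    have b1: "\<bar>?I (\<zeta> + e *\<^sub>R c) \<theta>'\<bar> \<le> B" if "\<bar>e\<bar> = \<bar>\<alpha> c\<bar>" for e \<theta>'
    proof (rule insert.IH)
      show "C \<subseteq> Basis" using insert.prems by simp
      show "(\<zeta> + e *\<^sub>R c) \<bullet> b = 0" if "b \<in> C" for b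
      proof -
        have "b \<in> Basis" "b \<noteq> c" using that insert.prems(1) insert.hyps(2) by auto
        then have "c \<bullet> b = 0" using cc[of b] by simp
        moreover have "\<zeta> \<bullet> b = 0" using that insert.prems(2) by blast
        ultimately show ?thesis by (simp add: inner_add_left)
      qed
      show "\<bar>(\<zeta> + e *\<^sub>R c) \<bullet> b\<bar> = \<bar>\<alpha> b\<bar>" if "b \<in> Basis - C" for b
        using that insert.prems cc[of b] \<open>\<bar>e\<bar> = \<bar>\<alpha> c\<bar>\<close> by (cases "b = c") (auto simp: inner_add_left)
    qed
    have "cos (\<zeta> \<bullet> x + \<theta>) * (\<Prod>b\<in>insert c C. cos (\<alpha> b * (x \<bullet> b + h)))
      = (cos ((\<zeta> + \<alpha> c *\<^sub>R c) \<bullet> x + (\<theta> + \<alpha> c * h)) * ?P x + cos ((\<zeta> + (- \<alpha> c) *\<^sub>R c) \<bullet> x + (\<theta> - \<alpha> c * h)) * ?P x) / 2" for x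
    proof -
      have 1: "(\<zeta> + \<alpha> c *\<^sub>R c) \<bullet> x + (\<theta> + \<alpha> c * h) = (\<zeta> \<bullet> x + \<theta>) + \<alpha> c * (x \<bullet> c + h)"
        "(\<zeta> + (- \<alpha> c) *\<^sub>R c) \<bullet> x + (\<theta> - \<alpha> c * h) = (\<zeta> \<bullet> x + \<theta>) - \<alpha> c * (x \<bullet> c + h)"
        by (simp_all add: inner_add_left inner_diff_left inner_commute algebra_simps)
      show ?thesis unfolding 1 cos_add cos_diff using insert.hyps by (simp add: algebra_simps)
    qed
    then have "(\<integral>x. f x * (cos (\<zeta> \<bullet> x + \<theta>) * (\<Prod>b\<in>insert c C. cos (\<alpha> b * (x \<bullet> b + h)))) \<partial>lborel)
      = (\<integral>x. (f x * (cos ((\<zeta> + \<alpha> c *\<^sub>R c) \<bullet> x + (\<theta> + \<alpha> c * h)) * ?P x)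
         + f x * (cos ((\<zeta> + (- \<alpha> c) *\<^sub>R c) \<bullet> x + (\<theta> - \<alpha> c * h)) * ?P x)) / 2 \<partial>lborel)"
      by (simp only: times_divide_eq_right distrib_left)
    also have "\<dots> = (?I (\<zeta> + \<alpha> c *\<^sub>R c) (\<theta> + \<alpha> c * h) + ?I (\<zeta> + (- \<alpha> c) *\<^sub>R c) (\<theta> - \<alpha> c * h)) / 2"
      by (simp only: Bochner_Integration.integral_add[OF int int] integral_divide_zero)
    finally have eq: "(\<integral>x. f x * (cos (\<zeta> \<bullet> x + \<theta>) * (\<Prod>b\<in>insert c C. cos (\<alpha> b * (x \<bullet> b + h)))) \<partial>lborel)
      = (?I (\<zeta> + \<alpha> c *\<^sub>R c) (\<theta> + \<alpha> c * h) + ?I (\<zeta> + (- \<alpha> c) *\<^sub>R c) (\<theta> - \<alpha> c * h)) / 2" .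
    have avg: "\<bar>(x + y) / 2\<bar> \<le> B" if "\<bar>x\<bar> \<le> B" "\<bar>y\<bar> \<le> B" for x y :: real
    proof -
      have "\<bar>(x + y) / 2\<bar> = \<bar>x + y\<bar> / 2" by simp
      also have "\<dots> \<le> (\<bar>x\<bar> + \<bar>y\<bar>) / 2" by (intro divide_right_mono abs_triangle_ineq) simp
      also have "\<dots> \<le> (B + B) / 2" by (intro divide_right_mono add_mono that) simp
      also have "(B + B) / 2 = B" by simp
      finally show ?thesis .
    qed
    show ?case unfolding eq by (rule avg; rule b1; simp)
  qed
  from this[of Basis 0 0] show ?thesis by simp
qed

section \<open>Weak derivatives and the cosine coefficients of the source\<close>

lemma smooth_expr_prod:
  assumes "finite I" "\<And>i. i \<in> I \<Longrightarrow> smooth_expr (f i)"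
  shows "smooth_expr (\<lambda>x. \<Prod>i\<in>I. f i x)"
  using assms by (induction I rule: finite_induct) (auto intro: smooth_expr.const smooth_expr.mult)

lemma smooth_expr_sin_cos_prod: "smooth_expr (sin_cos_prod h j m)"
  unfolding sin_cos_prod_def[abs_def]
proof (rule smooth_expr_prod)
  fix b :: 'a
  have l: "smooth_expr (\<lambda>x::'a. real (m b) * (pi / (2 * h)) * (x \<bullet> b + h))"
    by (intro smooth_expr.mult smooth_expr.const smooth_expr.add smooth_expr.inner)
  show "smooth_expr (\<lambda>x. (if b = j then sin else cos) (real (m b) * (pi / (2 * h)) * (x \<bullet> b + h)))"
    using smooth_expr.sin[OF l] smooth_expr.cos[OF l] by (cases "b = j") simp_all
qed simp

lemma sin_cos_prod_derivative:
  assumes b: "b \<in> Basis" and D: "(sin_cos_prod h b m has_derivative D) (at x)"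
  shows "D b = real (m b) * (pi / (2 * h)) * cos_prod h m x"
proof -
  let ?\<kappa> = "real (m b) * (pi / (2 * h))"
  let ?P = "\<Prod>c\<in>Basis - {b}. cos (real (m c) * (pi / (2 * h)) * (x \<bullet> c + h))"
  have eq: "sin_cos_prod h b m (x + s *\<^sub>R b) = sin (?\<kappa> * (x \<bullet> b + s + h)) * ?P" for s
  proof -
    have "(\<Prod>c\<in>Basis - {b}. (if c = b then sin else cos) (real (m c) * (pi / (2 * h)) * ((x + s *\<^sub>R b) \<bullet> c + h))) = ?P"
      using b by (intro prod.cong) (auto simp: inner_add_left inner_Basis)
    then show ?thesis
      unfolding sin_cos_prod_def by (subst prod.remove[OF finite_Basis b]) (use b in \<open>simp add: inner_add_left\<close>)
  qed
  have "((\<lambda>s. x + s *\<^sub>R b) has_derivative (\<lambda>s. s *\<^sub>R b)) (at 0)" by (auto intro!: derivative_eq_intros)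
  moreover have "(sin_cos_prod h b m has_derivative D) (at (x + 0 *\<^sub>R b))" using D by simp
  ultimately have "((\<lambda>s. sin_cos_prod h b m (x + s *\<^sub>R b)) has_derivative (\<lambda>s. D (s *\<^sub>R b))) (at 0)"
    by (rule has_derivative_compose)
  moreover have "(\<lambda>s. D (s *\<^sub>R b)) = (*) (D b)"
    by (auto simp: fun_eq_iff linear_cmul[OF has_derivative_linear[OF D]])
  ultimately have 1: "((\<lambda>s. sin_cos_prod h b m (x + s *\<^sub>R b)) has_real_derivative D b) (at 0)"
    by (simp add: has_field_derivative_def)
  have "((\<lambda>s. ?\<kappa> * (x \<bullet> b + s + h)) has_real_derivative ?\<kappa>) (at 0)"
  proof -
    have "((\<lambda>s. k * (u + s + h)) has_real_derivative k) (at 0)" for k u :: real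
      by (auto intro!: derivative_eq_intros)
    then show ?thesis .
  qed
  then have "((\<lambda>s. sin (?\<kappa> * (x \<bullet> b + s + h)) * ?P) has_real_derivative (cos (?\<kappa> * (x \<bullet> b + 0 + h)) * ?\<kappa>) * ?P) (at 0)"
    by (intro DERIV_cmult_right DERIV_chain2[OF DERIV_sin])
  then have "D b = (cos (?\<kappa> * (x \<bullet> b + 0 + h)) * ?\<kappa>) * ?P"
    using 1 unfolding eq by (rule DERIV_unique[rotated])
  also have "\<dots> = ?\<kappa> * cos_prod h m x"
    unfolding cos_prod_def by (subst prod.remove[OF finite_Basis b]) simp
  finally show ?thesis .
qed

lemma pt_basis_cases:
  assumes "b \<in> (Basis :: pt set)"
  obtains j where "b = (axis j 1, 0)" | "b = (0, 1)"
  using assms by (auto simp: Basis_prod_def Basis_vec_def)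

lemma sderiv_eq_frechet:
  assumes "(f has_derivative D) (at p)" shows "sderiv j f p = D (axis j 1, 0)"
proof -
  have "((\<lambda>y. (y, snd p)) has_derivative (\<lambda>h. (h, 0))) (at (fst p))"
    by (auto intro!: derivative_eq_intros)
  moreover have "(f has_derivative D) (at (fst p, snd p))" using assms by simp
  ultimately have "((\<lambda>y. f (y, snd p)) has_derivative (\<lambda>h. D (h, 0))) (at (fst p))"
    by (rule has_derivative_compose)
  then show ?thesis unfolding sderiv_def by (simp add: frechet_derivative_at[symmetric])
qed

lemma tderiv_eq_frechet:
  assumes "(f has_derivative D) (at p)" shows "tderiv f p = D (0, 1)"
proof -
  have "((\<lambda>t. (fst p, t)) has_derivative (\<lambda>h. (0, h))) (at (snd p))"
    by (auto intro!: derivative_eq_intros)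
  moreover have "(f has_derivative D) (at (fst p, snd p))" using assms by simp
  ultimately have "((\<lambda>t. f (fst p, t)) has_derivative (\<lambda>h. D (0, h))) (at (snd p))"
    by (rule has_derivative_compose)
  then show ?thesis unfolding tderiv_def by (simp add: frechet_derivative_at[symmetric])
qed

lemma L2_bounded_support_integrable:
  fixes F :: "'a::euclidean_space \<Rightarrow> 'b::euclidean_space"
  assumes F: "F \<in> borel_measurable borel" and F2: "integrable lborel (\<lambda>p. (norm (F p))\<^sup>2)"
    and K: "bounded K" "K \<in> sets borel" "\<And>p. F p \<noteq> 0 \<Longrightarrow> p \<in> K"
  shows "integrable lborel F"
proof (rule Bochner_Integration.integrable_bound)
  show "integrable lborel (\<lambda>p. indicator K p + (norm (F p))\<^sup>2)"
    using emeasure_bounded_finite[OF K(1)] K(2)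
    by (intro Bochner_Integration.integrable_add F2 integrable_real_indicator) auto
  show "AE p in lborel. norm (F p) \<le> norm (indicator K p + (norm (F p))\<^sup>2)"
  proof (rule AE_I2)
    fix p
    have "norm (F p) \<le> 1 + (norm (F p))\<^sup>2"
      using sum_squares_bound[of "norm (F p)" 1] norm_ge_zero[of "F p"] by (simp del: norm_ge_zero)
    then show "norm (F p) \<le> norm (indicator K p + (norm (F p))\<^sup>2)"
      using K(3)[of p] by (cases "F p = 0") auto
  qed
qed (use F in simp)

text \<open>Testing the weak derivatives with sine products relates their sine coefficients to the
  cosine coefficients of \<open>F\<close>. Admissible test functions live in positive time, hence
  the factor \<open>cut\<close>; its derivatives never enter, because \<open>cut\<close> is locally
  constant wherever \<open>F\<close> is nonzero. The factor 3 counts the components of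
  \<open>F\<close>.\<close>

lemma low_frequency_energy_bound:
  assumes R: "R > 0" and T0: "T0 > 0" and \<rho>: "\<rho> > 0" and H: "H4H1_bound F M"
    and supp: "closure {p. F p \<noteq> 0} \<subseteq> ball 0 R \<times> {0<..<T0}"
    and low: "\<And>\<zeta> \<theta>. (\<And>b. b \<in> Basis \<Longrightarrow> \<bar>\<zeta> \<bullet> b\<bar> \<le> \<rho>) \<Longrightarrow> norm (\<integral>p. cos (\<zeta> \<bullet> p + \<theta>) *\<^sub>R F p \<partial>lborel) \<le> B"
  shows "L2sq F \<le> 3 * ((2 * \<rho> / pi + 1 / (R + 2 * T0)) ^ 4 * B\<^sup>2) + M\<^sup>2 / \<rho>\<^sup>2"
proof -
  obtain D :: "nat \<Rightarrow> pt \<Rightarrow> real^3" and G :: "nat \<Rightarrow> 3 \<Rightarrow> pt \<Rightarrow> real^3" where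
    D0: "D 0 = F" and L2D: "\<And>k. k \<le> 4 \<Longrightarrow> L2_pos (D k)" and L2G: "\<And>k j. k \<le> 4 \<Longrightarrow> L2_pos (G k j)"
    and wG: "\<And>k j. k \<le> 4 \<Longrightarrow> weak_sderiv j (D k) (G k j)" and wD: "\<And>k. k < 4 \<Longrightarrow> weak_tderiv (D k) (D (Suc k))"
    and sumM: "(\<Sum>k\<le>4. L2sq (D k) + (\<Sum>j\<in>UNIV. L2sq (G k j))) \<le> M\<^sup>2"
    using H unfolding H4H1_bound_def by blast
  \<comment> \<open>Large enough for the cube to contain the support of \<open>cut\<close>, which
    reaches up to time \<open>T0 + \<tau> / 4\<close>.\<close>
  define h where "h = R + 2 * T0"
  have h: "h > 0" using R T0 by (simp add: h_def)
  let ?M = "restrict_space lborel (cube h :: pt set)"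
  obtain r \<tau>' where r: "0 \<le> r" "r < R" "0 < \<tau>'" "\<And>p. F p \<noteq> 0 \<Longrightarrow> norm (fst p) \<le> r \<and> \<tau>' \<le> snd p \<and> snd p < T0"
    by (rule compact_support_margins[OF R T0 supp], rule that)
  \<comment> \<open>For \<open>F = 0\<close> the margin \<open>\<tau>'\<close> is unrelated to
    \<open>T0\<close>; the minimum restores \<open>\<tau> \<le> T0\<close>.\<close>
  define \<tau> where "\<tau> = min \<tau>' T0"
  have \<tau>: "0 < \<tau>" "\<tau> \<le> T0" using r T0 by (auto simp: \<tau>_def)
  have \<tau>F: "\<tau> \<le> snd p" if "F p \<noteq> 0" for p using r(4)[OF that] by (simp add: \<tau>_def)
  \<comment> \<open>Strictly between \<open>r\<close> and \<open>R\<close>, so that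
    \<open>cut\<close> equals 1 on an open set containing all points where \<open>F\<close> is
    nonzero.\<close>
  define r' where "r' = (r + R) / 2"
  have r': "r < r'" "r' < R" "0 \<le> r'" using r by (auto simp: r'_def)
  define \<delta> where "\<delta> = R\<^sup>2 - r'\<^sup>2"
  have \<delta>: "\<delta> > 0" using r' by (auto simp: \<delta>_def intro!: power_strict_mono)
  \<comment> \<open>In time the plateau is \<open>[\<tau> / 2, T0]\<close> with flanks of width
    \<open>\<tau> / 4\<close>, so the support stays at times \<open>\<ge> \<tau> / 4\<close>, away
    from 0.\<close>
  define cut where "cut = (\<lambda>p::pt. step (radial_arg R \<delta> p) * window (\<tau> / 4) (- (\<tau> / 2)) T0 (phase 0 p))"
  define U where "U = (ball 0 r' \<times> {\<tau> / 2<..<T0} :: pt set)"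
  have U: "open U" unfolding U_def by (intro open_Times) auto
  have FU: "p \<in> U" if "F p \<noteq> 0" for p
    using r(4)[OF that] \<tau>F[OF that] r'(1) \<tau>(1) by (auto simp: U_def mem_Times_iff)
  have sc: "smooth_expr cut" unfolding cut_def
    by (intro smooth_expr.mult smooth_expr_step smooth_expr_radial_arg smooth_expr_compose[OF smooth_expr_window] smooth_expr_phase)
  have \<tau>4: "\<tau> / 4 > 0" using \<tau> by simp
  have c1: "cut p = 1" if "p \<in> U" for p
  proof -
    have "norm (fst p) < r'" using that by (auto simp: U_def mem_Times_iff)
    then have "(norm (fst p))\<^sup>2 \<le> r'\<^sup>2" by (intro power_mono) auto
    then have "1 \<le> radial_arg R \<delta> p"
      using \<delta> by (simp add: radial_arg_def power2_norm_eq_inner pos_le_divide_eq) (simp add: \<delta>_def)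
    moreover have "window (\<tau> / 4) (- (\<tau> / 2)) T0 (phase 0 p) = 1"
      using that by (intro window_props(1)[OF \<tau>4]) (auto simp: phase_def U_def mem_Times_iff)
    ultimately show ?thesis by (simp add: cut_def step_1)
  qed
  have cb: "0 \<le> cut p" "cut p \<le> 1" for p
    using step_nonneg step_le_1 window_props(4,5)[OF \<tau>4] by (auto simp: cut_def intro: mult_le_one)
  define K where "K = (cball 0 R \<times> {\<tau> / 4..T0 + \<tau> / 4} :: pt set)"
  have cK: "p \<in> K" if "cut p \<noteq> 0" for p
  proof -
    have "step (radial_arg R \<delta> p) \<noteq> 0" "window (\<tau> / 4) (- (\<tau> / 2)) T0 (snd p) \<noteq> 0"
      using that by (auto simp: cut_def phase_def)
    then have "\<not> radial_arg R \<delta> p \<le> 0" "\<not> (T0 + \<tau> / 4 \<le> snd p \<or> snd p \<le> - (- (\<tau> / 2)) - \<tau> / 4)"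
      using step_0[of "radial_arg R \<delta> p"] window_props(2)[OF \<tau>4, of T0 "snd p" "- (\<tau> / 2)"]
        window_props(2)[OF \<tau>4, of "snd p" T0 "- (\<tau> / 2)"] by argo+
    then have "0 < radial_arg R \<delta> p" "\<tau> / 4 < snd p" "snd p < T0 + \<tau> / 4" by auto
    moreover from this have "(norm (fst p))\<^sup>2 < R\<^sup>2"
      using \<delta> by (simp add: radial_arg_def power2_norm_eq_inner zero_less_divide_iff)
    then have "norm (fst p) < R" using R by (intro power_less_imp_less_base[of _ 2 R]) auto
    ultimately show ?thesis by (auto simp: K_def mem_Times_iff)
  qed
  have closedK: "closed K" unfolding K_def by (intro closed_Times) auto
  have bK: "bounded K" unfolding K_def by (intro bounded_Times) auto
  have Kcube: "p \<in> cube h" if "p \<in> K" for p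
    unfolding mem_cube
  proof
    fix b :: pt assume b: "b \<in> Basis"
    have p: "norm (fst p) \<le> R" "\<tau> / 4 \<le> snd p" "snd p \<le> T0 + \<tau> / 4" using that by (auto simp: K_def mem_Times_iff)
    have "\<bar>p \<bullet> b\<bar> \<le> h" using b
    proof (cases rule: pt_basis_cases)
      case (1 j)
      then have "\<bar>p \<bullet> b\<bar> = \<bar>fst p $ j\<bar>" by (cases p) (simp add: inner_axis)
      also have "\<dots> \<le> norm (fst p)" by (rule component_le_norm_cart)
      finally show ?thesis using p T0 by (simp add: h_def)
    next
      case 2
      then have "\<bar>p \<bullet> b\<bar> = \<bar>snd p\<bar>" by (cases p) simp
      then show ?thesis using p \<tau> T0 R by (simp add: h_def)
    qed
    then show "- h \<le> p \<bullet> b \<and> p \<bullet> b \<le> h" by auto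
  qed
  have test: "test_fun_pos (\<lambda>p. cut p * g p)" if "smooth_expr g" for g
    unfolding test_fun_pos_def
  proof
    have sub: "{p. cut p * g p \<noteq> 0} \<subseteq> K" using cK by auto
    show "test_fun (\<lambda>p. cut p * g p)"
      by (rule test_fun_smooth_expr[OF smooth_expr.mult[OF sc that] bounded_subset[OF bK sub]])
    have "closure {p. cut p * g p \<noteq> 0} \<subseteq> K" by (rule closure_minimal[OF sub closedK])
    also have "K \<subseteq> {p. 0 < snd p}" using \<tau>(1) by (auto simp: K_def)
    finally show "closure {p. cut p * g p \<noteq> 0} \<subseteq> {p. 0 < snd p}" .
  qed
  \<comment> \<open>The three spatial weak derivatives and the temporal one, indexed by the basis
    vectors of space-time as the tail bound expects them.\<close>
  define gd where "gd = (\<lambda>b::pt. if b = (0, 1) then D 1 else G 0 (THE j. b = (axis j 1, 0)))"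
  have gdt: "gd (0, 1) = D 1" by (simp add: gd_def)
  have gds: "gd (axis j 1, 0) = G 0 j" for j
  proof -
    have "(THE i. (axis j (1::real), 0::real) = (axis i 1, 0)) = j" by (rule the_equality) (auto simp: axis_eq_axis)
    then show ?thesis by (simp add: gd_def)
  qed
  have L2gd: "L2_pos (gd b)" if "b \<in> Basis" for b
    using that L2D[of 1] L2G[of 0] by (cases rule: pt_basis_cases) (auto simp: gdt gds)
  have L2F: "L2_pos F" using L2D[of 0] by (simp add: D0)
  have Fm: "F \<in> borel_measurable borel" and F2: "integrable lborel (\<lambda>p. (norm (F p))\<^sup>2)"
    using L2F by (auto simp: L2_pos_def)
  have FK: "p \<in> K" if "F p \<noteq> 0" for p using c1[OF FU[OF that]] cK by simp
  have Fint: "integrable lborel F"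
    by (rule L2_bounded_support_integrable[OF Fm F2 bK _ FK]) (use closedK in auto)
  \<comment> \<open>On \<open>U\<close> the product \<open>cut * g\<close> has the derivative of
    \<open>g\<close>, and off \<open>U\<close> the factor \<open>F\<close> is 0, so on the left the
    cutoff disappears.\<close>
  have weak: "(\<integral>p. Dg p b *\<^sub>R F p \<partial>lborel) = - (\<integral>p. (cut p * g p) *\<^sub>R gd b p \<partial>lborel)"
    if b: "b \<in> Basis" and g: "smooth_expr g" and Dg: "\<And>p. (g has_derivative Dg p) (at p)" for b g Dg
  proof -
    have DU: "((\<lambda>p. cut p * g p) has_derivative Dg p) (at p)" if "p \<in> U" for p
      by (rule has_derivative_transform_within_open[OF Dg U that]) (simp add: c1)
    show ?thesis using b
    proof (cases rule: pt_basis_cases)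
      case (1 j)
      have eq: "sderiv j (\<lambda>p. cut p * g p) p *\<^sub>R F p = Dg p b *\<^sub>R F p" for p
        using sderiv_eq_frechet[OF DU[OF FU]] 1 by (cases "F p = 0") auto
      have "weak_sderiv j F (G 0 j)" using wG[of 0 j] by (simp add: D0)
      then have "(\<integral>p. sderiv j (\<lambda>p. cut p * g p) p *\<^sub>R F p \<partial>lborel) = - (\<integral>p. (cut p * g p) *\<^sub>R G 0 j p \<partial>lborel)"
        using test[OF g] unfolding weak_sderiv_def by blast
      then show ?thesis by (simp only: eq 1 gds)
    next
      case 2
      have eq: "tderiv (\<lambda>p. cut p * g p) p *\<^sub>R F p = Dg p b *\<^sub>R F p" for p
        using tderiv_eq_frechet[OF DU[OF FU]] 2 by (cases "F p = 0") auto
      have "weak_tderiv F (D 1)" using wD[of 0] by (simp add: D0)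
      then have "(\<integral>p. tderiv (\<lambda>p. cut p * g p) p *\<^sub>R F p \<partial>lborel) = - (\<integral>p. (cut p * g p) *\<^sub>R D 1 p \<partial>lborel)"
        using test[OF g] unfolding weak_tderiv_def by blast
      then show ?thesis by (simp only: eq 2 gdt)
    qed
  qed
  have restr: "integrable ?M u" if "integrable lborel u" for u :: "pt \<Rightarrow> real"
    by (subst integrable_restrict_space, simp, rule integrable_mult_indicator[OF _ that], simp)
  have restrI: "integral\<^sup>L ?M u = integral\<^sup>L lborel u" if "\<And>p. p \<notin> cube h \<Longrightarrow> u p = 0" for u :: "pt \<Rightarrow> real"
    by (subst integral_restrict_space) (auto intro!: Bochner_Integration.integral_cong simp: indicator_def that)
  have nth2: "integrable lborel (\<lambda>p. (u p $ k)\<^sup>2)"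
    if "u \<in> borel_measurable borel" "integrable lborel (\<lambda>p. (norm (u p))\<^sup>2)" for u :: "pt \<Rightarrow> real^3" and k
  proof (rule Bochner_Integration.integrable_bound[OF that(2)])
    have "(\<lambda>p. u p $ k) \<in> borel_measurable borel"
      by (rule measurable_compose[OF that(1)]) (intro borel_measurable_continuous_onI continuous_intros)
    then show "(\<lambda>p. (u p $ k)\<^sup>2) \<in> borel_measurable lborel" by simp
    show "AE p in lborel. norm ((u p $ k)\<^sup>2) \<le> norm ((norm (u p))\<^sup>2)"
      by (rule AE_I2) (simp add: abs_le_square_iff[symmetric] component_le_norm_cart)
  qed
  have L2sum: "L2sq u = (\<Sum>k\<in>UNIV. \<integral>p. (u p $ k)\<^sup>2 \<partial>lborel)"
    if "u \<in> borel_measurable borel" "integrable lborel (\<lambda>p. (norm (u p))\<^sup>2)" for u :: "pt \<Rightarrow> real^3"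
  proof -
    have "L2sq u = (\<integral>p. (\<Sum>k\<in>UNIV. (u p $ k)\<^sup>2) \<partial>lborel)"
      unfolding L2sq_def power2_norm_eq_inner inner_vec_def by (simp add: power2_eq_square)
    then show ?thesis using nth2[OF that] by simp
  qed
  have gdm: "gd b \<in> borel_measurable borel" "integrable lborel (\<lambda>p. (norm (gd b p))\<^sup>2)" if "b \<in> Basis" for b
    using L2gd[OF that] by (auto simp: L2_pos_def)
  have cutm [measurable]: "cut \<in> borel_measurable borel"
    by (intro borel_measurable_continuous_onI smooth_expr_continuous sc)
  have scp [measurable]: "sin_cos_prod h b m \<in> borel_measurable borel" for b :: pt and m
    by (rule borel_measurable_sin_cos_prod)
  have nthm: "(\<lambda>p. u p $ k) \<in> borel_measurable borel" if "u \<in> borel_measurable borel" for u :: "pt \<Rightarrow> real^3" and k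
    by (rule measurable_compose[OF that]) (intro borel_measurable_continuous_onI continuous_intros)
  have Fk: "integrable lborel (\<lambda>p. F p $ k)" for k
    by (rule integrable_bounded_linear[OF bounded_linear_vec_nth Fint])
  have ccp: "continuous_on UNIV (cos_prod h m)" and acp: "\<bar>cos_prod h m p\<bar> \<le> 1" for m :: "pt \<Rightarrow> nat" and p
    using continuous_on_sin_cos_prod[of UNIV h 0 m] abs_sin_cos_prod_le[of h 0 m p] by (simp_all add: sin_cos_prod_0)
  have coeff: "\<bar>\<integral>p. (cut p * gd b p $ k) * sin_cos_prod h b m p \<partial>?M\<bar>
      = real (m b) * (pi / (2 * h)) * \<bar>\<integral>p. F p $ k * cos_prod h m p \<partial>?M\<bar>" if b: "b \<in> Basis" for b k m
  proof -
    let ?s = "sin_cos_prod h b m" and ?\<kappa> = "real (m b) * (pi / (2 * h))"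
    have Ds: "(?s has_derivative frechet_derivative ?s (at p)) (at p)" for p
      by (rule smooth_expr_has_derivative[OF smooth_expr_sin_cos_prod])
    have W: "(\<integral>p. (?\<kappa> * cos_prod h m p) *\<^sub>R F p \<partial>lborel) = - (\<integral>p. (cut p * ?s p) *\<^sub>R gd b p \<partial>lborel)"
      using weak[OF b smooth_expr_sin_cos_prod Ds] by (simp only: sin_cos_prod_derivative[OF b Ds])
    have i1: "integrable lborel (\<lambda>p. (?\<kappa> * cos_prod h m p) *\<^sub>R F p)"
    proof (rule Bochner_Integration.integrable_bound[OF Bochner_Integration.integrable_scaleR_right[OF Fint, of ?\<kappa>]])
      have "cos_prod h m \<in> borel_measurable borel" using ccp by (rule borel_measurable_continuous_onI)
      then show "(\<lambda>p. (?\<kappa> * cos_prod h m p) *\<^sub>R F p) \<in> borel_measurable lborel"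
        using Fm by (intro borel_measurable_scaleR borel_measurable_times) auto
      show "AE p in lborel. norm ((?\<kappa> * cos_prod h m p) *\<^sub>R F p) \<le> norm (?\<kappa> *\<^sub>R F p)"
        unfolding norm_scaleR abs_mult[of ?\<kappa>]
        using acp by (intro AE_I2 mult_right_mono mult_left_le) auto
    qed
    have i2: "integrable lborel (\<lambda>p. (cut p * ?s p) *\<^sub>R gd b p)"
    proof (rule L2_bounded_support_integrable[OF _ _ bK])
      show m: "(\<lambda>p. (cut p * ?s p) *\<^sub>R gd b p) \<in> borel_measurable borel"
        using gdm[OF b] by (intro borel_measurable_scaleR borel_measurable_times cutm scp)
      show "integrable lborel (\<lambda>p. (norm ((cut p * ?s p) *\<^sub>R gd b p))\<^sup>2)"
      proof (rule Bochner_Integration.integrable_bound[OF gdm(2)[OF b]])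
        show "(\<lambda>p. (norm ((cut p * ?s p) *\<^sub>R gd b p))\<^sup>2) \<in> borel_measurable lborel"
          unfolding measurable_lborel2
          by (rule borel_measurable_power[OF measurable_compose[OF m borel_measurable_norm]])
        show "AE p in lborel. norm ((norm ((cut p * ?s p) *\<^sub>R gd b p))\<^sup>2) \<le> norm ((norm (gd b p))\<^sup>2)"
        proof (rule AE_I2)
          fix p
          have "\<bar>cut p * ?s p\<bar> \<le> 1"
            unfolding abs_mult using cb[of p] abs_sin_cos_prod_le[of h b m p] by (intro mult_le_one) auto
          then have "\<bar>cut p * ?s p\<bar> * norm (gd b p) \<le> 1 * norm (gd b p)" by (intro mult_right_mono) auto
          then show "norm ((norm ((cut p * ?s p) *\<^sub>R gd b p))\<^sup>2) \<le> norm ((norm (gd b p))\<^sup>2)"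
            by (simp add: abs_le_square_iff[symmetric])
        qed
      qed
    qed (use closedK cK in auto)
    have "(\<integral>p. (?\<kappa> * cos_prod h m p) *\<^sub>R F p \<partial>lborel) $ k = ?\<kappa> * (\<integral>p. F p $ k * cos_prod h m p \<partial>lborel)"
      unfolding integral_bounded_linear[OF bounded_linear_vec_nth i1, symmetric] by (simp add: mult_ac)
    moreover have "(\<integral>p. (cut p * ?s p) *\<^sub>R gd b p \<partial>lborel) $ k = (\<integral>p. (cut p * gd b p $ k) * ?s p \<partial>lborel)"
      unfolding integral_bounded_linear[OF bounded_linear_vec_nth i2, symmetric] by (simp add: mult_ac)
    ultimately have "\<bar>\<integral>p. (cut p * gd b p $ k) * ?s p \<partial>lborel\<bar> = ?\<kappa> * \<bar>\<integral>p. F p $ k * cos_prod h m p \<partial>lborel\<bar>"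
      using arg_cong[OF W, of "\<lambda>v. \<bar>v $ k\<bar>"] h by (simp add: abs_mult)
    moreover have "(\<integral>p. (cut p * gd b p $ k) * ?s p \<partial>?M) = (\<integral>p. (cut p * gd b p $ k) * ?s p \<partial>lborel)"
      by (rule restrI) (use cK Kcube in auto)
    moreover have "(\<integral>p. F p $ k * cos_prod h m p \<partial>?M) = (\<integral>p. F p $ k * cos_prod h m p \<partial>lborel)"
      by (rule restrI) (use FK Kcube in force)
    ultimately show ?thesis by (simp only:)
  qed
  have lowk: "\<bar>\<integral>p. F p $ k * cos_prod h m p \<partial>?M\<bar> \<le> B"
    if m: "\<And>b. b \<in> Basis \<Longrightarrow> real (m b) * (pi / (2 * h)) \<le> \<rho>" for k and m :: "pt \<Rightarrow> nat"
  proof -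
    have "(\<integral>p. F p $ k * cos_prod h m p \<partial>?M) = (\<integral>p. F p $ k * cos_prod h m p \<partial>lborel)"
      by (rule restrI) (use FK Kcube in force)
    moreover have "\<bar>\<integral>p. F p $ k * (\<Prod>b\<in>Basis. cos (real (m b) * (pi / (2 * h)) * (p \<bullet> b + h))) \<partial>lborel\<bar> \<le> B"
    proof (rule integral_prod_cos_bound[OF Fk])
      fix \<zeta> :: pt and \<theta>
      assume z: "\<And>b. b \<in> Basis \<Longrightarrow> \<bar>\<zeta> \<bullet> b\<bar> = \<bar>real (m b) * (pi / (2 * h))\<bar>"
      have "norm (\<integral>p. cos (\<zeta> \<bullet> p + \<theta>) *\<^sub>R F p \<partial>lborel) \<le> B"
        by (rule low) (use z m h in simp)
      moreover have "(\<integral>p. F p $ k * cos (\<zeta> \<bullet> p + \<theta>) \<partial>lborel) = (\<integral>p. cos (\<zeta> \<bullet> p + \<theta>) *\<^sub>R F p \<partial>lborel) $ k"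
        unfolding integral_bounded_linear[OF bounded_linear_vec_nth integrable_cos_scaleR[OF Fint], symmetric]
        by (simp add: mult.commute)
      ultimately show "\<bar>\<integral>p. F p $ k * cos (\<zeta> \<bullet> p + \<theta>) \<partial>lborel\<bar> \<le> B"
        using component_le_norm_cart[of "\<integral>p. cos (\<zeta> \<bullet> p + \<theta>) *\<^sub>R F p \<partial>lborel" k] by simp
    qed
    ultimately show ?thesis by (simp add: cos_prod_def)
  qed
  let ?c = "(2 * \<rho> / pi + 1 / h) ^ 4 * B\<^sup>2"
  have comp: "(\<integral>p. (F p $ k)\<^sup>2 \<partial>lborel) \<le> ?c + (\<Sum>b\<in>Basis. \<integral>p. (gd b p $ k)\<^sup>2 \<partial>lborel) / \<rho>\<^sup>2" for k
  proof -
    have cut2: "(cut p * gd b p $ k)\<^sup>2 \<le> (gd b p $ k)\<^sup>2" for b p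
      using cb[of p] by (simp add: abs_le_square_iff[symmetric] abs_mult mult_left_le_one_le)
    have ig: "integrable lborel (\<lambda>p. (cut p * gd b p $ k)\<^sup>2)" if b: "b \<in> Basis" for b
      by (rule Bochner_Integration.integrable_bound[OF nth2[OF gdm[OF b], of k]])
         (use cut2 nthm[OF gdm(1)[OF b]] in \<open>auto intro!: borel_measurable_power borel_measurable_times\<close>)
    have "(\<integral>p. (F p $ k)\<^sup>2 \<partial>lborel) = (\<integral>p. (F p $ k)\<^sup>2 \<partial>?M)"
      by (rule restrI[symmetric]) (use FK Kcube in force)
    also have "\<dots> \<le> (2 * \<rho> / pi + 1 / h) ^ DIM(pt) * B\<^sup>2 +
       (\<Sum>b\<in>Basis. \<integral>p. (cut p * gd b p $ k)\<^sup>2 \<partial>?M) / \<rho>\<^sup>2"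
      by (rule cos_series_tail_bound[OF h \<rho>])
         (use coeff lowk nthm[OF Fm] nthm[OF gdm(1)] nth2[OF Fm F2] ig in \<open>auto intro!: restr borel_measurable_times\<close>)
    also have "(\<Sum>b\<in>Basis. \<integral>p. (cut p * gd b p $ k)\<^sup>2 \<partial>?M) \<le> (\<Sum>b\<in>Basis. \<integral>p. (gd b p $ k)\<^sup>2 \<partial>lborel)"
    proof (rule sum_mono)
      fix b :: pt assume b: "b \<in> Basis"
      have "(\<integral>p. (cut p * gd b p $ k)\<^sup>2 \<partial>?M) = (\<integral>p. (cut p * gd b p $ k)\<^sup>2 \<partial>lborel)"
        by (rule restrI) (use cK Kcube in auto)
      also have "\<dots> \<le> (\<integral>p. (gd b p $ k)\<^sup>2 \<partial>lborel)"
        by (rule Bochner_Integration.integral_mono[OF ig[OF b] nth2[OF gdm[OF b]] cut2])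
      finally show "(\<integral>p. (cut p * gd b p $ k)\<^sup>2 \<partial>?M) \<le> (\<integral>p. (gd b p $ k)\<^sup>2 \<partial>lborel)" .
    qed
    finally show ?thesis by (simp add: divide_right_mono)
  qed
  have "L2sq F \<le> (\<Sum>k\<in>(UNIV::3 set). ?c + (\<Sum>b\<in>Basis. \<integral>p. (gd b p $ k)\<^sup>2 \<partial>lborel) / \<rho>\<^sup>2)"
    unfolding L2sum[OF Fm F2] by (intro sum_mono comp)
  also have "\<dots> = 3 * ?c + (\<Sum>k\<in>UNIV. \<Sum>b\<in>Basis. \<integral>p. (gd b p $ k)\<^sup>2 \<partial>lborel) / \<rho>\<^sup>2"
    by (simp add: sum.distrib sum_divide_distrib)
  also have "(\<Sum>k\<in>UNIV. \<Sum>b\<in>Basis. \<integral>p. (gd b p $ k)\<^sup>2 \<partial>lborel) = (\<Sum>b\<in>Basis. L2sq (gd b))"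
    by (subst sum.swap) (intro sum.cong refl L2sum[symmetric] gdm)
  also have "\<dots> = (\<Sum>j\<in>UNIV. L2sq (G 0 j)) + L2sq (D 1)"
  proof -
    have B: "(Basis::pt set) = insert (0, 1) (range (\<lambda>j. (axis j 1, 0)))"
      by (auto simp: Basis_prod_def Basis_vec_def)
    have inj: "inj (\<lambda>j::3. (axis j (1::real), 0::real))" by (auto simp: inj_on_def axis_eq_axis)
    have "(\<Sum>b\<in>Basis. L2sq (gd b)) = L2sq (gd (0, 1)) + (\<Sum>b\<in>range (\<lambda>j. (axis j 1, 0)). L2sq (gd b))"
      unfolding B by (rule sum.insert) auto
    then show ?thesis unfolding sum.reindex[OF inj] o_def gds gdt by simp
  qed
  also have "\<dots> \<le> M\<^sup>2"
  proof -
    have nn: "0 \<le> L2sq u" for u by (simp add: L2sq_def)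
    have "(\<Sum>k\<in>{0, 1}. L2sq (D k) + (\<Sum>j\<in>UNIV. L2sq (G k j))) \<le> (\<Sum>k\<le>4. L2sq (D k) + (\<Sum>j\<in>UNIV. L2sq (G k j)))"
      by (intro sum_mono2) (auto intro!: add_nonneg_nonneg sum_nonneg nn)
    moreover have "0 \<le> L2sq (D 0)" "0 \<le> (\<Sum>j\<in>UNIV. L2sq (G 1 j))" by (auto intro!: sum_nonneg nn)
    ultimately show ?thesis using sumM by simp
  qed
  finally show ?thesis by (simp add: h_def divide_right_mono)
qed

section \<open>The estimate at a fixed cutoff\<close>

lemma extrapolated_fourier_bound:
  fixes F :: "pt \<Rightarrow> real^3"
  assumes F: "integrable lborel F" and T0: "T0 > 0" and a: "a > 0" and N: "N > 0"
    and supp: "\<And>p. F p \<noteq> 0 \<Longrightarrow> \<bar>snd p\<bar> \<le> T0"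
    and high: "\<And>w \<theta>. a \<le> w \<Longrightarrow> norm (\<integral>p. cos ((\<xi>, w) \<bullet> p + \<theta>) *\<^sub>R F p \<partial>lborel) \<le> \<delta>"
    and w: "\<bar>w\<bar> \<le> a"
  shows "norm (\<integral>p. cos ((\<xi>, w) \<bullet> p + \<theta>) *\<^sub>R F p \<partial>lborel)
    \<le> 12 ^ N * \<delta> + (1 + 12 ^ N) * ((3 * a * T0) ^ N / fact N) * (\<integral>p. norm (F p) \<partial>lborel)"
proof -
  obtain x l where x: "\<And>j. j < N \<Longrightarrow> a \<le> x j" and l: "(\<Sum>j<N. \<bar>l j\<bar>) \<le> 12 ^ N"
    and ex: "\<And>y c. \<bar>cos (w * y + c) - (\<Sum>j<N. l j * cos (x j * y + c))\<bar> \<le> (1 + 12 ^ N) * ((3 * a * \<bar>y\<bar>) ^ N / fact N)"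
    by (rule cos_extrapolation[OF N a w], rule that)
  let ?E = "(1 + 12 ^ N) * ((3 * a * T0) ^ N / fact N)"
  let ?X = "\<lambda>w. \<integral>p. cos ((\<xi>, w) \<bullet> p + \<theta>) *\<^sub>R F p \<partial>lborel"
  \<comment> \<open>The extrapolation formula is used pointwise under the integral, with time as
    \<open>y\<close> and \<open>\<xi> \<bullet> x + \<theta>\<close> as \<open>c\<close>; the
    bounded time support of \<open>F\<close> makes the error uniform.\<close>
  let ?e = "\<lambda>p. cos ((\<xi>, w) \<bullet> p + \<theta>) - (\<Sum>j<N. l j * cos ((\<xi>, x j) \<bullet> p + \<theta>))"
  note int = integrable_cos_scaleR[OF F]
  have diff: "?X w - (\<Sum>j<N. l j *\<^sub>R ?X (x j)) = (\<integral>p. ?e p *\<^sub>R F p \<partial>lborel)"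
    and ie: "integrable lborel (\<lambda>p. ?e p *\<^sub>R F p)"
  proof -
    have eq: "?e p *\<^sub>R F p = cos ((\<xi>, w) \<bullet> p + \<theta>) *\<^sub>R F p - (\<Sum>j<N. l j *\<^sub>R (cos ((\<xi>, x j) \<bullet> p + \<theta>) *\<^sub>R F p))" for p
      by (simp add: scaleR_left_diff_distrib scaleR_sum_left)
    have ij: "integrable lborel (\<lambda>p. l j *\<^sub>R (cos ((\<xi>, x j) \<bullet> p + \<theta>) *\<^sub>R F p))" for j
      by (rule Bochner_Integration.integrable_scaleR_right[OF int])
    have iS: "integrable lborel (\<lambda>p. \<Sum>j<N. l j *\<^sub>R (cos ((\<xi>, x j) \<bullet> p + \<theta>) *\<^sub>R F p))"
      by (rule Bochner_Integration.integrable_sum[OF ij])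
    have S: "(\<integral>p. (\<Sum>j<N. l j *\<^sub>R (cos ((\<xi>, x j) \<bullet> p + \<theta>) *\<^sub>R F p)) \<partial>lborel) = (\<Sum>j<N. l j *\<^sub>R ?X (x j))"
      unfolding Bochner_Integration.integral_sum[OF ij]
      by (intro sum.cong refl Bochner_Integration.integral_scaleR_right int)
    show "?X w - (\<Sum>j<N. l j *\<^sub>R ?X (x j)) = (\<integral>p. ?e p *\<^sub>R F p \<partial>lborel)"
      unfolding eq Bochner_Integration.integral_diff[OF int iS] S ..
    show "integrable lborel (\<lambda>p. ?e p *\<^sub>R F p)"
      unfolding eq by (rule Bochner_Integration.integrable_diff[OF int iS])
  qed
  have ptw: "norm (?e p *\<^sub>R F p) \<le> ?E * norm (F p)" for p
  proof (cases "F p = 0")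
    case False
    have e: "?e p = cos (w * snd p + (\<xi> \<bullet> fst p + \<theta>)) - (\<Sum>j<N. l j * cos (x j * snd p + (\<xi> \<bullet> fst p + \<theta>)))"
      by (cases p) (simp add: algebra_simps)
    have "\<bar>?e p\<bar> \<le> (1 + 12 ^ N) * ((3 * a * \<bar>snd p\<bar>) ^ N / fact N)"
      unfolding e by (rule ex)
    also have "\<dots> \<le> ?E"
      using supp[OF False] a by (intro mult_left_mono divide_right_mono power_mono) auto
    finally show ?thesis unfolding norm_scaleR by (intro mult_right_mono) auto
  qed simp
  have "norm (\<integral>p. ?e p *\<^sub>R F p \<partial>lborel) \<le> (\<integral>p. ?E * norm (F p) \<partial>lborel)"
    by (rule Bochner_Integration.integral_norm_bound_integral[OF ie _ ptw])
       (intro Bochner_Integration.integrable_mult_right Bochner_Integration.integrable_norm F)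
  also have "\<dots> = ?E * (\<integral>p. norm (F p) \<partial>lborel)" by (rule integral_mult_right_zero)
  finally have err: "norm (\<integral>p. ?e p *\<^sub>R F p \<partial>lborel) \<le> ?E * (\<integral>p. norm (F p) \<partial>lborel)" .
  have \<delta>0: "\<delta> \<ge> 0" by (rule order_trans[OF norm_ge_zero high[OF order_refl]])
  have "norm (\<Sum>j<N. l j *\<^sub>R ?X (x j)) \<le> (\<Sum>j<N. \<bar>l j\<bar> * \<delta>)"
  proof (rule order_trans[OF norm_sum], rule sum_mono)
    fix j assume "j \<in> {..<N}"
    then have "norm (?X (x j)) \<le> \<delta>" using high x by simp
    then show "norm (l j *\<^sub>R ?X (x j)) \<le> \<bar>l j\<bar> * \<delta>" unfolding norm_scaleR by (intro mult_left_mono) auto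
  qed
  also have "\<dots> \<le> 12 ^ N * \<delta>"
    unfolding sum_distrib_right[symmetric] by (intro mult_right_mono l \<delta>0)
  finally have main: "norm (\<Sum>j<N. l j *\<^sub>R ?X (x j)) \<le> 12 ^ N * \<delta>" .
  have "?X w = (\<Sum>j<N. l j *\<^sub>R ?X (x j)) + (\<integral>p. ?e p *\<^sub>R F p \<partial>lborel)"
    unfolding diff[symmetric] by simp
  then show ?thesis using norm_triangle_le[OF add_mono[OF main err]] by (simp only:)
qed

text \<open>The arithmetic-geometric mean inequality with weight \<open>M\<close> bounds
  \<open>norm (F p)\<close> by \<open>M / 2\<close> plus a multiple of its square; the result is
  linear in \<open>M\<close> and the volume of \<open>K\<close> appears only as a constant.\<close>

lemma L1_norm_bound:
  fixes F :: "pt \<Rightarrow> real^3"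
  assumes F: "integrable lborel F" and F2: "integrable lborel (\<lambda>p. (norm (F p))\<^sup>2)" and le: "L2sq F \<le> M\<^sup>2" and M: "M > 0"
    and K: "K \<in> sets borel" "bounded K" "\<And>p. F p \<noteq> 0 \<Longrightarrow> p \<in> K"
  shows "(\<integral>p. norm (F p) \<partial>lborel) \<le> (measure lborel K + 1) / 2 * M"
proof -
  have iK: "integrable lborel (\<lambda>p. M / 2 * indicator K p)"
    using emeasure_bounded_finite[OF K(2)] K(1)
    by (intro Bochner_Integration.integrable_mult_right integrable_real_indicator) auto
  have iF: "integrable lborel (\<lambda>p. 1 / (2 * M) * (norm (F p))\<^sup>2)"
    by (rule Bochner_Integration.integrable_mult_right[OF F2])
  have "(\<integral>p. norm (F p) \<partial>lborel) \<le> (\<integral>p. M / 2 * indicator K p + 1 / (2 * M) * (norm (F p))\<^sup>2 \<partial>lborel)"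
  proof (rule Bochner_Integration.integral_mono[OF Bochner_Integration.integrable_norm[OF F] Bochner_Integration.integrable_add[OF iK iF]])
    fix p
    have "1 * norm (F p) \<le> M / 2 + 1 / (2 * M) * (norm (F p))\<^sup>2"
    proof -
      have "0 \<le> (M - norm (F p))\<^sup>2 / (2 * M)" using M by simp
      also have "\<dots> = M / 2 + 1 / (2 * M) * (norm (F p))\<^sup>2 - norm (F p)"
        using M by (simp add: power2_eq_square field_simps)
      finally show ?thesis by simp
    qed
    then show "norm (F p) \<le> M / 2 * indicator K p + 1 / (2 * M) * (norm (F p))\<^sup>2"
      using K(3)[of p] by (cases "F p = 0") (auto simp: indicator_def M less_imp_le)
  qed
  also have "\<dots> = (\<integral>p. M / 2 * indicator K p \<partial>lborel) + (\<integral>p. 1 / (2 * M) * (norm (F p))\<^sup>2 \<partial>lborel)"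
    by (rule Bochner_Integration.integral_add[OF iK iF])
  also have "(\<integral>p. M / 2 * indicator K p \<partial>lborel) = M / 2 * measure lborel K" using K(1) by simp
  also have "(\<integral>p. 1 / (2 * M) * (norm (F p))\<^sup>2 \<partial>lborel) = 1 / (2 * M) * L2sq F"
    unfolding L2sq_def by (rule integral_mult_right_zero)
  also have "1 / (2 * M) * L2sq F \<le> 1 / (2 * M) * M\<^sup>2" using le M by (intro mult_left_mono) auto
  also have "1 / (2 * M) * M\<^sup>2 = M / 2" using M by (simp add: power2_eq_square)
  finally show ?thesis by (simp add: algebra_simps add_divide_distrib)
qed

text \<open>Frequencies in the box of half-width \<open>\<rho>\<close> split according to the cone:
  large \<open>\<omega>\<close> is read directly from the boundary data, small
  \<open>\<omega>\<close> is extrapolated from large ones at the same spatial frequency.\<close>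

lemma frequency_cutoff_estimate:
  fixes F :: "pt \<Rightarrow> real^3"
  assumes R: "R > 0" and T0: "T0 > 0" and b: "b > 1" and M: "M > 1" and df: "div_free F" and H: "H4H1_bound F M"
    and supp: "closure {p. F p \<noteq> 0} \<subseteq> ball 0 R \<times> {0<..<T0}"
    and E: "\<And>n. n \<in> {0<..<b\<^sup>2} \<Longrightarrow> maxwell_sol n F (E n)"
    and T: "2 * R * b\<^sup>2 + T0 \<le> T" and bdry: "\<And>n. n \<in> {0<..<b\<^sup>2} \<Longrightarrow> bdry_int R (E n) T \<le> \<epsilon>\<^sup>2" and \<epsilon>: "\<epsilon> > 0"
    and B: "\<And>x. bump x \<le> B" and \<rho>: "\<rho> \<ge> 1" and N: "N > 0"
    and C1: "C1 = 2 * pi\<^sup>2 * R\<^sup>2 * (T0 + 2 * R) * (2 + 2 * (B / R)\<^sup>2)"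
    and c: "c = (measure lborel (ball 0 R \<times> {0<..<T0} :: pt set) + 1) / 2"
  shows "L2sq F \<le> 3 * ((1 + 1 / (R + 2 * T0)) ^ 4 * \<rho> ^ 4 *
      (12 ^ N * (\<epsilon> * sqrt (C1 * (b * (b\<^sup>2 + 4 * \<rho>\<^sup>2)))) + (1 + 12 ^ N) * ((12 * \<rho> * T0 / b) ^ N / fact N) * (c * M))\<^sup>2) + M\<^sup>2 / \<rho>\<^sup>2"
    and "L2sq F \<le> M\<^sup>2"
proof -
  obtain D :: "nat \<Rightarrow> pt \<Rightarrow> real^3" and G :: "nat \<Rightarrow> 3 \<Rightarrow> pt \<Rightarrow> real^3" where
    D0: "D 0 = F" and L2D': "\<And>k. k \<le> 4 \<Longrightarrow> L2_pos (D k)"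
    and sumM: "(\<Sum>k\<le>4. L2sq (D k) + (\<Sum>j\<in>UNIV. L2sq (G k j))) \<le> M\<^sup>2"
    using H unfolding H4H1_bound_def by blast
  have L2D: "L2_pos (D 0)" by (rule L2D') simp
  have nn: "0 \<le> L2sq u" for u by (simp add: L2sq_def)
  have "L2sq (D 0) + (\<Sum>j\<in>UNIV. L2sq (G 0 j)) \<le> (\<Sum>k\<le>4. L2sq (D k) + (\<Sum>j\<in>UNIV. L2sq (G k j)))"
    by (rule member_le_sum[of 0 "{..4::nat}" "\<lambda>k. L2sq (D k) + (\<Sum>j\<in>UNIV. L2sq (G k j))"])
       (auto intro!: add_nonneg_nonneg sum_nonneg nn)
  moreover have "0 \<le> (\<Sum>j\<in>UNIV. L2sq (G 0 j))" by (intro sum_nonneg nn)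
  ultimately show L2M: "L2sq F \<le> M\<^sup>2" using sumM D0 by simp
  have Fm: "F \<in> borel_measurable borel" and F2: "integrable lborel (\<lambda>p. (norm (F p))\<^sup>2)"
    using L2D by (auto simp: L2_pos_def D0)
  let ?K = "ball 0 R \<times> {0<..<T0} :: pt set"
  have FK: "p \<in> ?K" if "F p \<noteq> 0" for p
    by (rule subsetD[OF supp], rule subsetD[OF closure_subset]) (simp add: that)
  have "open ?K" by (intro open_Times) auto
  then have Kb: "?K \<in> sets borel" by (rule borel_open)
  have bK: "bounded ?K" by (intro bounded_Times bounded_ball bounded_subset[OF bounded_closed_interval[of 0 T0]]; auto)
  have F: "integrable lborel F" by (rule L2_bounded_support_integrable[OF Fm F2 bK Kb FK])
  have L1: "(\<integral>p. norm (F p) \<partial>lborel) \<le> c * M"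
    unfolding c by (rule L1_norm_bound[OF F F2 L2M _ Kb bK FK]) (use M in simp_all)
  define \<delta> where "\<delta> = \<epsilon> * sqrt (C1 * (b * (b\<^sup>2 + 4 * \<rho>\<^sup>2)))"
  define er where "er = (1 + 12 ^ N) * ((12 * \<rho> * T0 / b) ^ N / fact N)"
  have C10: "C1 \<ge> 0" unfolding C1 using R T0 by (intro mult_nonneg_nonneg) auto
  have er0: "er \<ge> 0" unfolding er_def using \<rho> T0 b by (intro mult_nonneg_nonneg divide_nonneg_nonneg zero_le_power) auto
  have \<delta>0: "\<delta> \<ge> 0" unfolding \<delta>_def using \<epsilon> C10 b by (intro mult_nonneg_nonneg real_sqrt_ge_zero) auto
  have c0: "c \<ge> 0" by (simp add: c)
  have direct: "norm (\<integral>p. cos (\<zeta> \<bullet> p + \<theta>) *\<^sub>R F p \<partial>lborel) \<le> \<delta>"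
    if "norm (fst \<zeta>) \<le> 2 * \<rho>" "4 * \<rho> / b \<le> \<bar>snd \<zeta>\<bar>" for \<zeta> \<theta>
  proof -
    have "2 * \<rho> \<le> b / 2 * \<bar>snd \<zeta>\<bar>" using that(2) b by (simp add: pos_divide_le_eq mult.commute)
    then have "norm (fst \<zeta>) \<le> b / 2 * \<bar>snd \<zeta>\<bar>" using that(1) by linarith
    note fb = fourier_bound[OF R T0 b df F supp E T bdry \<epsilon> B this, of \<theta>]
    have "(norm (fst \<zeta>))\<^sup>2 \<le> (2 * \<rho>)\<^sup>2" using that(1) by (intro power_mono) auto
    then have "b\<^sup>2 + (norm (fst \<zeta>))\<^sup>2 \<le> b\<^sup>2 + 4 * \<rho>\<^sup>2" by (simp add: power_mult_distrib)
    then have "C1 * (b * (b\<^sup>2 + (norm (fst \<zeta>))\<^sup>2)) \<le> C1 * (b * (b\<^sup>2 + 4 * \<rho>\<^sup>2))"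
      using C10 b by (intro mult_left_mono) auto
    then have "\<epsilon> * sqrt (C1 * (b * (b\<^sup>2 + (norm (fst \<zeta>))\<^sup>2))) \<le> \<delta>"
      unfolding \<delta>_def using \<epsilon> by (intro mult_left_mono[OF real_sqrt_le_mono]) auto
    then show ?thesis using fb unfolding C1 by (rule order_trans[rotated])
  qed
  have low: "norm (\<integral>p. cos (\<zeta> \<bullet> p + \<theta>) *\<^sub>R F p \<partial>lborel) \<le> 12 ^ N * \<delta> + er * (c * M)"
    if \<zeta>: "\<And>b. b \<in> Basis \<Longrightarrow> \<bar>\<zeta> \<bullet> b\<bar> \<le> \<rho>" for \<zeta> \<theta>
  proof -
    have comp: "\<bar>fst \<zeta> $ j\<bar> \<le> \<rho>" for j
      using \<zeta>[of "(axis j 1, 0)"] by (cases \<zeta>) (auto simp: Basis_prod_def Basis_vec_def inner_axis)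
    have "(norm (fst \<zeta>))\<^sup>2 = (\<Sum>j\<in>UNIV. \<bar>fst \<zeta> $ j\<bar>\<^sup>2)"
      unfolding power2_norm_eq_inner inner_vec_def by (simp add: power2_eq_square)
    also have "\<dots> \<le> (\<Sum>j\<in>(UNIV::3 set). \<rho>\<^sup>2)" by (intro sum_mono power_mono comp) auto
    also have "\<dots> \<le> (2 * \<rho>)\<^sup>2" by (simp add: power_mult_distrib)
    finally have n2: "norm (fst \<zeta>) \<le> 2 * \<rho>" using \<rho> by (intro power2_le_imp_le[of "norm (fst \<zeta>)" "2 * \<rho>"]) auto
    \<comment> \<open>Three components of size at most \<open>\<rho>\<close> give a spatial
      frequency of at most \<open>2 * \<rho>\<close>, and the cone condition then needs
      \<open>|\<omega>| \<ge> 4 * \<rho> / b\<close>. Hence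
      \<open>3 * a * T0 = 12 * \<rho> * T0 / b\<close> in the error.\<close>
    let ?a = "4 * \<rho> / b"
    show ?thesis
    proof (cases "?a \<le> \<bar>snd \<zeta>\<bar>")
      case True
      have "1 * \<delta> \<le> 12 ^ N * \<delta>" using \<delta>0 by (intro mult_right_mono) auto
      moreover have "0 \<le> er * (c * M)" using er0 c0 M by (intro mult_nonneg_nonneg) auto
      ultimately show ?thesis using direct[OF n2 True, of \<theta>] by linarith
    next
      case False
      have "norm (\<integral>p. cos ((fst \<zeta>, snd \<zeta>) \<bullet> p + \<theta>) *\<^sub>R F p \<partial>lborel)
        \<le> 12 ^ N * \<delta> + (1 + 12 ^ N) * ((3 * ?a * T0) ^ N / fact N) * (\<integral>p. norm (F p) \<partial>lborel)"
      proof (rule extrapolated_fourier_bound[OF F T0 _ N])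
        show "?a > 0" using \<rho> b by simp
        show "\<bar>snd p\<bar> \<le> T0" if "F p \<noteq> 0" for p using FK[OF that] by (auto simp: mem_Times_iff)
        show "norm (\<integral>p. cos ((fst \<zeta>, w) \<bullet> p + \<theta>) *\<^sub>R F p \<partial>lborel) \<le> \<delta>" if "?a \<le> w" for w \<theta>
          by (rule direct) (use n2 that \<rho> b in auto)
        show "\<bar>snd \<zeta>\<bar> \<le> ?a" using False by simp
      qed
      also have "(1 + 12 ^ N) * ((3 * ?a * T0) ^ N / fact N) = er" by (simp add: er_def)
      also have "er * (\<integral>p. norm (F p) \<partial>lborel) \<le> er * (c * M)" by (rule mult_left_mono[OF L1 er0])
      finally show ?thesis by simp
    qed
  qed
  have "L2sq F \<le> 3 * ((2 * \<rho> / pi + 1 / (R + 2 * T0)) ^ 4 * (12 ^ N * \<delta> + er * (c * M))\<^sup>2) + M\<^sup>2 / \<rho>\<^sup>2"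
    by (rule low_frequency_energy_bound[OF R T0 _ H supp low]) (use \<rho> in simp_all)
  \<comment> \<open>Because \<open>\<rho> \<ge> 1\<close> and \<open>2 / pi \<le> 1\<close>, the
    mode count is a multiple of \<open>\<rho> ^ 4\<close> whose factor depends only on
    \<open>R\<close> and \<open>T0\<close>.\<close>
  also have "(2 * \<rho> / pi + 1 / (R + 2 * T0)) ^ 4 \<le> (1 + 1 / (R + 2 * T0)) ^ 4 * \<rho> ^ 4"
  proof -
    have "2 * \<rho> / pi \<le> 1 * \<rho>" using \<rho> pi_ge_two by (simp add: pos_divide_le_eq)
    moreover have "1 / (R + 2 * T0) * 1 \<le> 1 / (R + 2 * T0) * \<rho>" using \<rho> R T0 by (intro mult_left_mono) auto
    ultimately have "2 * \<rho> / pi + 1 / (R + 2 * T0) \<le> (1 + 1 / (R + 2 * T0)) * \<rho>" by (simp only: distrib_right)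
    then show ?thesis unfolding power_mult_distrib[symmetric] using \<rho> R T0 by (intro power_mono) auto
  qed
  finally show "L2sq F \<le> 3 * ((1 + 1 / (R + 2 * T0)) ^ 4 * \<rho> ^ 4 *
      (12 ^ N * (\<epsilon> * sqrt (C1 * (b * (b\<^sup>2 + 4 * \<rho>\<^sup>2)))) + (1 + 12 ^ N) * ((12 * \<rho> * T0 / b) ^ N / fact N) * (c * M))\<^sup>2) + M\<^sup>2 / \<rho>\<^sup>2"
    unfolding \<delta>_def[symmetric] er_def[symmetric] by (simp add: mult_right_mono mult_left_mono)
qed

section \<open>Choice of the cutoff\<close>

lemma power_div_fact_le:
  fixes y :: real
  assumes "y \<ge> 0" "N > 0"
  shows "y ^ N / fact N \<le> (3 * y / N) ^ N"
proof -
  have "real N ^ N / fact N \<le> exp (real N)" by (rule power_div_fact_le_exp) simp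
  also have "\<dots> = exp 1 ^ N" by (simp flip: exp_of_nat_mult)
  also have "\<dots> \<le> 3 ^ N" by (rule power_mono) (use exp_le in auto)
  finally have "real N ^ N \<le> 3 ^ N * fact N" by (simp add: divide_le_eq)
  then have "y ^ N * real N ^ N \<le> y ^ N * (3 ^ N * fact N)"
    using assms by (intro mult_left_mono) auto
  then show ?thesis using assms by (simp add: power_divide power_mult_distrib divide_le_eq le_divide_eq mult_ac)
qed

text \<open>A fixed \<open>N\<close> works here: up to constants the error is \<open>\<rho> ^ 6 *
  (\<rho> / b) ^ (2 * N) = s ^ (2 * N + 6) / b ^ (N - 3)\<close>, which \<open>s ^ 4 \<le> b\<close>
  keeps below 1 once \<open>N \<ge> 9\<close>. For \<open>N = 12\<close> this reads
  \<open>s ^ 30 / b ^ 9 \<le> 1\<close>. The data term collects at most \<open>b ^ 6\<close>, which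
  fits into \<open>b ^ 11\<close>.\<close>

lemma moderate_frequency_bounds:
  fixes b s T0 \<rho> :: real
  assumes b: "b > 1" and s: "s > 0" and sb: "s ^ 4 \<le> b" and T0: "T0 > 0" and \<rho>: "\<rho>\<^sup>2 = b * s\<^sup>2"
  shows "\<rho> ^ 4 * (144 ^ 12 * (b * (b\<^sup>2 + 4 * \<rho>\<^sup>2))) \<le> 5 * 144 ^ 12 * b ^ 11"
    and "\<rho> ^ 6 * ((1 + 12 ^ 12) * ((12 * \<rho> * T0 / b) ^ 12 / fact 12))\<^sup>2 \<le> ((1 + 12 ^ 12) * (12 * T0) ^ 12)\<^sup>2"
proof -
  have "(s\<^sup>2)\<^sup>2 \<le> b\<^sup>2"
    using sb b self_le_power[of b 2] by (simp add: power_mult[symmetric])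
  then have s2: "s\<^sup>2 \<le> b" by (rule power2_le_imp_le) (use b in simp)
  have r4: "\<rho> ^ 4 = b\<^sup>2 * s ^ 4" and r6: "\<rho> ^ 6 = b ^ 3 * s ^ 6"
    using arg_cong[OF \<rho>, of "\<lambda>x. x\<^sup>2"] arg_cong[OF \<rho>, of "\<lambda>x. x ^ 3"]
    by (simp_all add: power_mult_distrib flip: power_mult)
  have "\<rho> ^ 4 \<le> b ^ 3" unfolding r4 using sb b by (simp add: power2_eq_square power3_eq_cube)
  moreover have "b * (b\<^sup>2 + 4 * \<rho>\<^sup>2) \<le> 5 * b ^ 3"
    unfolding \<rho> using s2 b by (simp add: power2_eq_square power3_eq_cube algebra_simps)
  ultimately have "\<rho> ^ 4 * (b * (b\<^sup>2 + 4 * \<rho>\<^sup>2)) \<le> b ^ 3 * (5 * b ^ 3)"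
    by (rule mult_mono) (use b in auto)
  also have "\<dots> = 5 * b ^ 6" by (simp flip: power_add)
  also have "\<dots> \<le> 5 * b ^ 11" using b by (simp add: power_increasing)
  finally have "144 ^ 12 * (\<rho> ^ 4 * (b * (b\<^sup>2 + 4 * \<rho>\<^sup>2))) \<le> 144 ^ 12 * (5 * b ^ 11)"
    by (rule mult_left_mono) simp
  then show "\<rho> ^ 4 * (144 ^ 12 * (b * (b\<^sup>2 + 4 * \<rho>\<^sup>2))) \<le> 5 * 144 ^ 12 * b ^ 11"
    by (simp only: mult_ac)
  have "s ^ 30 = (s ^ 4) ^ 7 * s\<^sup>2" by (simp flip: power_mult power_add)
  also have "\<dots> \<le> b ^ 7 * b" using sb s2 s b by (intro mult_mono power_mono) auto
  also have "\<dots> \<le> b ^ 9" using b power_increasing[of 8 9 b] by (simp flip: power_Suc2)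
  finally have "s ^ 30 / b ^ 9 \<le> 1" using b by simp
  have "\<rho> ^ 24 = b ^ 12 * s ^ 24"
    using arg_cong[OF \<rho>, of "\<lambda>x. x ^ 12"] by (simp add: power_mult_distrib flip: power_mult)
  moreover have "b ^ 15 = b ^ 3 * b ^ 12" "s ^ 30 = s ^ 6 * s ^ 24" by (simp_all flip: power_add)
  ultimately have "\<rho> ^ 6 * \<rho> ^ 24 = b ^ 15 * s ^ 30" using r6 by (simp only: mult_ac)
  then have "\<rho> ^ 6 * (\<rho> / b) ^ 24 = b ^ 15 * s ^ 30 / (b ^ 15 * b ^ 9)"
    unfolding power_divide by (simp add: times_divide_eq_right flip: power_add)
  also have "\<dots> = s ^ 30 / b ^ 9" by (rule mult_divide_mult_cancel_left) (use b in simp)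
  also have "\<dots> \<le> 1" by fact
  finally have le: "\<rho> ^ 6 * (\<rho> / b) ^ 24 \<le> 1" .
  have "\<rho> ^ 6 * ((1 + 12 ^ 12) * ((12 * \<rho> * T0 / b) ^ 12 / fact 12))\<^sup>2
    = (\<rho> ^ 6 * (\<rho> / b) ^ 24) * (((1 + 12 ^ 12) * (12 * T0) ^ 12)\<^sup>2 / (fact 12)\<^sup>2)"
    unfolding power_mult_distrib power_divide power_mult[symmetric] by simp
  also have "\<dots> \<le> 1 * (((1 + 12 ^ 12) * (12 * T0) ^ 12)\<^sup>2 / 1)"
  proof (rule mult_mono[OF le])
    have f: "(1::real) \<le> (fact 12)\<^sup>2" using fact_ge_1[of 12, where ?'a=real] by (rule one_le_power)
    show "((1 + 12 ^ 12) * (12 * T0) ^ 12)\<^sup>2 / (fact 12)\<^sup>2 \<le> ((1 + 12 ^ 12) * (12 * T0) ^ 12)\<^sup>2 / 1"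
      by (rule divide_left_mono[OF f]) auto
  qed auto
  finally show "\<rho> ^ 6 * ((1 + 12 ^ 12) * ((12 * \<rho> * T0 / b) ^ 12 / fact 12))\<^sup>2 \<le> ((1 + 12 ^ 12) * (12 * T0) ^ 12)\<^sup>2"
    by simp
qed

text \<open>The choice \<open>N = \<lfloor>s ^ 5 / 6\<rfloor>\<close> lets the extrapolation factor \<open>144 ^ N\<close> consume at most half of the
  decay of \<open>\<epsilon>\<^sup>2 = exp (- 2 * s ^ 5)\<close>, while \<open>fact N\<close> still beats the remaining powers of \<open>s\<close>.\<close>

lemma small_data_bounds:
  fixes b s T0 \<rho> :: real
  assumes b: "b > 1" and s: "s > 1" and bs: "b \<le> s ^ 4" and T0: "T0 > 0"
    and \<rho>: "\<rho>\<^sup>2 = b * s\<^sup>2" "\<rho> > 0" and s5: "s ^ 5 \<ge> 36" and s4: "s ^ 4 \<ge> 5184 * T0"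
  obtains N :: nat where "N > 0"
    and "\<rho>\<^sup>2 * (\<rho> ^ 4 * (144 ^ N * (exp (- (s ^ 5)))\<^sup>2 * (b * (b\<^sup>2 + 4 * \<rho>\<^sup>2)))) \<le> 3600"
    and "\<rho> ^ 6 * ((1 + 12 ^ N) * ((12 * \<rho> * T0 / b) ^ N / fact N))\<^sup>2 \<le> 4 * (5184 * T0) ^ 6"
proof -
  \<comment> \<open>\<open>q\<close> bounds the base of the error power:
    \<open>3 * 144 * T0 * s\<close> divided by the lower bound \<open>s ^ 5 / 12\<close> for
    \<open>N\<close>. Here 144 joins the 12 of the Lagrange coefficients with the 12 of the error,
    and \<open>3 * 144 * 12 = 5184\<close>.\<close>
  let ?L = "s ^ 5" define q where "q = 5184 * T0 / s ^ 4"
  define N where "N = nat \<lfloor>?L / 6\<rfloor>"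
  have "0 \<le> ?L / 6" using s by simp
  then have "real N = of_int \<lfloor>?L / 6\<rfloor>" unfolding N_def by (subst of_nat_nat) auto
  then have N: "real N \<le> ?L / 6" "?L / 6 < real N + 1" by linarith+
  then have N3: "real N \<ge> 3" and NL: "?L / 12 \<le> real N" using s5 by linarith+
  have N0: "N > 0" and Nge: "N \<ge> 3" using N3 by linarith+
  have q: "0 \<le> q" "q \<le> 1" unfolding q_def using s4 T0 s by auto
  \<comment> \<open>\<open>144 \<le> (5/2) ^ 6\<close> and \<open>5/2 \<le> exp 1\<close>, so
    \<open>144 ^ N\<close> is at most \<open>exp (6 * N)\<close>, which the choice of
    \<open>N\<close> keeps below \<open>exp (s ^ 5)\<close>.\<close>
  have "144 ^ N \<le> ((5/2::real) ^ 6) ^ N" by (rule power_mono) (auto simp: power_divide)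
  also have "\<dots> \<le> (exp 1 ^ 6) ^ N"
    using exp_lower_Taylor_quadratic[of 1] by (intro power_mono) auto
  also have "\<dots> = exp (6 * real N)" by (simp flip: exp_of_nat_mult power_mult)
  also have "\<dots> \<le> exp ?L" using N by simp
  finally have e1: "144 ^ N * (exp (- ?L))\<^sup>2 \<le> exp ?L * (exp (- ?L))\<^sup>2" by (rule mult_right_mono) simp
  have e2: "exp ?L * (exp (- ?L))\<^sup>2 = exp (- ?L)" by (simp add: power2_eq_square flip: exp_add)
  have s1: "1 \<le> s" using s by simp
  have r2: "\<rho>\<^sup>2 \<le> s ^ 6" unfolding \<rho> using mult_right_mono[OF bs, of "s\<^sup>2"] by (simp flip: power_add)
  have r4: "\<rho> ^ 4 \<le> s ^ 12" using power_mono[OF r2, of 2] by (simp flip: power_mult)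
  have r6: "\<rho> ^ 6 \<le> s ^ 18" using power_mono[OF r2, of 3] by (simp flip: power_mult)
  have b2: "b\<^sup>2 \<le> s ^ 8" using power_mono[OF bs, of 2] b by (simp flip: power_mult)
  have "s ^ 6 \<le> s ^ 8" using s1 by (intro power_increasing) auto
  then have "b * (b\<^sup>2 + 4 * \<rho>\<^sup>2) \<le> s ^ 4 * (5 * s ^ 8)"
    using bs b b2 r2 by (intro mult_mono) auto
  also have "\<dots> = 5 * s ^ 12" by (simp flip: power_add)
  finally have bb: "b * (b\<^sup>2 + 4 * \<rho>\<^sup>2) \<le> 5 * s ^ 12" .
  have "\<rho>\<^sup>2 * (\<rho> ^ 4 * (144 ^ N * (exp (- ?L))\<^sup>2 * (b * (b\<^sup>2 + 4 * \<rho>\<^sup>2))))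
    \<le> s ^ 6 * (s ^ 12 * (exp (- ?L) * (5 * s ^ 12)))"
    using r2 r4 bb e1 b unfolding e2
    by (intro mult_mono[OF _ mult_mono[OF _ mult_mono]]) auto
  also have "\<dots> = 5 * ?L ^ 6 * exp (- ?L)" by (simp add: mult_ac flip: power_mult power_add)
  \<comment> \<open>One term of the exponential series: \<open>720 = fact 6\<close>, and the sixth
    power matches the 30 powers of \<open>s\<close> collected above.\<close>
  also have "\<dots> \<le> 5 * (720 * exp ?L) * exp (- ?L)"
  proof -
    have "?L ^ 6 / fact 6 \<le> exp ?L" by (rule power_div_fact_le_exp) (use s in simp)
    then have "?L ^ 6 \<le> 720 * exp ?L" by (simp add: fact_numeral)
    then show ?thesis by (intro mult_right_mono mult_left_mono) auto
  qed
  also have "\<dots> = 3600" by (simp flip: exp_add)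
  finally have 1: "\<rho>\<^sup>2 * (\<rho> ^ 4 * (144 ^ N * (exp (- ?L))\<^sup>2 * (b * (b\<^sup>2 + 4 * \<rho>\<^sup>2)))) \<le> 3600" .
  have "\<rho>\<^sup>2 \<le> (b * s)\<^sup>2" unfolding \<rho>
    using b mult_right_mono[of b "b\<^sup>2" "s\<^sup>2"] self_le_power[of b 2] by (simp add: power_mult_distrib)
  then have "\<rho> \<le> b * s" using b s by (simp add: power2_le_iff_abs_le)
  then have rb: "\<rho> / b \<le> s" using b by (simp add: divide_le_eq mult.commute)
  have "12 ^ N * ((12 * \<rho> * T0 / b) ^ N / fact N) \<le> (3 * (144 * T0 * (\<rho> / b)) / N) ^ N"
    using power_div_fact_le[of "144 * T0 * (\<rho> / b)" N] \<rho> T0 b N0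
    by (simp add: mult_ac flip: power_mult_distrib)
  also have "\<dots> \<le> q ^ N"
  proof (rule power_mono)
    have "3 * (144 * T0 * (\<rho> / b)) / N \<le> 3 * (144 * T0 * s) / (?L / 12)"
      using rb T0 NL s \<rho> b by (intro frac_le mult_left_mono) auto
    also have "\<dots> = q" unfolding q_def using s by (simp add: divide_simps) (simp add: eval_nat_numeral)
    finally show "3 * (144 * T0 * (\<rho> / b)) / N \<le> q" .
  qed (use \<rho> T0 b in auto)
  \<comment> \<open>Three factors are enough: squared, \<open>q ^ 3\<close> supplies
    \<open>s ^ 24\<close> in the denominator, against
    \<open>\<rho> ^ 6 \<le> s ^ 18\<close>.\<close>
  also have "\<dots> \<le> q ^ 3" using q Nge by (intro power_decreasing) auto
  finally have x: "12 ^ N * ((12 * \<rho> * T0 / b) ^ N / fact N) \<le> q ^ 3" .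
  let ?y = "(12 * \<rho> * T0 / b) ^ N / fact N"
  have y: "0 \<le> ?y" using \<rho> T0 b by auto
  have "(1 + 12 ^ N) * ?y \<le> (2 * 12 ^ N) * ?y" using y by (intro mult_right_mono) auto
  also have "\<dots> \<le> 2 * q ^ 3" using x by simp
  finally have "((1 + 12 ^ N) * ?y)\<^sup>2 \<le> (2 * q ^ 3)\<^sup>2"
    by (rule power_mono) (rule mult_nonneg_nonneg[OF _ y], simp)
  then have "\<rho> ^ 6 * ((1 + 12 ^ N) * ?y)\<^sup>2 \<le> s ^ 18 * (2 * q ^ 3)\<^sup>2" using r6 s by (intro mult_mono) auto
  also have "\<dots> = 4 * (5184 * T0) ^ 6 * (s ^ 18 / s ^ 24)"
    unfolding q_def by (simp add: power_mult_distrib power_divide flip: power_mult)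
  also have "\<dots> \<le> 4 * (5184 * T0) ^ 6 * 1"
    using power_increasing[of 18 24 s] s T0 by (intro mult_left_mono) auto
  finally show ?thesis using that[OF N0 1] by simp
qed

lemma cutoff_estimate_expand:
  fixes A \<rho> u v Y Z :: real
  assumes "Y \<le> 3 * (A * \<rho> ^ 4 * (u + v)\<^sup>2) + Z" "A \<ge> 0"
  shows "Y \<le> 6 * A * (\<rho> ^ 4 * u\<^sup>2) + 6 * A * (\<rho> ^ 4 * v\<^sup>2) + Z"
proof -
  have "(u + v)\<^sup>2 \<le> 2 * u\<^sup>2 + 2 * v\<^sup>2" using sum_squares_ge_zero[of "u - v" 0]
    by (simp add: power2_eq_square algebra_simps)
  then have "(A * \<rho> ^ 4) * (u + v)\<^sup>2 \<le> (A * \<rho> ^ 4) * (2 * u\<^sup>2 + 2 * v\<^sup>2)"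
    using assms by (intro mult_left_mono) auto
  then show ?thesis using assms by (simp add: algebra_simps)
qed

text \<open>The constant is fixed before \<open>b\<close>, \<open>M\<close> and
  \<open>\<epsilon>\<close>. With \<open>D = b * s\<^sup>2\<close> and
  \<open>\<rho> = sqrt D\<close>, three regimes remain: \<open>D \<le> C\<close>, then
  \<open>s ^ 4 \<le> b\<close> with 12 nodes, and finally \<open>b < s ^ 4\<close> with a growing
  number of nodes.\<close>

lemma cutoff_optimization:
  fixes A c K T0 :: real
  assumes A: "A \<ge> 0" and K: "K \<ge> 0" and T0: "T0 > 0"
  obtains C where "C > 0"
    and "\<And>b M \<epsilon> Y. b > 1 \<Longrightarrow> M > 1 \<Longrightarrow> 0 < \<epsilon> \<Longrightarrow> \<epsilon> < 1 \<Longrightarrow> Y \<le> M\<^sup>2 \<Longrightarrow>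
      (\<And>\<rho> N. \<rho> \<ge> 1 \<Longrightarrow> N > 0 \<Longrightarrow> Y \<le> 3 * (A * \<rho> ^ 4 *
        (12 ^ N * (\<epsilon> * sqrt (K * (b * (b\<^sup>2 + 4 * \<rho>\<^sup>2)))) +
         (1 + 12 ^ N) * ((12 * \<rho> * T0 / b) ^ N / fact N) * (c * M))\<^sup>2) + M\<^sup>2 / \<rho>\<^sup>2) \<Longrightarrow>
      Y \<le> C * (b ^ 11 * \<epsilon>\<^sup>2 + M\<^sup>2 / (b * \<bar>ln \<epsilon>\<bar> powr (2/5)))"
proof -
  define KI KII \<Lambda> where "KI = ((1 + 12 ^ 12) * (12 * T0) ^ 12)\<^sup>2" and "KII = 4 * (5184 * T0) ^ 6"
    and "\<Lambda> = max 36 (5184 * T0)"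
  define C where "C = 6 * A * K * (5 * 144 ^ 12 + 3600) + 6 * A * c\<^sup>2 * (KI + KII) + 1 + \<Lambda> ^ 6"
  have nn: "0 \<le> KI" "0 \<le> KII" "\<Lambda> \<ge> 36" unfolding KI_def KII_def \<Lambda>_def using T0 by auto
  have parts: "0 \<le> 6 * A * K" "0 \<le> 6 * A * c\<^sup>2 * KI" "0 \<le> 6 * A * c\<^sup>2 * KII" "0 \<le> \<Lambda> ^ 6"
    using A K nn by auto
  have gen: "p * (5 * 144 ^ 12) \<le> C' \<and> p * 3600 + r + 1 \<le> C' \<and> q + 1 \<le> C' \<and> 1 \<le> C' \<and> l \<le> C'"
    if "C' = p * (5 * 144 ^ 12 + 3600) + (q + r) + 1 + l" "0 \<le> p" "0 \<le> q" "0 \<le> r" "0 \<le> l" for p q r l C' :: real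
    using that by simp
  have C1: "6 * A * K * (5 * 144 ^ 12) \<le> C" "6 * A * K * 3600 + 6 * A * c\<^sup>2 * KII + 1 \<le> C"
     "6 * A * c\<^sup>2 * KI + 1 \<le> C" "1 \<le> C" "\<Lambda> ^ 6 \<le> C"
    using gen[OF C_def[unfolded distrib_left[of _ KI KII]] parts] by blast+
  show ?thesis
  proof (rule that[of C])
    show "C > 0" using C1 by linarith
  next
    fix b M \<epsilon> Y :: real
    assume b: "b > 1" and M: "M > 1" and \<epsilon>: "0 < \<epsilon>" "\<epsilon> < 1" and YM: "Y \<le> M\<^sup>2"
      and est: "\<And>\<rho> N. \<rho> \<ge> 1 \<Longrightarrow> N > 0 \<Longrightarrow> Y \<le> 3 * (A * \<rho> ^ 4 *
        (12 ^ N * (\<epsilon> * sqrt (K * (b * (b\<^sup>2 + 4 * \<rho>\<^sup>2)))) +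
         (1 + 12 ^ N) * ((12 * \<rho> * T0 / b) ^ N / fact N) * (c * M))\<^sup>2) + M\<^sup>2 / \<rho>\<^sup>2"
    define s where "s = \<bar>ln \<epsilon>\<bar> powr (1/5)"
    have L: "\<bar>ln \<epsilon>\<bar> > 0" using \<epsilon> by simp
    have s: "s > 0" unfolding s_def using L by simp
    have s2: "\<bar>ln \<epsilon>\<bar> powr (2/5) = s\<^sup>2" unfolding s_def using L by (simp add: powr_power)
    have s5: "s ^ 5 = \<bar>ln \<epsilon>\<bar>" unfolding s_def using L by (simp add: powr_power)
    have \<epsilon>s: "\<epsilon> = exp (- (s ^ 5))" unfolding s5 using \<epsilon> by (simp add: exp_minus)
    define D where "D = b * s\<^sup>2"
    have D: "D > 0" unfolding D_def using b s by simp
    \<comment> \<open>As long as \<open>D\<close> is bounded by the constant, the a priori bound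
      \<open>Y \<le> M\<^sup>2\<close> already has the required form.\<close>
    have big: "Y \<le> C * (b ^ 11 * \<epsilon>\<^sup>2 + M\<^sup>2 / D)" if "D \<le> C"
    proof -
      have "Y \<le> D * (M\<^sup>2 / D)" using YM D by simp
      also have "\<dots> \<le> C * (M\<^sup>2 / D)" using that D by (intro mult_right_mono) auto
      also have "\<dots> \<le> C * (b ^ 11 * \<epsilon>\<^sup>2 + M\<^sup>2 / D)" using C1 b by (intro mult_left_mono) auto
      finally show ?thesis .
    qed
    have expand: "Y \<le> 6 * A * K * (\<rho> ^ 4 * (144 ^ N * \<epsilon>\<^sup>2 * (b * (b\<^sup>2 + 4 * \<rho>\<^sup>2))))
       + 6 * A * c\<^sup>2 * ((\<rho> ^ 6 * ((1 + 12 ^ N) * ((12 * \<rho> * T0 / b) ^ N / fact N))\<^sup>2) * (M\<^sup>2 / D)) + M\<^sup>2 / D"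
      if \<rho>: "\<rho> \<ge> 1" "\<rho>\<^sup>2 = D" and N: "N > 0" for \<rho> N
    proof -
      have Q: "0 \<le> K * (b * (b\<^sup>2 + 4 * \<rho>\<^sup>2))" using K b by auto
      have u: "\<rho> ^ 4 * (12 ^ N * (\<epsilon> * sqrt (K * (b * (b\<^sup>2 + 4 * \<rho>\<^sup>2)))))\<^sup>2
        = K * (\<rho> ^ 4 * (144 ^ N * \<epsilon>\<^sup>2 * (b * (b\<^sup>2 + 4 * \<rho>\<^sup>2))))"
        unfolding power_mult_distrib real_sqrt_pow2[OF Q]
        using power_mult_distrib[of "12::real" 12 N]
        by (simp add: power_mult power2_eq_square mult_ac)
      \<comment> \<open>Trading \<open>\<rho>\<^sup>2\<close> for \<open>D\<close> brings the
        extrapolation error into the target form \<open>M\<^sup>2 / D\<close>; this is why the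
        bounds above carry \<open>\<rho> ^ 6\<close>.\<close>
      have "\<rho> ^ 6 = \<rho> ^ 4 * D" unfolding \<rho>(2)[symmetric] by (simp flip: power_add)
      then have "\<rho> ^ 4 * (e * (c * M))\<^sup>2 = c\<^sup>2 * ((\<rho> ^ 6 * e\<^sup>2) * (M\<^sup>2 / D))" for e
        using D by (simp add: power_mult_distrib)
      then have v: "\<rho> ^ 4 * ((1 + 12 ^ N) * ((12 * \<rho> * T0 / b) ^ N / fact N) * (c * M))\<^sup>2
        = c\<^sup>2 * ((\<rho> ^ 6 * ((1 + 12 ^ N) * ((12 * \<rho> * T0 / b) ^ N / fact N))\<^sup>2) * (M\<^sup>2 / D))" .
      show ?thesis using cutoff_estimate_expand[OF est[OF \<rho>(1) N] A] unfolding u v by (simp add: mult_ac \<rho>(2))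
    qed
    have "Y \<le> C * (b ^ 11 * \<epsilon>\<^sup>2 + M\<^sup>2 / D)"
    proof (cases "D \<le> C")
      case True then show ?thesis by (rule big)
    next
      case False
      then have D1: "D \<ge> 1" using C1 by linarith
      define \<rho> where "\<rho> = sqrt D"
      have \<rho>: "\<rho> \<ge> 1" "\<rho>\<^sup>2 = D" "\<rho>\<^sup>2 = b * s\<^sup>2" "\<rho> > 0" unfolding \<rho>_def using D1 D by (auto simp: D_def)
      show ?thesis
      proof (cases "s ^ 4 \<le> b")
        case True
        note mb = moderate_frequency_bounds[OF b s True T0 \<rho>(3), folded KI_def]
        have "Y \<le> 6 * A * K * (\<rho> ^ 4 * (144 ^ 12 * \<epsilon>\<^sup>2 * (b * (b\<^sup>2 + 4 * \<rho>\<^sup>2))))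
          + 6 * A * c\<^sup>2 * ((\<rho> ^ 6 * ((1 + 12 ^ 12) * ((12 * \<rho> * T0 / b) ^ 12 / fact 12))\<^sup>2) * (M\<^sup>2 / D)) + M\<^sup>2 / D"
          by (rule expand[OF \<rho>(1,2)]) simp
        moreover have "6 * A * K * (\<rho> ^ 4 * (144 ^ 12 * \<epsilon>\<^sup>2 * (b * (b\<^sup>2 + 4 * \<rho>\<^sup>2)))) \<le> 6 * A * K * (5 * 144 ^ 12 * b ^ 11 * \<epsilon>\<^sup>2)"
          using mult_right_mono[OF mb(1), of "\<epsilon>\<^sup>2"] parts(1) by (intro mult_left_mono) (auto simp: mult_ac)
        moreover have "6 * A * c\<^sup>2 * ((\<rho> ^ 6 * ((1 + 12 ^ 12) * ((12 * \<rho> * T0 / b) ^ 12 / fact 12))\<^sup>2) * (M\<^sup>2 / D))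
          \<le> 6 * A * c\<^sup>2 * (KI * (M\<^sup>2 / D))"
          using mb(2) A D by (intro mult_left_mono mult_right_mono) auto
        moreover have "6 * A * K * (5 * 144 ^ 12) * (b ^ 11 * \<epsilon>\<^sup>2) \<le> C * (b ^ 11 * \<epsilon>\<^sup>2)"
          using C1 b by (intro mult_right_mono) auto
        moreover have "(6 * A * c\<^sup>2 * KI + 1) * (M\<^sup>2 / D) \<le> C * (M\<^sup>2 / D)"
          using C1 D by (intro mult_right_mono) auto
        ultimately show ?thesis unfolding distrib_left distrib_right mult.assoc by linarith
      next
        case bs: False
        have s1: "s > 1"
        proof (rule ccontr)
          assume "\<not> s > 1" then have "s ^ 4 \<le> 1" using s by (intro power_le_one) auto
          then show False using bs b by simp
        qed
        \<comment> \<open>Otherwise \<open>D \<le> s ^ 8 \<le> \<Lambda>\<^sup>2 \<le> \<Lambda> ^ 6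
          \<le> C\<close>, which belongs to the first regime. For this the constant contains
          \<open>\<Lambda> ^ 6\<close>.\<close>
        have lam: "\<Lambda> < s ^ 4"
        proof (rule ccontr)
          assume *: "\<not> \<Lambda> < s ^ 4"
          have "s\<^sup>2 \<le> s ^ 4" using s1 by (intro power_increasing) auto
          then have "D \<le> s ^ 4 * s ^ 4" unfolding D_def using bs b s1 by (intro mult_mono) auto
          also have "\<dots> \<le> \<Lambda> * \<Lambda>" using * s1 nn by (intro mult_mono) auto
          also have "\<dots> \<le> \<Lambda> ^ 6" using nn power_increasing[of 2 6 \<Lambda>] by (simp add: power2_eq_square)
          finally show False using C1 False by linarith
        qed
        moreover have "s ^ 4 \<le> s ^ 5" using s1 by (intro power_increasing) auto
        ultimately have "s ^ 5 \<ge> 36" "s ^ 4 \<ge> 5184 * T0" "b \<le> s ^ 4" using bs unfolding \<Lambda>_def by auto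
        then obtain N where N: "N > 0"
          and 1: "\<rho>\<^sup>2 * (\<rho> ^ 4 * (144 ^ N * \<epsilon>\<^sup>2 * (b * (b\<^sup>2 + 4 * \<rho>\<^sup>2)))) \<le> 3600"
          and 2: "\<rho> ^ 6 * ((1 + 12 ^ N) * ((12 * \<rho> * T0 / b) ^ N / fact N))\<^sup>2 \<le> KII"
          unfolding \<epsilon>s KII_def using small_data_bounds[OF b s1 _ T0 \<rho>(3,4)] by metis
        \<comment> \<open>For such small \<open>\<epsilon>\<close> even the data term is of size
          \<open>1 / D\<close>, so with \<open>M > 1\<close> it is charged to
          \<open>M\<^sup>2 / D\<close> instead of
          \<open>b ^ 11 * \<epsilon>\<^sup>2\<close>.\<close>
        have "\<rho> ^ 4 * (144 ^ N * \<epsilon>\<^sup>2 * (b * (b\<^sup>2 + 4 * \<rho>\<^sup>2))) \<le> 3600 / D"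
          using 1 D unfolding \<rho>(2) by (simp add: le_divide_eq mult_ac)
        also have "\<dots> \<le> 3600 * (M\<^sup>2 / D)" using M D one_le_power[of M 2] by (simp add: divide_right_mono)
        finally have "6 * A * K * (\<rho> ^ 4 * (144 ^ N * \<epsilon>\<^sup>2 * (b * (b\<^sup>2 + 4 * \<rho>\<^sup>2)))) \<le> 6 * A * K * (3600 * (M\<^sup>2 / D))"
          using parts(1) by (rule mult_left_mono)
        moreover have "6 * A * c\<^sup>2 * ((\<rho> ^ 6 * ((1 + 12 ^ N) * ((12 * \<rho> * T0 / b) ^ N / fact N))\<^sup>2) * (M\<^sup>2 / D))
          \<le> 6 * A * c\<^sup>2 * (KII * (M\<^sup>2 / D))"
          using 2 A D by (intro mult_left_mono mult_right_mono) auto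
        moreover have "(6 * A * K * 3600 + 6 * A * c\<^sup>2 * KII + 1) * (M\<^sup>2 / D) \<le> C * (M\<^sup>2 / D)"
          using C1 D by (intro mult_right_mono) auto
        moreover have "0 \<le> C * (b ^ 11 * \<epsilon>\<^sup>2)" using C1 b by auto
        moreover note expand[OF \<rho>(1,2) N]
        ultimately show ?thesis unfolding distrib_left distrib_right mult.assoc by linarith
      qed
    qed
    then show "Y \<le> C * (b ^ 11 * \<epsilon>\<^sup>2 + M\<^sup>2 / (b * \<bar>ln \<epsilon>\<bar> powr (2/5)))" unfolding s2 D_def .
  qed
qed

theorem theorem2p2:
  fixes R T\<^sub>0 :: real
  assumes "R > 0" and "T\<^sub>0 > 0"
  shows "\<exists>C>0. \<forall>(b::real) (M::real) (F::pt \<Rightarrow> real^3) (E::real \<Rightarrow> pt \<Rightarrow> real^3) (T::real) (\<epsilon>::real).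
     b > 1 \<longrightarrow> M > 1 \<longrightarrow>
     H4H1_bound F M \<longrightarrow>
     closure {p. F p \<noteq> 0} \<subseteq> ball 0 R \<times> {0<..<T\<^sub>0} \<longrightarrow>
     div_free F \<longrightarrow>
     (\<forall>n\<in>{0<..<b\<^sup>2}. maxwell_sol n F (E n)) \<longrightarrow>
     (\<forall>n\<in>{0<..<b\<^sup>2}. T > 2 * R * n + T\<^sub>0) \<longrightarrow>
     ereal \<epsilon> = (SUP n\<in>{0<..<b\<^sup>2}. ereal (sqrt (bdry_int R (E n) T))) \<longrightarrow>
     0 < \<epsilon> \<longrightarrow> \<epsilon> < 1 \<longrightarrow>
     (\<integral>p. (norm (F p))\<^sup>2 \<partial>lborel)
       \<le> C * (b ^ 11 * \<epsilon>\<^sup>2 + M\<^sup>2 / (b * \<bar>ln \<epsilon>\<bar> powr (2/5)))"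
proof -
  obtain B where B: "B > 0" "\<And>x. bump x \<le> B" by (rule bump_bounded, rule that)
  define K where "K = 2 * pi\<^sup>2 * R\<^sup>2 * (T\<^sub>0 + 2 * R) * (2 + 2 * (B / R)\<^sup>2)"
  define A where "A = (1 + 1 / (R + 2 * T\<^sub>0)) ^ 4"
  define c where "c = (measure lborel (ball 0 R \<times> {0<..<T\<^sub>0} :: pt set) + 1) / 2"
  have AK: "A \<ge> 0" "K \<ge> 0" unfolding A_def K_def using assms by auto
  show ?thesis
  proof (rule cutoff_optimization[OF AK assms(2), where c = c])
    fix C :: real
    assume C: "C > 0" and opt: "\<And>b M \<epsilon> Y. b > 1 \<Longrightarrow> M > 1 \<Longrightarrow> 0 < \<epsilon> \<Longrightarrow> \<epsilon> < 1 \<Longrightarrow> Y \<le> M\<^sup>2 \<Longrightarrow>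
      (\<And>\<rho> N. \<rho> \<ge> 1 \<Longrightarrow> N > 0 \<Longrightarrow> Y \<le> 3 * (A * \<rho> ^ 4 *
        (12 ^ N * (\<epsilon> * sqrt (K * (b * (b\<^sup>2 + 4 * \<rho>\<^sup>2)))) +
         (1 + 12 ^ N) * ((12 * \<rho> * T\<^sub>0 / b) ^ N / fact N) * (c * M))\<^sup>2) + M\<^sup>2 / \<rho>\<^sup>2) \<Longrightarrow>
      Y \<le> C * (b ^ 11 * \<epsilon>\<^sup>2 + M\<^sup>2 / (b * \<bar>ln \<epsilon>\<bar> powr (2/5)))"
    show ?thesis
    proof (rule exI[of _ C], intro conjI allI impI C)
      fix b M T \<epsilon> :: real and F :: "pt \<Rightarrow> real^3" and E :: "real \<Rightarrow> pt \<Rightarrow> real^3"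
      assume b: "b > 1" and M: "M > 1" and H: "H4H1_bound F M"
        and supp: "closure {p. F p \<noteq> 0} \<subseteq> ball 0 R \<times> {0<..<T\<^sub>0}"
        and df: "div_free F" and E: "\<forall>n\<in>{0<..<b\<^sup>2}. maxwell_sol n F (E n)"
        and T: "\<forall>n\<in>{0<..<b\<^sup>2}. T > 2 * R * n + T\<^sub>0"
        and eps: "ereal \<epsilon> = (SUP n\<in>{0<..<b\<^sup>2}. ereal (sqrt (bdry_int R (E n) T)))"
        and \<epsilon>: "0 < \<epsilon>" "\<epsilon> < 1"
      \<comment> \<open>The strict inequalities for all \<open>n\<close> below
        \<open>b\<^sup>2\<close> give the weak one at the endpoint. Density of the order also asks
        about \<open>n \<le> 0\<close>, where the instance \<open>b\<^sup>2 / 2\<close> shows that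
        the right side is nonnegative.\<close>
      have T': "2 * R * b\<^sup>2 + T\<^sub>0 \<le> T"
      proof -
        have "n \<le> (T - T\<^sub>0) / (2 * R)" if "n < b\<^sup>2" for n
        proof (cases "n > 0")
          case True then show ?thesis using T[rule_format, of n] that assms by (simp add: field_simps)
        next
          case False
          have "b\<^sup>2 / 2 \<in> {0<..<b\<^sup>2}" using b by simp
          then have "T > 2 * R * (b\<^sup>2 / 2) + T\<^sub>0" using T by blast
          moreover have "2 * R * (b\<^sup>2 / 2) \<ge> 0" using assms by simp
          ultimately have "(T - T\<^sub>0) / (2 * R) \<ge> 0" using assms by (intro divide_nonneg_pos) linarith+
          then show ?thesis using False by linarith
        qed
        then have "b\<^sup>2 \<le> (T - T\<^sub>0) / (2 * R)" by (rule dense_le)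
        then show ?thesis using assms by (simp add: field_simps)
      qed
      have bd: "bdry_int R (E n) T \<le> \<epsilon>\<^sup>2" if "n \<in> {0<..<b\<^sup>2}" for n
      proof -
        have "ereal (sqrt (bdry_int R (E n) T)) \<le> ereal \<epsilon>" unfolding eps by (rule SUP_upper[OF that])
        then have "sqrt (bdry_int R (E n) T) \<le> \<epsilon>" by simp
        then show ?thesis using sqrt_le_D by blast
      qed
      note cut = frequency_cutoff_estimate[OF assms b M df H supp E[rule_format] T' bd \<epsilon>(1) B(2) _ _ K_def c_def, folded A_def]
      have "L2sq F \<le> C * (b ^ 11 * \<epsilon>\<^sup>2 + M\<^sup>2 / (b * \<bar>ln \<epsilon>\<bar> powr (2/5)))"
        \<comment> \<open>The a priori bound \<open>cut(2)\<close> mentions neither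
          \<open>\<rho>\<close> nor \<open>N\<close>, so it is taken at the dummy values 1 and
          1.\<close>
        by (rule opt[OF b M \<epsilon> cut(2)[of 1 1] cut(1)]) auto
      then show "(\<integral>p. (norm (F p))\<^sup>2 \<partial>lborel) \<le> C * (b ^ 11 * \<epsilon>\<^sup>2 + M\<^sup>2 / (b * \<bar>ln \<epsilon>\<bar> powr (2/5)))"
        unfolding L2sq_def .
    qed
  qed
qed

end
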